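(* Let $\widetilde S$ be an elephant random walk on $\mathbb Z^d$ with fixed memory parameter $p\in[0,1)$, and let $\mathcal R_n:=\{\widetilde S_0,\ldots,\widetilde S_n\}$. (i) If $d=2$ and $p<5/8$, then $$\lim_{n\to\infty}\frac{\log n}{n}|\mathcal R_n|=\pi\qquad\text{in }L^1.$$ (ii) If $d\ge3$, then $$\lim_{n\to\infty}\frac{|\mathcal R_n|}{n}=\gamma_d\qquad\text{in }L^1.$$
   Context: Elephant random walk (ERW) on $\mathbb Z^d$ with memory parameter $p\in[0,1)$: the increments $X_1,X_2,\ldots$ take values in the $2d$ directions $\{\pm e_1,\ldots,\pm e_d\}$. $X_1$ is uniform on the $2d$ directions. At each time $n\ge2$, a time $u_n$ is chosen uniformly from $\{1,\ldots,n-1\}$ (independently of the past); with probability $p$ one sets $X_n=X_{u_n}$, and with probability $1-p$ one chooses $X_n$ uniformly from the other $2d-1$ directions. The walk is $\widetilde S_0=0$, $\widetilde S_n=\sum_{j=1}^nX_j$. For $d\ge3$, $\gamma_d:=1/g_d(0)$, where $g_d(0)$ is the Green function at the origin for simple random walk on $\mathbb Z^d$ (expected number of visits to the origin, time $0$ included); equivalently, $\gamma_d$ is the probability that simple random walk on $\mathbb Z^d$ started at the origin never returns there after time zero. $|\mathcal R_n|$ denotes the cardinality of $\mathcal R_n$. *)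

theory Defs
  imports "HOL-Probability.Probability"
begin

definition directions :: "(int ^ 'd::finite) set" where
  "directions = range (\<lambda>i. axis i 1) \<union> range (\<lambda>i. - axis i 1)"

text \<open>The walk driven by the increments \<open>X 1, X 2, \<dots>\<close> (the value \<open>X 0\<close> is not used).\<close>

definition walk :: "(nat \<Rightarrow> 'a \<Rightarrow> int ^ 'd::finite) \<Rightarrow> nat \<Rightarrow> 'a \<Rightarrow> int ^ 'd" where
  "walk X n \<omega> = (\<Sum>j=1..n. X j \<omega>)"

definition walk_range :: "(nat \<Rightarrow> 'a \<Rightarrow> int ^ 'd::finite) \<Rightarrow> nat \<Rightarrow> 'a \<Rightarrow> (int ^ 'd) set" where
  "walk_range X n \<omega> = (\<lambda>k. walk X k \<omega>) ` {0..n}"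

text \<open>The past before time \<open>n\<close>: the increments \<open>X 1, \<dots>, X (n - 1)\<close> are given by \<open>x\<close> and the
  remembered times \<open>u 2, \<dots>, u (n - 1)\<close> by \<open>v\<close>.\<close>

definition past ::
  "(nat \<Rightarrow> 'a \<Rightarrow> 'b) \<Rightarrow> (nat \<Rightarrow> 'a \<Rightarrow> nat) \<Rightarrow> nat \<Rightarrow> (nat \<Rightarrow> 'b) \<Rightarrow> (nat \<Rightarrow> nat) \<Rightarrow> 'a \<Rightarrow> bool" where
  "past X u n x v \<omega> \<longleftrightarrow>
     (\<forall>j\<in>{1..<n}. X j \<omega> = x j) \<and> (\<forall>j\<in>{2..<n}. u j \<omega> = v j)"

text \<open>The past takes countably many values, so the two-stage choice at time \<open>n\<close> (first \<open>u n\<close>,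
  then \<open>X n\<close>) is given by elementary conditional probabilities. Independence of \<open>u n\<close> from
  the past is part of \<open>memory_time\<close>, since the right-hand side there does not depend on
  \<open>x\<close> and \<open>v\<close>.\<close>

locale elephant_random_walk = prob_space M
  for M :: "'a measure" and p :: real
    and X :: "nat \<Rightarrow> 'a \<Rightarrow> int ^ 'd::finite" and u :: "nat \<Rightarrow> 'a \<Rightarrow> nat" +
  assumes increments: "\<And>n. n \<ge> 1 \<Longrightarrow> X n \<in> measurable M (count_space directions)"
    and memory_times: "\<And>n. n \<ge> 2 \<Longrightarrow> u n \<in> measurable M (count_space {1..n - 1})"
    and first_increment:
      "distr M (count_space directions) (X 1) = uniform_count_measure directions"
    and memory_time:
      "\<And>n x v k. n \<ge> 2 \<Longrightarrow> k \<in> {1..n - 1} \<Longrightarrow>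
         \<P>(\<omega> in M. past X u n x v \<omega>) > 0 \<Longrightarrow>
         \<P>(\<omega> in M. u n \<omega> = k \<bar> past X u n x v \<omega>) = 1 / (real n - 1)"
    and next_increment:
      "\<And>n x v k e. n \<ge> 2 \<Longrightarrow> k \<in> {1..n - 1} \<Longrightarrow> e \<in> directions \<Longrightarrow>
         \<P>(\<omega> in M. past X u n x v \<omega> \<and> u n \<omega> = k) > 0 \<Longrightarrow>
         \<P>(\<omega> in M. X n \<omega> = e \<bar> past X u n x v \<omega> \<and> u n \<omega> = k) =
           (if e = x k then p else (1 - p) / (2 * real CARD('d) - 1))"

text \<open>Simple random walk on the canonical space of its i.i.d. uniform increments, again indexed
  from 1. Its Green function is the expected number of visits to a site, time 0 included.\<close>

definition srw_space :: "(nat \<Rightarrow> int ^ 'd::finite) measure" where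
  "srw_space = (\<Pi>\<^sub>M j\<in>UNIV. measure_pmf (pmf_of_set directions))"

definition green :: "int ^ 'd::finite \<Rightarrow> ennreal" where
  "green x = (\<integral>\<^sup>+\<omega>. (\<Sum>n. indicator {x} (walk (\<lambda>j \<omega>. \<omega> j) n \<omega>)) \<partial>srw_space)"

text \<open>Since \<open>1 / \<infinity> = 0\<close> in \<open>ennreal\<close>, this is 0 when the walk is recurrent. The dimension
  is \<open>CARD('d)\<close>.\<close>

definition escape_rate :: "'d::finite itself \<Rightarrow> real" where
  "escape_rate _ = enn2real (1 / green (0 :: int ^ 'd))"

text \<open>Integrability is required explicitly because \<open>integral\<^sup>L\<close> is 0 on non-integrable functions.\<close>

definition tendsto_L1 :: "'a measure \<Rightarrow> (nat \<Rightarrow> 'a \<Rightarrow> real) \<Rightarrow> ('a \<Rightarrow> real) \<Rightarrow> bool" where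
  "tendsto_L1 M f g \<longleftrightarrow> (\<forall>n. integrable M (f n)) \<and> integrable M g \<and>
     (\<lambda>n. \<integral>\<omega>. \<bar>f n \<omega> - g \<omega>\<bar> \<partial>M) \<longlonglongrightarrow> 0"

end

theory Submission
  imports Defs "HOL-Real_Asymp.Real_Asymp"
begin

text \<open>Write \<open>d\<close> for the dimension and \<open>u = 1 / (2 d)\<close>. Given the past, the next increment of the
  elephant random walk equals \<open>e\<close> with probability \<open>u + a (f - u)\<close>, where \<open>f\<close> is the frequency of
  \<open>e\<close> so far and \<open>a = (2 d p - 1) / (2 d - 1) < 1\<close>. The frequencies converge to \<open>u\<close>, so the walk
  looks locally like simple random walk. What has to be controlled is the remaining drift over
  long times, and this is done by relative entropy. The Donsker-Varadhan inequality
  (\<open>donsker_varadhan\<close>) gives, for two ways \<open>P\<close>, \<open>Q\<close> of choosing the steps, for every event \<open>A\<close> and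
  every \<open>t > 0\<close>,
  \<open>P A \<le> (exp t - 1) / t * Q A + cost / t\<close>, where the cost is the expected sum over time of the
  chi-square distances between the one-step laws. If the cost is small, a small \<open>t\<close> shows that the
  two probabilities almost agree. If the cost is merely bounded, a large \<open>t\<close> shows that \<open>Q A \<longlonglongrightarrow> 0\<close>
  implies \<open>P A \<longlonglongrightarrow> 0\<close>.

  Upper bound for the mean (\<open>expected_range_le\<close>). The range counts first visits, and at a first visit the walk, read
  backwards, avoids its starting point for \<open>L\<close> steps. Over \<open>L\<close> steps after time \<open>k\<close> the cost with
  respect to simple random walk is at most a constant times \<open>L k powr (\<theta> - 1)\<close> whenever
  \<open>2 a < 1 + \<theta>\<close>, because the squared excess of the counts has mean of order \<open>k powr (1 + \<theta>)\<close>.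
  In at least three dimensions a
  fixed \<open>L\<close> and some \<open>\<theta> < 1\<close> suffice. In the plane the condition \<open>p < 5 / 8\<close> says \<open>2 a < 1\<close>, so that
  \<open>\<theta> = 0\<close> is possible, and \<open>L\<close> may be \<open>n / ln n ^ 4\<close>, whose logarithm is asymptotic to \<open>ln n\<close>;
  simple random walk avoids its starting point for \<open>L\<close> steps with probability \<open>\<sim> pi / ln L\<close>.

  Lower bound in probability (\<open>transient_lower_tail\<close>, \<open>planar_lower_tail\<close>). Discard the first
  \<open>n / N\<close> steps. On the remaining ones the cost stays bounded: in the plane with respect to simple
  random walk, and in higher dimensions with respect to independent steps whose laws follow the
  excess predicted at time \<open>n / N\<close> (the prediction solves \<open>m (k + 1) = m k (1 + a / k)\<close>, and the
  deviation from it is of diffusive order for every \<open>a < 1\<close>). It is then enough that the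
  range of the comparison walk is unlikely to be too small. This is Chebyshev's inequality
  (\<open>range_lower_tail\<close>): two first visits at times \<open>j < k\<close> require two successive avoidances, so
  the second moment of the range is asymptotically the square of its mean. For steps
  that are nearly uniform in at least three dimensions, late returns are excluded by the
  heat kernel bound \<open>heat_kernel_bound\<close>.

  For simple random walk itself, the avoidance probabilities follow from the renewal equation
  (\<open>renewal\<close>) and the return probabilities: these are summable in at least three dimensions, and
  in the plane they are squares of one-dimensional ones, whence the constant \<open>pi\<close> by Wallis'
  product. Finally, an upper bound for the mean and a lower bound in probability with the same
  constant give convergence in mean (\<open>L1_convergence_criterion\<close>).\<close>

section \<open>Expectations over finitely many random steps\<close>

text \<open>A path is the list of its steps, the newest first, so that the walk stands at \<open>sum_list xs\<close> and
  the position \<open>j\<close> steps ago is \<open>sum_list (drop j xs)\<close>. All laws considered have finitely many steps from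
  a finite set \<open>D\<close>, and the step law \<open>K xs\<close> depends on the whole path \<open>xs\<close>; expectations are thus finite
  sums, and conditioning on the past is starting from a nonempty path.\<close>

primrec expect ::
  "'b set \<Rightarrow> ('b list \<Rightarrow> 'b \<Rightarrow> real) \<Rightarrow> nat \<Rightarrow> ('b list \<Rightarrow> real) \<Rightarrow> 'b list \<Rightarrow> real" where
  "expect D K 0 f xs = f xs"
| "expect D K (Suc n) f xs = (\<Sum>e\<in>D. K xs e * expect D K n f (e # xs))"

abbreviation chance ::
  "'b set \<Rightarrow> ('b list \<Rightarrow> 'b \<Rightarrow> real) \<Rightarrow> nat \<Rightarrow> ('b list \<Rightarrow> bool) \<Rightarrow> 'b list \<Rightarrow> real" where
  "chance D K n A xs \<equiv> expect D K n (\<lambda>ys. of_bool (A ys)) xs"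

lemma expect_cong:
  assumes "\<And>zs. zs \<in> lists D \<Longrightarrow> length zs = n \<Longrightarrow> f (zs @ xs) = g (zs @ xs)"
  shows "expect D K n f xs = expect D K n g xs"
  using assms
proof (induction n arbitrary: xs)
  case (Suc n)
  have "expect D K n f (e # xs) = expect D K n g (e # xs)" if "e \<in> D" for e
    by (rule Suc.IH) (use Suc.prems[of "_ @ [e]"] that in auto)
  thus ?case by simp
qed auto

lemma expect_add_steps: "expect D K (m + n) f xs = expect D K m (expect D K n f) xs"
  by (induction m arbitrary: xs) auto

lemma expect_Suc_last:
  "expect D K (Suc n) f xs = expect D K n (\<lambda>ys. \<Sum>e\<in>D. K ys e * f (e # ys)) xs"
  by (induction n arbitrary: xs) simp_all

text \<open>This restarts the process at the empty path after conditioning on the initial path.\<close>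

lemma expect_append:
  "expect D K n f (ys @ xs) = expect D (\<lambda>zs. K (zs @ xs)) n (\<lambda>zs. f (zs @ xs)) ys"
  by (induction n arbitrary: ys) (auto simp flip: append_Cons)

lemma expect_plus:
  "expect D K n (\<lambda>ys. f ys + g ys) xs = expect D K n f xs + expect D K n g xs"
  by (induction n arbitrary: xs) (auto simp: algebra_simps sum.distrib)

lemma expect_cmult: "expect D K n (\<lambda>ys. c * f ys) xs = c * expect D K n f xs"
  by (induction n arbitrary: xs) (auto simp: sum_distrib_left mult_ac)

lemma expect_sum:
  "expect D K n (\<lambda>ys. \<Sum>i\<in>I. f i ys) xs = (\<Sum>i\<in>I. expect D K n (f i) xs)"
proof (induction n arbitrary: xs)
  case (Suc n)
  show ?case by (simp add: Suc sum_distrib_left) (rule sum.swap)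
qed auto

locale step_kernel =
  fixes D :: "'b set" and K :: "'b list \<Rightarrow> 'b \<Rightarrow> real"
  assumes finite_steps: "finite D"
    and nonneg: "xs \<in> lists D \<Longrightarrow> e \<in> D \<Longrightarrow> 0 \<le> K xs e"
    and total: "xs \<in> lists D \<Longrightarrow> (\<Sum>e\<in>D. K xs e) = 1"
begin

lemma expect_mono:
  assumes "xs \<in> lists D"
    and "\<And>zs. zs \<in> lists D \<Longrightarrow> length zs = n \<Longrightarrow> f (zs @ xs) \<le> g (zs @ xs)"
  shows "expect D K n f xs \<le> expect D K n g xs"
  using assms
proof (induction n arbitrary: xs)
  case (Suc n)
  have "expect D K n f (e # xs) \<le> expect D K n g (e # xs)" if "e \<in> D" for e
    by (rule Suc.IH) (use Suc.prems(1) Suc.prems(2)[of "_ @ [e]"] that in auto)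
  thus ?case using Suc.prems(1) nonneg by (auto intro!: sum_mono mult_left_mono)
qed auto

lemma expect_const: "xs \<in> lists D \<Longrightarrow> expect D K n (\<lambda>_. c) xs = c"
  by (induction n arbitrary: xs) (auto simp flip: sum_distrib_right simp: total)

lemma expect_lower:
  assumes "xs \<in> lists D"
    and "\<And>zs. zs \<in> lists D \<Longrightarrow> length zs = n \<Longrightarrow> c \<le> f (zs @ xs)"
  shows "c \<le> expect D K n f xs"
  using expect_mono[of xs n "\<lambda>_. c" f] expect_const assms by simp

lemma expect_upper:
  assumes "xs \<in> lists D"
    and "\<And>zs. zs \<in> lists D \<Longrightarrow> length zs = n \<Longrightarrow> f (zs @ xs) \<le> c"
  shows "expect D K n f xs \<le> c"
  using expect_mono[of xs n f "\<lambda>_. c"] expect_const assms by simp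

lemma chance_bounds:
  assumes "xs \<in> lists D"
  shows "0 \<le> chance D K n A xs" "chance D K n A xs \<le> 1"
  using assms by (auto intro!: expect_lower expect_upper)

lemma chance_not:
  "xs \<in> lists D \<Longrightarrow> chance D K n (\<lambda>ys. \<not> A ys) xs = 1 - chance D K n A xs"
proof -
  assume xs: "xs \<in> lists D"
  have "chance D K n (\<lambda>ys. \<not> A ys) xs + chance D K n A xs = expect D K n (\<lambda>_. 1) xs"
    unfolding expect_plus[symmetric] by (rule expect_cong) auto
  thus ?thesis using expect_const[OF xs] by simp
qed

lemma markov_inequality:
  assumes "xs \<in> lists D" and c: "0 < c"
    and "\<And>zs. zs \<in> lists D \<Longrightarrow> length zs = n \<Longrightarrow> 0 \<le> f (zs @ xs)"
    and "\<And>zs. zs \<in> lists D \<Longrightarrow> length zs = n \<Longrightarrow> A (zs @ xs) \<Longrightarrow> c \<le> f (zs @ xs)"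
  shows "chance D K n A xs \<le> expect D K n f xs / c"
proof -
  have "chance D K n A xs \<le> expect D K n (\<lambda>ys. (1 / c) * f ys) xs"
    by (rule expect_mono) (use assms in \<open>auto simp: field_simps\<close>)
  thus ?thesis by (simp only: expect_cmult) simp
qed

lemma shifted: "xs \<in> lists D \<Longrightarrow> step_kernel D (\<lambda>ys. K (ys @ xs))"
  by unfold_locales (use finite_steps nonneg total in \<open>auto intro!: nonneg total simp del: in_lists_conv_set\<close>)

end

section \<open>Comparing step laws by relative entropy\<close>

definition chi_square :: "'b set \<Rightarrow> ('b \<Rightarrow> real) \<Rightarrow> ('b \<Rightarrow> real) \<Rightarrow> real" where
  "chi_square D p q = (\<Sum>e\<in>D. (p e - q e)\<^sup>2 / q e)"

text \<open>The Gibbs variational principle for the relative entropy of \<open>p\<close> with respect to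
  \<open>q\<close>, with that entropy replaced by the larger chi-square distance. Both estimates come from
  \<open>ln x \<le> x - 1\<close>.\<close>

lemma gibbs_inequality:
  assumes "finite D"
    and p: "\<And>e. e \<in> D \<Longrightarrow> 0 \<le> p e" "(\<Sum>e\<in>D. p e) = 1"
    and q: "\<And>e. e \<in> D \<Longrightarrow> 0 < q e" "(\<Sum>e\<in>D. q e) = 1"
    and g: "\<And>e. e \<in> D \<Longrightarrow> 0 < g e"
  shows "(\<Sum>e\<in>D. p e * ln (g e)) \<le> ln (\<Sum>e\<in>D. q e * g e) + chi_square D p q"
proof -
  define G where "G = (\<Sum>e\<in>D. q e * g e)"
  have "D \<noteq> {}" using p by auto
  hence G: "G > 0" unfolding G_def using assms by (intro sum_pos) auto
  have 1: "p e * ln (g e) - p e * ln G \<le> (q e * g e / G - p e) + (p e * p e / q e - p e)"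
    if e: "e \<in> D" for e
  proof (cases "p e = 0")
    case True
    thus ?thesis using q(1)[OF e] g[OF e] G by simp
  next
    case False
    hence pe: "p e > 0" using p(1)[OF e] by simp
    have "ln (g e) - ln G = ln (q e * g e / (G * p e)) + ln (p e / q e)"
      using q(1)[OF e] g[OF e] G pe by (simp add: ln_mult ln_div)
    also have "\<dots> \<le> (q e * g e / (G * p e) - 1) + (p e / q e - 1)"
      using q(1)[OF e] g[OF e] G pe by (intro add_mono ln_le_minus_one) auto
    finally have "p e * (ln (g e) - ln G) \<le> p e * ((q e * g e / (G * p e) - 1) + (p e / q e - 1))"
      using pe by (intro mult_left_mono) auto
    thus ?thesis using pe G by (simp add: algebra_simps)
  qed
  have "(\<Sum>e\<in>D. p e * ln (g e)) - ln G = (\<Sum>e\<in>D. p e * ln (g e) - p e * ln G)"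
    using p(2) by (simp add: sum_subtractf flip: sum_distrib_right)
  also have "\<dots> \<le> (\<Sum>e\<in>D. (q e * g e / G - p e) + (p e * p e / q e - p e))"
    by (rule sum_mono) (rule 1)
  also have "\<dots> = G / G - (\<Sum>e\<in>D. p e) + ((\<Sum>e\<in>D. p e * p e / q e) - (\<Sum>e\<in>D. p e))"
    unfolding sum.distrib sum_subtractf by (simp add: G_def flip: sum_divide_distrib)
  also have "\<dots> = (\<Sum>e\<in>D. p e * p e / q e) - 1"
    using p(2) G by simp
  also have "\<dots> = chi_square D p q"
  proof -
    have "chi_square D p q = (\<Sum>e\<in>D. p e * p e / q e - 2 * p e + q e)"
      unfolding chi_square_def
    proof (rule sum.cong)
      fix e assume "e \<in> D"
      hence "q e \<noteq> 0" using q(1) by force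
      thus "(p e - q e)\<^sup>2 / q e = p e * p e / q e - 2 * p e + q e"
        by (simp add: power2_eq_square field_simps)
    qed simp
    thus ?thesis using p(2) q(2) by (simp add: sum.distrib sum_subtractf flip: sum_distrib_left)
  qed
  finally show ?thesis unfolding G_def by simp
qed

definition divergence_cost ::
  "'b set \<Rightarrow> ('b list \<Rightarrow> 'b \<Rightarrow> real) \<Rightarrow> ('b list \<Rightarrow> 'b \<Rightarrow> real) \<Rightarrow> nat \<Rightarrow> 'b list \<Rightarrow> real" where
  "divergence_cost D P Q n xs =
     (\<Sum>m<n. expect D P m (\<lambda>ys. chi_square D (P ys) (Q ys)) xs)"

text \<open>The one-step inequality is applied to the conditional expectations of \<open>exp f\<close>
  under \<open>Q\<close>, from the first step on; the chi-square distances add up along the path, averaged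
  under \<open>P\<close>.\<close>

lemma donsker_varadhan:
  assumes P: "step_kernel D P" and Q: "step_kernel D Q"
    and pos: "\<And>ys e. ys \<in> lists D \<Longrightarrow> e \<in> D \<Longrightarrow> 0 < Q ys e"
    and xs: "xs \<in> lists D"
  shows "expect D P n f xs
           \<le> ln (expect D Q n (\<lambda>ys. exp (f ys)) xs) + divergence_cost D P Q n xs"
  using xs
proof (induction n arbitrary: xs)
  case 0
  thus ?case by (simp add: divergence_cost_def)
next
  case (Suc n)
  interpret P: step_kernel D P by (rule P)
  interpret Q: step_kernel D Q by (rule Q)
  define g where "g = (\<lambda>e. expect D Q n (\<lambda>ys. exp (f ys)) (e # xs))"
  have gpos: "0 < expect D Q n (\<lambda>ys. exp (f ys)) ys" if "ys \<in> lists D" for ys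
    using that
  proof (induction n arbitrary: ys)
    case (Suc n)
    have "D \<noteq> {}" using Q.total[OF Suc.prems] by auto
    moreover have "0 < expect D Q n (\<lambda>ys. exp (f ys)) (e # ys)" if "e \<in> D" for e
      using Suc that by (intro Suc.IH) auto
    ultimately show ?case
      unfolding expect.simps using Suc.prems
      by (intro sum_pos mult_pos_pos pos Q.finite_steps)
  qed auto
  have "expect D P (Suc n) f xs
      \<le> (\<Sum>e\<in>D. P xs e * (ln (g e) + divergence_cost D P Q n (e # xs)))"
    unfolding g_def expect.simps
    by (intro sum_mono mult_left_mono Suc.IH P.nonneg) (use Suc.prems in auto)
  also have "\<dots> = (\<Sum>e\<in>D. P xs e * ln (g e))
      + (\<Sum>e\<in>D. P xs e * divergence_cost D P Q n (e # xs))"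
    by (simp add: algebra_simps sum.distrib)
  also have "(\<Sum>e\<in>D. P xs e * ln (g e))
      \<le> ln (\<Sum>e\<in>D. Q xs e * g e) + chi_square D (P xs) (Q xs)"
    by (rule gibbs_inequality)
       (use Suc.prems P.nonneg P.total Q.total Q.finite_steps pos gpos in \<open>auto simp: g_def\<close>)
  also have "(\<Sum>e\<in>D. P xs e * divergence_cost D P Q n (e # xs))
      = (\<Sum>m<n. expect D P (Suc m) (\<lambda>ys. chi_square D (P ys) (Q ys)) xs)"
    unfolding divergence_cost_def sum_distrib_left expect.simps by (rule sum.swap)
  finally show ?case
    unfolding divergence_cost_def sum.lessThan_Suc_shift by (simp add: g_def)
qed

text \<open>The case \<open>f = t * indicator of A\<close>. With large \<open>t\<close> this transfers
  null sequences of events under a bounded cost.\<close>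

lemma chance_change_of_measure:
  assumes P: "step_kernel D P" and Q: "step_kernel D Q"
    and pos: "\<And>ys e. ys \<in> lists D \<Longrightarrow> e \<in> D \<Longrightarrow> 0 < Q ys e"
    and xs: "xs \<in> lists D" and t: "0 < t"
  shows "chance D P n A xs \<le> (exp t - 1) / t * chance D Q n A xs + divergence_cost D P Q n xs / t"
proof -
  interpret Q: step_kernel D Q by (rule Q)
  have "t * chance D P n A xs = expect D P n (\<lambda>ys. t * of_bool (A ys)) xs"
    by (simp add: expect_cmult)
  also have "\<dots> \<le> ln (expect D Q n (\<lambda>ys. exp (t * of_bool (A ys))) xs) + divergence_cost D P Q n xs"
    by (rule donsker_varadhan) (use assms in auto)
  also have "expect D Q n (\<lambda>ys. exp (t * of_bool (A ys))) xs
      = expect D Q n (\<lambda>ys. 1 + (exp t - 1) * of_bool (A ys)) xs"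
    by (rule expect_cong) auto
  also have "\<dots> = 1 + (exp t - 1) * chance D Q n A xs"
    using xs by (simp add: expect_plus expect_cmult Q.expect_const)
  also have "ln \<dots> \<le> (exp t - 1) * chance D Q n A xs"
    using t Q.chance_bounds[OF xs] by (intro ln_add_one_self_le_self) auto
  finally show ?thesis using t by (simp add: field_simps)
qed

text \<open>With small \<open>t\<close> and a cost that is small compared to \<open>t\<close>, the two
  probabilities nearly agree.\<close>

lemma chance_compare:
  assumes P: "step_kernel D P" and Q: "step_kernel D Q"
    and pos: "\<And>ys e. ys \<in> lists D \<Longrightarrow> e \<in> D \<Longrightarrow> 0 < Q ys e"
    and xs: "xs \<in> lists D" and t: "0 < t" "t \<le> 1"
  shows "chance D P n A xs \<le> (1 + t) * chance D Q n A xs + divergence_cost D P Q n xs / t"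
    and "chance D Q n A xs - t - divergence_cost D P Q n xs / t \<le> chance D P n A xs"
proof -
  interpret P: step_kernel D P by (rule P)
  interpret Q: step_kernel D Q by (rule Q)
  have "exp t \<le> 1 + t + t\<^sup>2" using t by (intro exp_bound) auto
  hence e: "(exp t - 1) / t \<le> 1 + t" using t by (simp add: field_simps power2_eq_square)
  have *: "chance D P n A xs \<le> (1 + t) * chance D Q n A xs + divergence_cost D P Q n xs / t" for A
    using chance_change_of_measure[OF P Q pos xs t(1), of n A]
      mult_right_mono[OF e Q.chance_bounds(1)[OF xs, of n A]] by linarith
  show "chance D P n A xs \<le> (1 + t) * chance D Q n A xs + divergence_cost D P Q n xs / t"
    by (rule *)
  have "t * chance D Q n A xs \<ge> 0" using t Q.chance_bounds(1)[OF xs, of n A] by simp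
  thus "chance D Q n A xs - t - divergence_cost D P Q n xs / t \<le> chance D P n A xs"
    using *[of "\<lambda>ys. \<not> A ys"] by (simp add: P.chance_not Q.chance_not xs algebra_simps)
qed


section \<open>First visits and the second moment of the range\<close>

primrec sites :: "'b::ab_group_add list \<Rightarrow> 'b set" where
  "sites [] = {0}"
| "sites (x # xs) = insert (x + sum_list xs) (sites xs)"

text \<open>The last \<open>m\<close> steps, read backwards, form a walk that does not return to its
  start. For \<open>m\<close> equal to the length of the path this says that its end point is visited for
  the first time.\<close>

definition avoids :: "nat \<Rightarrow> 'b::ab_group_add list \<Rightarrow> bool" where
  "avoids m xs \<longleftrightarrow> (\<forall>j\<in>{1..m}. sum_list (take j xs) \<noteq> 0)"

lemma finite_sites [simp]: "finite (sites xs)"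
  by (induction xs) auto

lemma sites_eq: "sites xs = (\<lambda>j. sum_list (drop j xs)) ` {..length xs}"
proof (induction xs)
  case (Cons x xs)
  have "(\<lambda>j. sum_list (drop j (x # xs))) ` {..length (x # xs)}
      = insert (x + sum_list xs) ((\<lambda>j. sum_list (drop j xs)) ` {..length xs})"
    by (simp add: atMost_Suc_eq_insert_0 image_image)
  thus ?case using Cons by simp
qed auto

lemma sum_list_split: "sum_list xs = sum_list (take j xs) + sum_list (drop j xs)"
  for xs :: "'b::ab_group_add list"
  by (metis append_take_drop_id sum_list_append)

lemma new_site_iff_avoids:
  "x + sum_list xs \<notin> sites xs \<longleftrightarrow> avoids (Suc (length xs)) (x # xs)"
proof -
  have "x + sum_list xs \<in> sites xs \<longleftrightarrow> (\<exists>j\<in>{..length xs}. sum_list (take (Suc j) (x # xs)) = 0)"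
    unfolding sites_eq image_iff
  proof (rule bex_cong)
    fix j
    show "x + sum_list xs = sum_list (drop j xs) \<longleftrightarrow> sum_list (take (Suc j) (x # xs)) = 0"
      by (subst sum_list_split[of xs j]) (simp add: add.assoc[symmetric])
  qed simp
  also have "\<dots> \<longleftrightarrow> (\<exists>j\<in>{1..Suc (length xs)}. sum_list (take j (x # xs)) = 0)"
    unfolding image_Suc_atMost[symmetric] by blast
  finally show ?thesis by (auto simp: avoids_def)
qed

lemma card_sites_Cons:
  "card (sites (x # xs)) = card (sites xs) + of_bool (avoids (Suc (length xs)) (x # xs))"
  using new_site_iff_avoids[of x xs] by (auto simp: card_insert_if)

text \<open>The sites seen by the newer part \<open>ys\<close> are a translate of \<open>sites ys\<close>,
  so discarding an initial part of the path only decreases the range.\<close>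

lemma card_sites_append: "card (sites ys) \<le> card (sites (ys @ xs))"
proof -
  have "(\<lambda>z. z + sum_list xs) ` sites ys \<subseteq> sites (ys @ xs)"
  proof (induction ys)
    case Nil
    show ?case by (cases xs) auto
  qed (auto simp: add_ac)
  hence "card ((\<lambda>z. z + sum_list xs) ` sites ys) \<le> card (sites (ys @ xs))"
    by (intro card_mono) auto
  thus ?thesis by (simp add: card_image)
qed

lemma card_sites_eq_sum:
  "card (sites xs) = 1 + (\<Sum>k=1..length xs. of_bool (avoids k (drop (length xs - k) xs)))"
proof (induction xs)
  case (Cons x xs)
  let ?f = "\<lambda>xs :: 'a list. \<lambda>k. of_bool (avoids k (drop (length xs - k) xs)) :: nat"
  have "(\<Sum>k=1..length xs. ?f xs k) = (\<Sum>k=1..length xs. ?f (x # xs) k)"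
    by (intro sum.cong) (auto simp: Suc_diff_le)
  moreover have "(\<Sum>k=1..length (x # xs). ?f (x # xs) k)
      = (\<Sum>k=1..length xs. ?f (x # xs) k) + ?f (x # xs) (Suc (length xs))"
    unfolding length_Cons by (subst sum.cl_ivl_Suc) simp
  moreover have "?f (x # xs) (Suc (length xs)) = of_bool (avoids (Suc (length xs)) (x # xs))"
    by simp
  ultimately show ?case using Cons by (simp only: card_sites_Cons add.assoc)
qed simp

lemma avoids_mono: "avoids m xs \<Longrightarrow> l \<le> m \<Longrightarrow> avoids l xs"
  by (auto simp: avoids_def)

lemma avoids_take: "l \<le> m \<Longrightarrow> avoids l (take m xs) \<longleftrightarrow> avoids l xs"
  by (auto simp: avoids_def min_def intro!: ball_cong)


lemma expect_drop1:
  fixes D :: "'b::ab_group_add set"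
  assumes "step_kernel D K"
  shows "expect D K (Suc n) (\<lambda>ys. F (drop 1 ys)) [] = expect D K n F []"
proof -
  interpret step_kernel D K by fact
  have "expect D K (Suc n) (\<lambda>ys. F (drop 1 ys)) [] = expect D K n (\<lambda>ys. (\<Sum>e\<in>D. K ys e) * F ys) []"
    by (simp add: expect_Suc_last sum_distrib_right del: expect.simps)
  also have "\<dots> = expect D K n F []" by (rule expect_cong) (simp add: total)
  finally show ?thesis .
qed

lemma expect_card_sites:
  fixes D :: "'b::ab_group_add set"
  assumes K: "step_kernel D K"
  shows "expect D K n (\<lambda>ys. real (card (sites ys))) []
     = 1 + (\<Sum>k=1..n. chance D K k (avoids k) [])"
proof (induction n)
  case (Suc n)
  have "expect D K (Suc n) (\<lambda>ys. real (card (sites ys))) []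
      = expect D K (Suc n) (\<lambda>ys. real (card (sites (drop 1 ys))) + of_bool (avoids (Suc n) ys)) []"
  proof (rule expect_cong)
    fix zs :: "'b list" assume "length zs = Suc n"
    then obtain y ys where "zs = y # ys" "length ys = n" by (cases zs) auto
    thus "real (card (sites (zs @ []))) = real (card (sites (drop 1 (zs @ [])))) + of_bool (avoids (Suc n) (zs @ []))"
      by (simp add: card_sites_Cons del: sites.simps)
  qed
  also have "\<dots> = expect D K n (\<lambda>ys. real (card (sites ys))) [] + chance D K (Suc n) (avoids (Suc n)) []"
    by (simp only: expect_plus expect_drop1[OF K, where F = "\<lambda>ys. real (card (sites ys))"])
  finally show ?case using Suc by simp
qed simp

text \<open>First visits at times \<open>j < k\<close> imply that the first \<open>j\<close> steps avoid
  and that the \<open>k - j\<close> steps after them avoid. If both numbers are at least \<open>A\<close>,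
  this has probability at most \<open>\<rho>\<^sup>2\<close>; the at most \<open>2 * A\<close> other values
  of \<open>j\<close> are estimated trivially.\<close>

lemma second_moment_new_sites:
  fixes D :: "'b::ab_group_add set"
  assumes Q: "step_kernel D Q" and rho: "0 \<le> \<rho>"
    and U: "\<And>xs m. xs \<in> lists D \<Longrightarrow> A \<le> m \<Longrightarrow> length xs + m \<le> T \<Longrightarrow> chance D Q m (avoids m) xs \<le> \<rho>"
    and "n \<le> T"
  shows "expect D Q n (\<lambda>ys. (real (card (sites ys)) - 1)\<^sup>2) []
           \<le> real n ^ 2 * \<rho>\<^sup>2 + real n * (4 * real A + 1)"
  using \<open>n \<le> T\<close>
proof (induction n)
  case (Suc n)
  interpret step_kernel D Q by fact
  define N where "N = (\<lambda>ys :: 'b list. real (card (sites ys)) - 1)"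
  define first where "first = (\<lambda>k (ys :: 'b list). of_bool (avoids k ys) :: real)"
  have N_sum: "N ys = (\<Sum>k=1..length ys. first k (drop (length ys - k) ys))" for ys
    unfolding N_def first_def by (simp add: card_sites_eq_sum)
  have bound: "chance D Q m (avoids m) xs \<le> (if A \<le> m then \<rho> else 1)"
    if "xs \<in> lists D" "length xs + m \<le> T" for xs m
    using U[OF that(1) _ that(2)] chance_bounds(2)[OF that(1)] by simp
  \<comment> \<open>the first \<open>j\<close> steps avoid, and after them the other \<open>m\<close> steps avoid\<close>
  have pair: "expect D Q (Suc n) (\<lambda>ys. first j (drop (Suc n - j) ys) * first (Suc n) ys) []
      \<le> \<rho>\<^sup>2 + of_bool (j < A) + of_bool (Suc n - j < A)" if j: "j \<in> {1..n}" for j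
  proof -
    let ?b = "\<lambda>m. if A \<le> m then \<rho> else (1::real)"
    define m where "m = Suc n - j"
    have Sn: "Suc n = j + m" using j by (auto simp: m_def)
    have "expect D Q (Suc n) (\<lambda>ys. first j (drop m ys) * first (Suc n) ys) []
        \<le> expect D Q (j + m) (\<lambda>ys. first j (drop m ys) * first m ys) []"
      unfolding Sn by (rule expect_mono)
        (auto simp: first_def dest: avoids_mono[of "j + m" _ m])
    also have "\<dots> = expect D Q j (\<lambda>xs. first j xs * chance D Q m (avoids m) xs) []"
      unfolding expect_add_steps expect_cmult[symmetric]
      by (intro expect_cong) (auto simp: first_def)
    also have "\<dots> \<le> expect D Q j (\<lambda>xs. ?b m * first j xs) []"
      using Suc.prems Sn
      by (intro expect_mono) (auto simp: first_def intro!: order.trans[OF bound] simp del: in_lists_conv_set)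
    also have "\<dots> \<le> ?b m * ?b j"
      unfolding expect_cmult first_def using Suc.prems Sn rho
      by (intro mult_left_mono bound) auto
    also have "\<dots> \<le> \<rho>\<^sup>2 + of_bool (j < A) + of_bool (m < A)"
    proof -
      have "\<rho> \<le> 1 + \<rho>\<^sup>2" using zero_le_power2[of "\<rho> - 1"] rho by (simp add: power2_diff)
      thus ?thesis by (auto simp: power2_eq_square)
    qed
    finally show ?thesis unfolding m_def .
  qed
  have card_lt: "(\<Sum>j=1..n. of_bool (j < A)) \<le> real A" "(\<Sum>j=1..n. of_bool (Suc n - j < A)) \<le> real A"
  proof -
    have "(\<Sum>j=1..n. of_bool (j < A) :: real) = real (card {j\<in>{1..n}. j < A})"
      by (simp add: sum.If_cases of_bool_def Int_def flip: sum.inter_filter)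
    also have "card {j\<in>{1..n}. j < A} \<le> card {..<A}" by (intro card_mono) auto
    finally show 1: "(\<Sum>j=1..n. of_bool (j < A)) \<le> real A" by simp
    have "(\<Sum>j=1..n. of_bool (Suc n - j < A) :: real) = (\<Sum>j=1..n. of_bool (j < A))"
      by (rule sum.reindex_bij_witness[of _ "\<lambda>j. Suc n - j" "\<lambda>j. Suc n - j"]) auto
    thus "(\<Sum>j=1..n. of_bool (Suc n - j < A)) \<le> real A" using 1 by simp
  qed
  have "expect D Q (Suc n) (\<lambda>ys. (N ys)\<^sup>2) []
      = expect D Q (Suc n) (\<lambda>ys. (N (drop 1 ys))\<^sup>2
          + (2 * (\<Sum>j=1..n. first j (drop (Suc n - j) ys) * first (Suc n) ys) + first (Suc n) ys)) []"
  proof (rule expect_cong)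
    fix zs :: "'b list" assume "length zs = Suc n"
    then obtain y ys where zs: "zs = y # ys" "length ys = n" by (cases zs) auto
    have 1: "N (y # ys) = N ys + first (Suc n) (y # ys)"
      unfolding N_def first_def using zs by (simp add: card_sites_Cons del: sites.simps)
    have 2: "N ys = (\<Sum>j=1..n. first j (drop (Suc n - j) zs))"
      unfolding N_sum using zs by (intro sum.cong) (auto simp: Suc_diff_le)
    have 3: "(first (Suc n) zs)\<^sup>2 = first (Suc n) zs" by (simp add: first_def)
    have "(N zs)\<^sup>2 = (N ys)\<^sup>2 + (2 * (N ys * first (Suc n) zs) + first (Suc n) zs)"
      using 1 3 zs by (simp add: power2_sum)
    also have "N ys * first (Suc n) zs = (\<Sum>j=1..n. first j (drop (Suc n - j) zs) * first (Suc n) zs)"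
      unfolding 2 by (simp add: sum_distrib_right)
    finally show "(N (zs @ []))\<^sup>2 = (N (drop 1 (zs @ [])))\<^sup>2
          + (2 * (\<Sum>j=1..n. first j (drop (Suc n - j) (zs @ [])) * first (Suc n) (zs @ [])) + first (Suc n) (zs @ []))"
      using zs by simp
  qed
  also have "\<dots> = expect D Q n (\<lambda>ys. (N ys)\<^sup>2) []
      + (2 * (\<Sum>j=1..n. expect D Q (Suc n) (\<lambda>ys. first j (drop (Suc n - j) ys) * first (Suc n) ys) [])
         + chance D Q (Suc n) (avoids (Suc n)) [])"
    unfolding expect_plus expect_cmult expect_sum
    by (simp only: expect_drop1[OF Q, where F = "\<lambda>ys. (N ys)\<^sup>2"] first_def)
  also have "\<dots> \<le> (real n ^ 2 * \<rho>\<^sup>2 + real n * (4 * real A + 1))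
      + (2 * (\<Sum>j=1..n. \<rho>\<^sup>2 + of_bool (j < A) + of_bool (Suc n - j < A)) + 1)"
    using Suc unfolding N_def
    by (intro add_mono mult_left_mono sum_mono pair chance_bounds) auto
  also have "(\<Sum>j=1..n. \<rho>\<^sup>2 + of_bool (j < A) + of_bool (Suc n - j < A)) \<le> real n * \<rho>\<^sup>2 + real A + real A"
    unfolding sum.distrib using card_lt by (intro add_mono) auto
  finally have "expect D Q (Suc n) (\<lambda>ys. (N ys)\<^sup>2) []
      \<le> real n ^ 2 * \<rho>\<^sup>2 + real n * (4 * real A + 1) + (2 * (real n * \<rho>\<^sup>2 + real A + real A) + 1)"
    by simp
  also have "\<dots> \<le> real (Suc n) ^ 2 * \<rho>\<^sup>2 + real (Suc n) * (4 * real A + 1)"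
    by (simp add: power2_eq_square algebra_simps)
  finally show ?case unfolding N_def .
qed simp

text \<open>Chebyshev's inequality for the number of new sites around \<open>\<rho> * T\<close>. The bound
  is small if the lower bound \<open>l\<close> and the upper bound \<open>\<rho>\<close> for the avoidance
  probabilities are close to each other and \<open>A\<close> is small compared to
  \<open>\<rho>\<^sup>2 * T\<close>.\<close>

lemma range_lower_tail:
  fixes D :: "'b::ab_group_add set"
  assumes Q: "step_kernel D Q" and rho: "0 < \<rho>" and s: "0 < s" and A: "1 \<le> A" and T: "1 \<le> T"
    and U: "\<And>xs m. xs \<in> lists D \<Longrightarrow> A \<le> m \<Longrightarrow> length xs + m \<le> T \<Longrightarrow> chance D Q m (avoids m) xs \<le> \<rho>"
    and L: "\<And>k. 1 \<le> k \<Longrightarrow> k \<le> T \<Longrightarrow> l \<le> chance D Q k (avoids k) []"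
  shows "chance D Q T (\<lambda>ys. real (card (sites ys)) \<le> (1 - s) * \<rho> * real T) []
           \<le> (2 * (1 - l / \<rho>) + 5 * real A / (\<rho>\<^sup>2 * real T)) / s\<^sup>2"
proof -
  interpret step_kernel D Q by fact
  define N where "N = (\<lambda>ys :: 'b list. real (card (sites ys)) - 1)"
  have EN: "real T * l \<le> expect D Q T N []"
  proof -
    have "expect D Q T N [] + 1 = expect D Q T (\<lambda>ys. real (card (sites ys))) []"
      using expect_plus[of D Q T N "\<lambda>_. 1" "[]"] by (simp add: N_def expect_const)
    hence "expect D Q T N [] = (\<Sum>k=1..T. chance D Q k (avoids k) [])"
      unfolding expect_card_sites[OF Q] by simp
    also have "\<dots> \<ge> (\<Sum>k=1..T. l)" using L by (intro sum_mono) auto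
    finally show ?thesis by simp
  qed
  have E2: "expect D Q T (\<lambda>ys. (N ys)\<^sup>2) [] \<le> real T ^ 2 * \<rho>\<^sup>2 + real T * (4 * real A + 1)"
    unfolding N_def by (rule second_moment_new_sites[OF Q _ U]) (use rho in auto)
  have "chance D Q T (\<lambda>ys. real (card (sites ys)) \<le> (1 - s) * \<rho> * real T) []
      \<le> expect D Q T (\<lambda>ys. (N ys - \<rho> * real T)\<^sup>2) [] / (s * \<rho> * real T)\<^sup>2"
  proof (rule markov_inequality)
    show "0 < (s * \<rho> * real T)\<^sup>2" using s rho T by simp
    fix zs :: "'b list" assume "real (card (sites (zs @ []))) \<le> (1 - s) * \<rho> * real T"
    hence "s * \<rho> * real T \<le> \<rho> * real T - N (zs @ [])" by (simp add: N_def algebra_simps)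
    hence "(s * \<rho> * real T)\<^sup>2 \<le> (\<rho> * real T - N (zs @ []))\<^sup>2"
      using s rho by (intro power_mono) auto
    thus "(s * \<rho> * real T)\<^sup>2 \<le> (N (zs @ []) - \<rho> * real T)\<^sup>2" by (simp add: power2_commute)
  qed auto
  also have "expect D Q T (\<lambda>ys. (N ys - \<rho> * real T)\<^sup>2) []
      = expect D Q T (\<lambda>ys. (N ys)\<^sup>2 + ((- 2 * \<rho> * real T) * N ys + (\<rho> * real T)\<^sup>2)) []"
    by (rule expect_cong) (simp add: power2_eq_square algebra_simps)
  also have "\<dots> = expect D Q T (\<lambda>ys. (N ys)\<^sup>2) [] - 2 * \<rho> * real T * expect D Q T N [] + (\<rho> * real T)\<^sup>2"
    unfolding expect_plus expect_cmult by (simp add: expect_const)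
  also have "\<dots> \<le> (real T ^ 2 * \<rho>\<^sup>2 + real T * (4 * real A + 1)) - 2 * \<rho> * real T * (real T * l) + (\<rho> * real T)\<^sup>2"
    using EN E2 rho by (intro add_mono diff_mono mult_left_mono) auto
  also have "\<dots> \<le> 2 * \<rho> * (\<rho> - l) * real T ^ 2 + 5 * real A * real T"
  proof -
    have "real T * 1 \<le> real T * real A" using A by (intro mult_left_mono) auto
    thus ?thesis by (simp add: power2_eq_square algebra_simps)
  qed
  also have "(2 * \<rho> * (\<rho> - l) * real T ^ 2 + 5 * real A * real T) / (s * \<rho> * real T)\<^sup>2
      = (2 * (1 - l / \<rho>) + 5 * real A / (\<rho>\<^sup>2 * real T)) / s\<^sup>2"
    using rho s T by (simp add: field_simps power2_eq_square)
  finally show ?thesis by (simp add: divide_right_mono)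
qed


section \<open>Steps reinforced by their own frequencies\<close>

lemma powr_Bernoulli:
  fixes y s :: real
  assumes "1 \<le> y" "1 \<le> s"
  shows "1 + s * (y - 1) \<le> y powr s"
proof -
  have "1 powr s - s * 1 \<le> y powr s - s * y"
  proof (rule DERIV_nonneg_imp_nondecreasing[of 1 y])
    fix x assume x: "1 \<le> x" "x \<le> y"
    have "((\<lambda>y. y powr s - s * y) has_real_derivative (s * x powr (s - 1) - s)) (at x)"
      using x by (auto intro!: derivative_eq_intros)
    moreover have "s * 1 \<le> s * x powr (s - 1)"
      using x assms by (intro mult_left_mono ge_one_powr_ge_zero) auto
    ultimately show "\<exists>z. ((\<lambda>y. y powr s - s * y) has_real_derivative z) (at x) \<and> 0 \<le> z"
      by (intro exI conjI) auto
  qed (use assms in auto)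
  thus ?thesis by (simp add: algebra_simps)
qed

text \<open>The step law of the elephant random walk for an arbitrary finite set of steps. Negative
  \<open>a\<close> means that frequent steps are avoided; the last assumption makes the step probabilities
  nonnegative, and \<open>- 1 / 2 \<le> a\<close> keeps the factor \<open>1 + 2 * a / k\<close> in the
  second moment recursion nonnegative.\<close>

locale reinforced_steps =
  fixes D :: "'b::ab_group_add set" and a :: real
  assumes finite_D: "finite D" and D_nonempty: "D \<noteq> {}"
    and a_less: "a < 1" and a_ge: "- 1 / 2 \<le> a"
    and a_card: "0 \<le> (1 - a) / real (card D) + a"
begin

definition u :: real where "u = 1 / real (card D)"

definition uniform :: "'b list \<Rightarrow> 'b \<Rightarrow> real" where "uniform xs e = u"

definition excess :: "'b list \<Rightarrow> 'b \<Rightarrow> real" where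
  "excess xs e = real (count_list xs e) - u * real (length xs)"

text \<open>On the empty path the fraction is \<open>0 / 0 = 0\<close>, so that the first step is
  uniform.\<close>

definition elephant :: "'b list \<Rightarrow> 'b \<Rightarrow> real" where
  "elephant xs e = u + a * excess xs e / real (length xs)"

lemma card_D: "0 < card D" using finite_D D_nonempty by (simp add: card_gt_0_iff)

lemma u_pos: "0 < u" and u_le_1: "u \<le> 1" and card_u: "real (card D) * u = 1"
  using card_D by (auto simp: u_def)

lemma uniform_kernel: "step_kernel D uniform"
  by unfold_locales (use finite_D u_pos card_u in \<open>auto simp: uniform_def\<close>)

lemma sum_excess: "xs \<in> lists D \<Longrightarrow> (\<Sum>e\<in>D. excess xs e) = 0"
proof -
  assume "xs \<in> lists D"
  hence "set xs \<subseteq> D" by auto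
  hence "(\<Sum>e\<in>D. count_list xs e) = length xs" by (rule sum_count_set) (rule finite_D)
  hence "(\<Sum>e\<in>D. real (count_list xs e)) = real (length xs)" by (metis of_nat_sum)
  thus ?thesis using card_u by (simp add: excess_def sum_subtractf)
qed

lemma excess_Cons: "excess (x # xs) e = excess xs e + (of_bool (x = e) - u)"
  by (auto simp: excess_def algebra_simps)

lemma elephant_kernel: "step_kernel D elephant"
proof
  show "finite D" by (rule finite_D)
  fix xs assume xs: "xs \<in> lists D"
  show "(\<Sum>e\<in>D. elephant xs e) = 1"
    using sum_excess[OF xs] card_u
    by (simp add: elephant_def sum.distrib flip: sum_divide_distrib sum_distrib_left)
  fix e assume "e \<in> D"
  show "0 \<le> elephant xs e"
  proof (cases "xs = []")
    case True
    thus ?thesis using u_pos by (simp add: elephant_def)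
  next
    case False
    define c where "c = real (count_list xs e) / real (length xs)"
    have c: "0 \<le> c" "c \<le> 1" unfolding c_def using count_le_length[of xs e] by (auto simp: divide_le_eq)
    have "elephant xs e = (1 - c) * ((1 - a) * u) + c * ((1 - a) * u + a)"
      using False by (simp add: elephant_def excess_def c_def field_simps)
    also have "\<dots> \<ge> 0" using c u_pos a_less a_card by (auto simp: u_def)
    finally show ?thesis by simp
  qed
qed

sublocale E: step_kernel D elephant by (rule elephant_kernel)
sublocale U: step_kernel D uniform by (rule uniform_kernel)

lemma uniform_pos: "0 < uniform xs e" using u_pos by (simp add: uniform_def)

text \<open>At time \<open>k = length xs\<close>, the difference between the excess and a prediction
  \<open>m\<close> is multiplied on average by \<open>1 + a / k\<close>, if the prediction is multiplied by
  this factor; here \<open>q - u = a * m / k\<close> is the increment of the prediction. The noise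
  contributes at most 1 to the second moment. The case \<open>m = 0\<close>, \<open>q = u\<close> is the
  excess itself.\<close>

lemma excess_second_moment_step:
  assumes xs: "xs \<in> lists D" and e: "e \<in> D"
    and q: "q = u + a * m / real (length xs)" "0 \<le> q" "q \<le> 1"
  shows "(\<Sum>x\<in>D. elephant xs x * (excess (x # xs) e - (m + (q - u)))\<^sup>2)
           \<le> (1 + 2 * a / real (length xs)) * (excess xs e - m)\<^sup>2 + 1"
proof -
  define V where "V = excess xs e - m"
  have sum_of: "(\<Sum>x\<in>D. elephant xs x * of_bool (x = e)) = elephant xs e"
    using e finite_D by (simp add: of_bool_def sum.delta if_distrib cong: if_cong)
  have "(\<Sum>x\<in>D. elephant xs x * (excess (x # xs) e - (m + (q - u)))\<^sup>2)
      = (\<Sum>x\<in>D. V\<^sup>2 * elephant xs x + 2 * V * (elephant xs x * of_bool (x = e) - q * elephant xs x)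
          + elephant xs x * (of_bool (x = e) - q)\<^sup>2)"
    by (rule sum.cong) (auto simp: excess_Cons V_def power2_eq_square algebra_simps)
  also have "\<dots> = V\<^sup>2 + 2 * V * (elephant xs e - q) + (\<Sum>x\<in>D. elephant xs x * (of_bool (x = e) - q)\<^sup>2)"
    unfolding sum.distrib sum_distrib_left[symmetric] sum_subtractf sum_of E.total[OF xs] by simp
  also have "2 * V * (elephant xs e - q) = 2 * a / real (length xs) * V\<^sup>2"
    unfolding q(1) elephant_def V_def by (simp add: power2_eq_square diff_divide_distrib algebra_simps)
  also have "(\<Sum>x\<in>D. elephant xs x * (of_bool (x = e) - q)\<^sup>2) \<le> (\<Sum>x\<in>D. elephant xs x * 1)"
  proof (intro sum_mono mult_left_mono E.nonneg xs)
    fix x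
    have "\<bar>of_bool (x = e) - q\<bar> \<le> 1" using q(2,3) by auto
    thus "(of_bool (x = e) - q)\<^sup>2 \<le> 1" by (simp add: abs_square_le_1)
  qed
  finally show ?thesis using E.total[OF xs] unfolding V_def by (simp add: algebra_simps)
qed

text \<open>The right-hand side is a supersolution of
  \<open>y (k + 1) = (1 + 2 * a / k) * y k + 1\<close>, by Bernoulli's inequality. The exponent
  \<open>1 + \<theta> = 1\<close> is the diffusive case; in general \<open>\<theta> < 1\<close> can be
  chosen, since \<open>a < 1\<close>.\<close>

lemma excess_second_moment:
  assumes \<theta>: "0 \<le> \<theta>" "2 * a < 1 + \<theta>" and e: "e \<in> D"
  shows "expect D elephant n (\<lambda>ys. (excess ys e)\<^sup>2) []
           \<le> (1 + 1 / (1 + \<theta> - 2 * a)) * real n powr (1 + \<theta>)"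
proof (induction n)
  case 0
  thus ?case by (simp add: excess_def)
next
  case (Suc n)
  define C where "C = 1 + 1 / (1 + \<theta> - 2 * a)"
  define E where "E = expect D elephant n (\<lambda>ys. (excess ys e)\<^sup>2) []"
  have IH: "E \<le> C * real n powr (1 + \<theta>)" using Suc by (simp add: C_def E_def)
  have "1 / (1 + \<theta> - 2 * a) > 0" using \<theta> by simp
  moreover have "1 / (1 + \<theta> - 2 * a) * (1 + \<theta> - 2 * a) = 1" using \<theta> by simp
  ultimately have C: "1 \<le> C" "1 \<le> C * (1 + \<theta> - 2 * a)" 
    using \<theta> unfolding C_def by (auto simp: distrib_right)
  have "expect D elephant (Suc n) (\<lambda>ys. (excess ys e)\<^sup>2) []
      \<le> expect D elephant n (\<lambda>ys. (1 + 2 * a / real n) * (excess ys e)\<^sup>2 + 1) []"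
    unfolding expect_Suc_last
  proof (rule E.expect_mono)
    fix zs assume zs: "zs \<in> lists D" "length zs = n"
    show "(\<Sum>x\<in>D. elephant (zs @ []) x * (excess (x # zs @ []) e)\<^sup>2)
        \<le> (1 + 2 * a / real n) * (excess (zs @ []) e)\<^sup>2 + 1"
      using excess_second_moment_step[OF zs(1) e, of u 0] u_pos u_le_1 zs by simp
  qed simp
  also have "\<dots> = (1 + 2 * a / real n) * E + 1"
    by (simp add: expect_plus expect_cmult E.expect_const E_def)
  also have "\<dots> \<le> C * real (Suc n) powr (1 + \<theta>)"
  proof (cases "n = 0")
    case True
    thus ?thesis using C IH by simp
  next
    case False
    hence n: "1 \<le> real n" by simp
    have "- 1 \<le> 2 * a / real n" using a_ge n by (simp add: field_simps)
    hence "(1 + 2 * a / real n) * E + 1 \<le> (1 + 2 * a / real n) * (C * real n powr (1 + \<theta>)) + 1"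
      using IH by (intro add_mono mult_left_mono) auto
    also have "\<dots> \<le> (1 + 2 * a / real n) * (C * real n powr (1 + \<theta>))
        + C * (1 + \<theta> - 2 * a) * (real n powr \<theta>)"
      using mult_mono[OF C(2) ge_one_powr_ge_zero[OF n \<theta>(1)]] C by (intro add_left_mono) simp
    also have "(1 + 2 * a / real n) * (C * real n powr (1 + \<theta>)) + C * (1 + \<theta> - 2 * a) * (real n powr \<theta>)
        = C * real n powr (1 + \<theta>) * (1 + (1 + \<theta>) * ((1 + 1 / real n) - 1))"
      using n by (simp add: powr_add field_simps)
    also have "\<dots> \<le> C * real n powr (1 + \<theta>) * ((1 + 1 / real n) powr (1 + \<theta>))"
      using \<theta> C n by (intro mult_left_mono powr_Bernoulli) auto
    also have "\<dots> = C * (real n * (1 + 1 / real n)) powr (1 + \<theta>)"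
      using n by (subst powr_mult) auto
    also have "real n * (1 + 1 / real n) = real (Suc n)" using n by (simp add: field_simps)
    finally show ?thesis by simp
  qed
  finally show ?case unfolding C_def .
qed

definition cost_const :: "real \<Rightarrow> real" where
  "cost_const \<theta> = (real (card D))\<^sup>2 * (1 + 1 / (1 + \<theta> - 2 * a))"

lemma a_sq_le: "a\<^sup>2 \<le> 1"
  using a_less a_ge by (simp add: abs_square_le_1 abs_le_iff)

lemma chi_square_uniform_le:
  assumes "0 \<le> \<theta>" "2 * a < 1 + \<theta>"
  shows "expect D elephant m (\<lambda>ys. chi_square D (elephant ys) (uniform ys)) []
           \<le> cost_const \<theta> * real m powr (\<theta> - 1)"
proof -
  have "expect D elephant m (\<lambda>ys. chi_square D (elephant ys) (uniform ys)) []
      \<le> expect D elephant m (\<lambda>ys. (\<Sum>e\<in>D. (1 / (u * (real m)\<^sup>2)) * (excess ys e)\<^sup>2)) []"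
  proof (rule E.expect_mono)
    fix zs assume zs: "zs \<in> lists D" "length zs = m"
    have "(elephant zs e - uniform zs e)\<^sup>2 / uniform zs e \<le> (1 / (u * (real m)\<^sup>2)) * (excess zs e)\<^sup>2" for e
    proof -
      have "(elephant zs e - uniform zs e)\<^sup>2 / uniform zs e = a\<^sup>2 * ((1 / (u * (real m)\<^sup>2)) * (excess zs e)\<^sup>2)"
        using zs by (simp add: elephant_def uniform_def power_divide power_mult_distrib)
      also have "\<dots> \<le> 1 * ((1 / (u * (real m)\<^sup>2)) * (excess zs e)\<^sup>2)"
        using a_sq_le u_pos by (intro mult_right_mono) auto
      finally show ?thesis by simp
    qed
    thus "chi_square D (elephant (zs @ [])) (uniform (zs @ []))
        \<le> (\<Sum>e\<in>D. (1 / (u * (real m)\<^sup>2)) * (excess (zs @ []) e)\<^sup>2)"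
      unfolding chi_square_def by (intro sum_mono) simp
  qed simp
  also have "\<dots> = (\<Sum>e\<in>D. (1 / (u * (real m)\<^sup>2)) * expect D elephant m (\<lambda>ys. (excess ys e)\<^sup>2) [])"
    unfolding expect_sum expect_cmult ..
  also have "\<dots> \<le> (\<Sum>e\<in>D. (1 / (u * (real m)\<^sup>2)) * ((1 + 1 / (1 + \<theta> - 2 * a)) * real m powr (1 + \<theta>)))"
    using u_pos assms by (intro sum_mono mult_left_mono excess_second_moment) auto
  also have "\<dots> = cost_const \<theta> * (real m powr (1 + \<theta>) / (real m)\<^sup>2)"
    using card_D by (simp add: cost_const_def u_def power2_eq_square)
  also have "real m powr (1 + \<theta>) / (real m)\<^sup>2 = real m powr (\<theta> - 1)"
  proof (cases "m = 0")
    case False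
    have "real m powr (1 + \<theta>) = real m powr (\<theta> - 1) * real m powr 2"
      unfolding powr_add[symmetric] by (rule arg_cong[of _ _ "(powr) _"]) simp
    thus ?thesis using False by simp
  qed simp
  finally show ?thesis .
qed

lemma chance_uniform_take:
  "chance D uniform T (\<lambda>ys. A (take T ys)) xs = chance D uniform T A []"
proof -
  have "chance D uniform T (\<lambda>ys. A (take T ys)) ([] @ xs)
      = expect D (\<lambda>zs. uniform (zs @ xs)) T (\<lambda>zs. of_bool (A (take T (zs @ xs)))) []"
    by (rule expect_append)
  also have "(\<lambda>zs. uniform (zs @ xs)) = uniform" by (intro ext) (simp add: uniform_def)
  also have "expect D uniform T (\<lambda>zs. of_bool (A (take T (zs @ xs)))) [] = chance D uniform T A []"
    by (rule expect_cong) simp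
  finally show ?thesis by simp
qed

lemma expected_divergence_uniform:
  assumes "0 \<le> \<theta>" "\<theta> \<le> 1" "2 * a < 1 + \<theta>" "1 \<le> k"
  shows "expect D elephant k (divergence_cost D elephant uniform T) []
           \<le> cost_const \<theta> * real T * real k powr (\<theta> - 1)"
proof -
  have c: "0 \<le> cost_const \<theta>" using assms by (auto simp: cost_const_def intro!: mult_nonneg_nonneg)
  have "expect D elephant k (divergence_cost D elephant uniform T) []
      = (\<Sum>m<T. expect D elephant (k + m) (\<lambda>ys. chi_square D (elephant ys) (uniform ys)) [])"
    unfolding divergence_cost_def expect_sum expect_add_steps ..
  also have "\<dots> \<le> (\<Sum>m<T. cost_const \<theta> * real k powr (\<theta> - 1))"
  proof (rule sum_mono)
    fix m
    have "expect D elephant (k + m) (\<lambda>ys. chi_square D (elephant ys) (uniform ys)) []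
        \<le> cost_const \<theta> * real (k + m) powr (\<theta> - 1)"
      by (rule chi_square_uniform_le) (use assms in auto)
    also have "\<dots> \<le> cost_const \<theta> * real k powr (\<theta> - 1)"
      using assms c by (intro mult_left_mono powr_mono2') auto
    finally show "expect D elephant (k + m) (\<lambda>ys. chi_square D (elephant ys) (uniform ys)) []
        \<le> cost_const \<theta> * real k powr (\<theta> - 1)" .
  qed
  also have "\<dots> = cost_const \<theta> * real T * real k powr (\<theta> - 1)" by simp
  finally show ?thesis .
qed

definition srw_avoid :: "nat \<Rightarrow> real" where
  "srw_avoid m = chance D uniform m (avoids m) []"

text \<open>Only the last \<open>L\<close> of the \<open>k\<close> steps are compared with simple random
  walk.\<close>

lemma avoid_chance_le:
  assumes "0 \<le> \<theta>" "\<theta> \<le> 1" "2 * a < 1 + \<theta>" "L < k" "0 < t" "t \<le> 1"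
  shows "chance D elephant k (avoids k) []
           \<le> (1 + t) * srw_avoid L + cost_const \<theta> * real L * real (k - L) powr (\<theta> - 1) / t"
proof -
  have "chance D elephant k (avoids k) [] \<le> chance D elephant (k - L + L) (avoids L) []"
  proof -
    have "k - L + L = k" using assms by simp
    thus ?thesis using assms by (auto intro!: E.expect_mono elim!: avoids_mono)
  qed
  also have "\<dots> = expect D elephant (k - L) (chance D elephant L (avoids L)) []"
    by (rule expect_add_steps)
  also have "\<dots> \<le> expect D elephant (k - L)
      (\<lambda>xs. (1 + t) * srw_avoid L + (1 / t) * divergence_cost D elephant uniform L xs) []"
  proof (rule E.expect_mono)
    fix zs assume zs: "zs \<in> lists D" "length zs = k - L"
    have "chance D elephant L (avoids L) zs
        \<le> (1 + t) * chance D uniform L (avoids L) zs + divergence_cost D elephant uniform L zs / t"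
      by (rule chance_compare) (use zs assms uniform_pos elephant_kernel uniform_kernel in auto)
    also have "chance D uniform L (avoids L) zs = chance D uniform L (\<lambda>ys. avoids L (take L ys)) zs"
      by (simp add: avoids_take)
    also have "\<dots> = srw_avoid L"
      unfolding chance_uniform_take[of L "avoids L"] srw_avoid_def ..
    finally show "chance D elephant L (avoids L) (zs @ [])
        \<le> (1 + t) * srw_avoid L + (1 / t) * divergence_cost D elephant uniform L (zs @ [])"
      by simp
  qed simp
  also have "\<dots> = (1 + t) * srw_avoid L
      + (1 / t) * expect D elephant (k - L) (divergence_cost D elephant uniform L) []"
    unfolding expect_plus expect_cmult by (simp add: E.expect_const)
  also have "\<dots> \<le> (1 + t) * srw_avoid L
      + (1 / t) * (cost_const \<theta> * real L * real (k - L) powr (\<theta> - 1))"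
    using assms by (intro add_left_mono mult_left_mono expected_divergence_uniform) auto
  finally show ?thesis by simp
qed

text \<open>The first \<open>m\<close> steps are allowed to reach a new site each time.\<close>

lemma expected_range_le:
  assumes "0 \<le> \<theta>" "\<theta> \<le> 1" "2 * a < 1 + \<theta>" "L < m" "0 < t" "t \<le> 1"
  shows "expect D elephant n (\<lambda>ys. real (card (sites ys))) []
     \<le> 1 + real m + real n * ((1 + t) * srw_avoid L + cost_const \<theta> * real L * real (m - L) powr (\<theta> - 1) / t)"
proof -
  define B where "B = (1 + t) * srw_avoid L + cost_const \<theta> * real L * real (m - L) powr (\<theta> - 1) / t"
  have c: "0 \<le> cost_const \<theta>" using assms by (auto simp: cost_const_def intro!: mult_nonneg_nonneg)
  have B: "0 \<le> B" unfolding B_def srw_avoid_def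
    using assms c by (intro add_nonneg_nonneg mult_nonneg_nonneg divide_nonneg_nonneg U.chance_bounds) auto
  have "chance D elephant k (avoids k) [] \<le> of_bool (k \<le> m) + B" for k
  proof (cases "k \<le> m")
    case True
    thus ?thesis using E.chance_bounds(2)[of "[]" k "avoids k"] B by simp
  next
    case False
    have "chance D elephant k (avoids k) []
        \<le> (1 + t) * srw_avoid L + cost_const \<theta> * real L * real (k - L) powr (\<theta> - 1) / t"
      by (rule avoid_chance_le) (use assms False in auto)
    also have "\<dots> \<le> B" unfolding B_def
      using assms False c by (intro add_left_mono divide_right_mono mult_left_mono powr_mono2') auto
    finally show ?thesis using False by simp
  qed
  hence "(\<Sum>k=1..n. chance D elephant k (avoids k) []) \<le> (\<Sum>k=1..n. of_bool (k \<le> m) + B)"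
    by (intro sum_mono) 
  also have "\<dots> = real (card {k\<in>{1..n}. k \<le> m}) + real n * B"
    by (simp add: sum.distrib Int_def)
  also have "card {k\<in>{1..n}. k \<le> m} \<le> card {1..m}" by (intro card_mono) auto
  finally show ?thesis unfolding expect_card_sites[OF elephant_kernel] B_def by simp
qed

text \<open>Given the excess at time \<open>k\<close>, its conditional mean at time \<open>t\<close> is
  this multiple of it.\<close>

definition growth :: "nat \<Rightarrow> nat \<Rightarrow> real" where
  "growth k t = (\<Prod>s\<in>{k..<t}. 1 + a / real s)"

lemma growth_Suc: "k \<le> t \<Longrightarrow> growth k (Suc t) = growth k t * (1 + a / real t)"
  by (simp add: growth_def)

lemma growth_nonneg: "1 \<le> k \<Longrightarrow> 0 \<le> growth k t"
  unfolding growth_def using a_ge by (intro prod_nonneg) (auto simp: field_simps)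

lemma growth_le:
  assumes k: "1 \<le> k" and "k \<le> t"
  shows "growth k t * real k \<le> real t"
  using \<open>k \<le> t\<close>
proof (induction rule: dec_induct)
  case base
  thus ?case by (simp add: growth_def)
next
  case (step t)
  note Suc = step
  have t: "1 \<le> real t" using Suc k by simp
  have "growth k (Suc t) * real k = (growth k t * real k) * (1 + a / real t)"
    using Suc by (simp add: growth_Suc)
  also have "\<dots> \<le> real t * (1 + a / real t)"
    using Suc a_ge t by (intro mult_right_mono) (auto simp: field_simps)
  also have "\<dots> \<le> real (Suc t)" using a_less t by (simp add: field_simps)
  finally show ?case .
qed

text \<open>The step law at time \<open>length ys\<close> if the excess develops from \<open>xs\<close> on
  as predicted. It depends on \<open>ys\<close> only through its length, so under this law the steps after
  \<open>xs\<close> are independent.\<close>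

definition predicted :: "'b list \<Rightarrow> 'b list \<Rightarrow> 'b \<Rightarrow> real" where
  "predicted xs ys e =
     u + a * (excess xs e * growth (length xs) (length ys)) / real (length ys)"

text \<open>The predicted frequencies stay at least as close to the uniform ones as those of
  \<open>xs\<close>, because \<open>growth k t \<le> t / k\<close> by \<open>a < 1\<close>.\<close>

lemma
  assumes xs: "xs \<in> lists D" "xs \<noteq> []" and \<eta>: "\<eta> \<le> u / 2"
    and near: "\<And>e. e \<in> D \<Longrightarrow> \<bar>excess xs e\<bar> \<le> \<eta> * real (length xs)"
    and ys: "length xs \<le> length ys"
  shows predicted_near: "e \<in> D \<Longrightarrow> \<bar>predicted xs ys e - u\<bar> \<le> \<eta>"
    and predicted_ge: "e \<in> D \<Longrightarrow> u / 2 \<le> predicted xs ys e"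
    and predicted_le: "e \<in> D \<Longrightarrow> predicted xs ys e \<le> 1"
    and sum_predicted: "(\<Sum>e\<in>D. predicted xs ys e) = 1"
proof -
  have k: "1 \<le> length xs" using xs by (simp add: Suc_le_eq)
  have eta: "0 \<le> \<eta>"
  proof -
    obtain e where "e \<in> D" using D_nonempty by auto
    hence "0 \<le> \<eta> * real (length xs)" using near[of e] by linarith
    thus ?thesis using xs by (simp add: zero_le_mult_iff)
  qed
  show *: "\<bar>predicted xs ys e - u\<bar> \<le> \<eta>" if e: "e \<in> D" for e
  proof -
    have "\<bar>a\<bar> * (\<bar>excess xs e\<bar> * growth (length xs) (length ys))
        \<le> 1 * ((\<eta> * real (length xs)) * growth (length xs) (length ys))"
      using a_less a_ge near[OF e] eta growth_nonneg[OF k] by (intro mult_mono) auto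
    also have "\<dots> = \<eta> * (growth (length xs) (length ys) * real (length xs))" by simp
    also have "\<dots> \<le> \<eta> * real (length ys)"
      using eta growth_le[OF k ys] by (intro mult_left_mono) auto
    finally show ?thesis using k ys eta growth_nonneg[OF k, of "length ys"]
      by (simp add: predicted_def abs_mult divide_le_eq)
  qed
  show **: "u / 2 \<le> predicted xs ys e" if "e \<in> D" for e
    using *[OF that] \<eta> by (simp add: abs_le_iff)
  have "(\<Sum>e\<in>D. predicted xs ys e) = 1 + (\<Sum>e\<in>D. excess xs e) * (a * growth (length xs) (length ys) / real (length ys))"
    unfolding predicted_def sum.distrib sum_distrib_right using card_u
    by (intro arg_cong2[of _ _ _ _ "(+)"] sum.cong) auto
  thus s: "(\<Sum>e\<in>D. predicted xs ys e) = 1" by (simp add: sum_excess[OF xs(1)])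
  show "predicted xs ys e \<le> 1" if "e \<in> D" for e
    unfolding s[symmetric]
    using that ** finite_D u_pos by (intro member_le_sum) (auto intro: order.trans[of _ "u / 2"])
qed

text \<open>Around the prediction the mean square error starts at 0 and grows linearly, apart from a
  factor that is bounded while the time stays below a multiple of \<open>length xs\<close>. This holds for
  every \<open>a < 1\<close>, whereas the excess itself may be superdiffusive.\<close>

lemma excess_prediction_error:
  assumes xs: "xs \<in> lists D" "xs \<noteq> []" and \<eta>: "\<eta> \<le> u / 2"
    and near: "\<And>e. e \<in> D \<Longrightarrow> \<bar>excess xs e\<bar> \<le> \<eta> * real (length xs)"
    and e: "e \<in> D"
  shows "expect D elephant i
      (\<lambda>ys. (excess ys e - excess xs e * growth (length xs) (length ys))\<^sup>2) xs
    \<le> real i * (1 + 2 / real (length xs)) ^ i"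
proof (induction i)
  case 0
  thus ?case by (simp add: growth_def)
next
  case (Suc i)
  define k where "k = length xs"
  define m where "m = (\<lambda>ys :: 'b list. excess xs e * growth k (length ys))"
  have k: "1 \<le> k" using xs by (simp add: k_def Suc_le_eq)
  have "expect D elephant (Suc i) (\<lambda>ys. (excess ys e - m ys)\<^sup>2) xs
      \<le> expect D elephant i (\<lambda>ys. (1 + 2 / real k) * (excess ys e - m ys)\<^sup>2 + 1) xs"
    unfolding expect_Suc_last
  proof (rule E.expect_mono)
    fix zs assume zs: "zs \<in> lists D" "length zs = i"
    let ?ys = "zs @ xs"
    have len: "length xs \<le> length ?ys" by simp
    have ys: "?ys \<in> lists D" using zs xs by auto
    have q: "predicted xs ?ys e = u + a * m ?ys / real (length ?ys)"
      by (simp add: predicted_def m_def k_def)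
    have "m (x # ?ys) = m ?ys + (predicted xs ?ys e - u)" for x
    proof -
      have "growth k (Suc (length ?ys)) = growth k (length ?ys) * (1 + a / real (length ?ys))"
        by (rule growth_Suc) (simp add: k_def)
      thus ?thesis unfolding q by (simp add: m_def algebra_simps)
    qed
    hence "(\<Sum>x\<in>D. elephant ?ys x * (excess (x # ?ys) e - m (x # ?ys))\<^sup>2)
        \<le> (1 + 2 * a / real (length ?ys)) * (excess ?ys e - m ?ys)\<^sup>2 + 1"
      using excess_second_moment_step[OF ys e q] predicted_ge[OF xs \<eta> near len e]
        predicted_le[OF xs \<eta> near len e] u_pos by simp
    also have "\<dots> \<le> (1 + 2 / real k) * (excess ?ys e - m ?ys)\<^sup>2 + 1"
      using k a_less by (intro add_right_mono mult_right_mono add_left_mono frac_le) (auto simp: k_def)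
    finally show "(\<Sum>x\<in>D. elephant ?ys x * (excess (x # ?ys) e - m (x # ?ys))\<^sup>2)
        \<le> (1 + 2 / real k) * (excess ?ys e - m ?ys)\<^sup>2 + 1" .
  qed (rule xs)
  also have "\<dots> = (1 + 2 / real k) * expect D elephant i (\<lambda>ys. (excess ys e - m ys)\<^sup>2) xs + 1"
    by (simp add: expect_plus expect_cmult E.expect_const xs)
  also have "\<dots> \<le> (1 + 2 / real k) * (real i * (1 + 2 / real k) ^ i) + (1 + 2 / real k) ^ Suc i"
    using Suc k by (intro add_mono mult_left_mono one_le_power) (auto simp: m_def k_def)
  also have "\<dots> = real (Suc i) * (1 + 2 / real k) ^ Suc i"
    by (simp only: power_Suc of_nat_Suc) (simp only: algebra_simps)
  finally show ?case by (simp add: m_def k_def)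
qed

text \<open>Each of the \<open>T\<close> steps costs at most a constant times \<open>T / k\<^sup>2\<close>
  with \<open>k = length xs\<close>, so the cost is bounded as long as
  \<open>T \<le> \<beta> * k\<close>.\<close>

lemma divergence_prediction_le:
  assumes xs: "xs \<in> lists D" "xs \<noteq> []" and \<eta>: "\<eta> \<le> u / 2"
    and near: "\<And>e. e \<in> D \<Longrightarrow> \<bar>excess xs e\<bar> \<le> \<eta> * real (length xs)"
    and T: "real T \<le> \<beta> * real (length xs)"
  shows "divergence_cost D elephant (predicted xs) T xs
      \<le> 2 * (real (card D))\<^sup>2 * \<beta>\<^sup>2 * exp (2 * \<beta>)"
proof -
  define k where "k = length xs"
  have k: "1 \<le> real k" using xs by (simp add: k_def Suc_le_eq)
  define x where "x = 1 + 2 / real k"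
  have x: "1 \<le> x" using k by (simp add: x_def)
  have \<beta>: "real T / real k \<le> \<beta>" using T xs by (simp add: k_def divide_le_eq)
  have \<beta>0: "0 \<le> \<beta>" using \<beta> by (rule order.trans[rotated]) auto
  define c where "c = 2 / (u * (real k)\<^sup>2)"
  have c: "0 \<le> c" using u_pos by (simp add: c_def)
  have step: "expect D elephant i (\<lambda>ys. chi_square D (elephant ys) (predicted xs ys)) xs
      \<le> real (card D) * (c * (real T * x ^ T))" if i: "i < T" for i
  proof -
    define V where "V = (\<lambda>e ys. (excess ys e - excess xs e * growth k (length ys))\<^sup>2)"
    have "expect D elephant i (\<lambda>ys. chi_square D (elephant ys) (predicted xs ys)) xs
        \<le> expect D elephant i (\<lambda>ys. \<Sum>e\<in>D. c * V e ys) xs"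
    proof (rule E.expect_mono)
      fix zs assume zs: "zs \<in> lists D" "length zs = i"
      let ?ys = "zs @ xs"
      have len: "length xs \<le> length ?ys" by simp
      have "(elephant ?ys e - predicted xs ?ys e)\<^sup>2 / predicted xs ?ys e \<le> c * V e ?ys" if e: "e \<in> D" for e
      proof -
        have "elephant ?ys e - predicted xs ?ys e
            = a * (excess ?ys e - excess xs e * growth k (length ?ys)) / real (length ?ys)"
          by (simp add: elephant_def predicted_def k_def diff_divide_distrib right_diff_distrib)
        hence "(elephant ?ys e - predicted xs ?ys e)\<^sup>2 = a\<^sup>2 * V e ?ys / (real (length ?ys))\<^sup>2"
          by (simp add: V_def power_divide power_mult_distrib)
        also have "\<dots> \<le> 1 * V e ?ys / (real k)\<^sup>2"
          using a_sq_le k by (intro frac_le mult_right_mono power_mono) (auto simp: V_def k_def)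
        finally have "(elephant ?ys e - predicted xs ?ys e)\<^sup>2 / predicted xs ?ys e
            \<le> (1 * V e ?ys / (real k)\<^sup>2) / (u / 2)"
          using predicted_ge[OF xs \<eta> near len e] u_pos by (intro frac_le) (auto simp: V_def)
        thus ?thesis by (simp add: c_def mult_ac)
      qed
      thus "chi_square D (elephant ?ys) (predicted xs ?ys) \<le> (\<Sum>e\<in>D. c * V e ?ys)"
        unfolding chi_square_def by (rule sum_mono)
    qed (rule xs)
    also have "\<dots> = (\<Sum>e\<in>D. c * expect D elephant i (V e) xs)"
      unfolding expect_sum expect_cmult ..
    also have "\<dots> \<le> (\<Sum>e\<in>D. c * (real T * x ^ T))"
    proof (intro sum_mono mult_left_mono c)
      fix e assume e: "e \<in> D"
      have "expect D elephant i (V e) xs \<le> real i * x ^ i"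
        using excess_prediction_error[OF xs \<eta> near e, of i] by (simp add: V_def x_def k_def)
      also have "\<dots> \<le> real T * x ^ T"
        using i x by (intro mult_mono power_increasing) auto
      finally show "expect D elephant i (V e) xs \<le> real T * x ^ T" .
    qed
    finally show ?thesis by simp
  qed
  have "divergence_cost D elephant (predicted xs) T xs \<le> (\<Sum>i<T. real (card D) * (c * (real T * x ^ T)))"
    unfolding divergence_cost_def by (intro sum_mono step) auto
  also have "\<dots> = 2 * (real (card D))\<^sup>2 * (real T / real k)\<^sup>2 * x ^ T"
    using k card_D by (simp add: c_def u_def power2_eq_square)
  also have "x ^ T \<le> exp (2 * \<beta>)"
  proof -
    have "x \<le> exp (2 / real k)" unfolding x_def by (rule exp_ge_add_one_self)
    hence "x ^ T \<le> exp (2 / real k) ^ T" using x by (intro power_mono) auto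
    also have "\<dots> = exp (2 * (real T / real k))" by (simp flip: exp_of_nat_mult)
    also have "\<dots> \<le> exp (2 * \<beta>)" using \<beta> by simp
    finally show ?thesis .
  qed
  also have "(real T / real k)\<^sup>2 \<le> \<beta>\<^sup>2" using \<beta> by (intro power_mono) auto
  finally show ?thesis by (simp add: mult_left_mono mult_right_mono)
qed

end


section \<open>The one-dimensional walk and binomial averages\<close>

primrec line_walk :: "nat \<Rightarrow> int \<Rightarrow> real" where
  "line_walk 0 z = of_bool (z = 0)"
| "line_walk (Suc m) z = (line_walk m (z - 1) + line_walk m (z + 1)) / 2"

lemma line_walk_nonneg: "0 \<le> line_walk m z"
  by (induction m arbitrary: z) auto

lemma line_walk_even:
  "line_walk m (2 * k - int m) = (if 0 \<le> k then real (m choose nat k) / 2 ^ m else 0)"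
proof (induction m arbitrary: k)
  case 0
  show ?case by (cases "k = 0") auto
next
  case (Suc m)
  have "line_walk (Suc m) (2 * k - int (Suc m))
      = (line_walk m (2 * (k - 1) - int m) + line_walk m (2 * k - int m)) / 2"
    by (simp add: algebra_simps)
  also have "\<dots> = (if 0 \<le> k then real (Suc m choose nat k) / 2 ^ Suc m else 0)"
  proof (cases "k \<le> 0")
    case True
    thus ?thesis unfolding Suc by auto
  next
    case False
    then obtain j where j: "k = int (Suc j)" by (metis not_le zero_less_imp_eq_int gr0_implies_Suc)
    show ?thesis unfolding Suc j by (simp add: nat_add_distrib add_divide_distrib)
  qed
  finally show ?case .
qed

lemma line_walk_odd: "odd (z + int m) \<Longrightarrow> line_walk m z = 0"
proof (induction m arbitrary: z)
  case (Suc m)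
  have "line_walk m (z - 1) = 0" "line_walk m (z + 1) = 0"
    using Suc.prems by (intro Suc.IH; simp)+
  thus ?case by simp
qed auto

definition central :: "nat \<Rightarrow> real" where
  "central n = real (2 * n choose n) / 4 ^ n"

lemma central_fact: "central n = fact (2 * n) / (4 ^ n * (fact n)\<^sup>2)"
  by (simp add: central_def binomial_fact power2_eq_square)

lemma central_Suc: "central (Suc n) = central n * ((2 * real n + 1) / (2 * real n + 2))"
proof -
  have e1: "fact (2 * Suc n) = (2 * real n + 2) * ((2 * real n + 1) * fact (2 * n))"
    by (simp add: algebra_simps)
  have e2: "4 ^ Suc n * (fact (Suc n))\<^sup>2 = (2 * real n + 2) * ((2 * real n + 2) * (4 ^ n * (fact n)\<^sup>2))"
    by (simp add: power2_eq_square algebra_simps)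
  have "x * (y * F) / (x * (x * G)) = F / G * (y / x)" if "x \<noteq> 0" for x y F G :: real
    using that by (simp add: mult_ac)
  moreover have "2 * real n + 2 \<noteq> 0" by linarith
  ultimately show ?thesis unfolding central_fact e1 e2 by blast
qed

lemma line_walk_central: "line_walk (2 * n) 0 = central n"
  using line_walk_even[of "2 * n" "int n"] by (simp add: central_def power_mult)

lemma line_walk_le_central: "line_walk (2 * n) z \<le> central n"
proof (cases "even z")
  case True
  then obtain k where z: "z = 2 * (k + int n) - int (2 * n)" by (auto elim!: evenE)
  show ?thesis unfolding z line_walk_even
    using binomial_maximum'[of n "nat (k + int n)"] by (auto simp: central_def power_mult divide_right_mono)
next
  case False
  thus ?thesis using line_walk_odd[of z "2 * n"] by (simp add: central_def)
qed

text \<open>Together with the next lemma and Wallis' product this encloses the squared return probability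
  between \<open>2 / (pi * (2 * n + 1))\<close> and \<open>1 / (pi * n)\<close>.\<close>

lemma central_sq_decreasing: "decseq (\<lambda>n. (central n)\<^sup>2 * (2 * real n + 1))"
proof (rule decseq_SucI)
  fix n
  have rearrange: "(c * (x / y))\<^sup>2 * z = c\<^sup>2 * (x\<^sup>2 * z / y\<^sup>2)" for c x y z :: real
    by (simp add: power_mult_distrib power_divide)
  have s: "2 * real (Suc n) + 1 = 2 * real n + 3" by simp
  have "(2 * real n + 1) * (2 * real n + 3) \<le> (2 * real n + 2)\<^sup>2"
    by (simp add: power2_eq_square algebra_simps)
  hence "(2 * real n + 1)\<^sup>2 * (2 * real n + 3) / (2 * real n + 2)\<^sup>2 \<le> 2 * real n + 1"
    by (simp add: power2_eq_square divide_le_eq mult_ac mult_left_mono)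
  hence "(central n)\<^sup>2 * ((2 * real n + 1)\<^sup>2 * (2 * real n + 3) / (2 * real n + 2)\<^sup>2)
      \<le> (central n)\<^sup>2 * (2 * real n + 1)"
    by (intro mult_left_mono) auto
  thus "(central (Suc n))\<^sup>2 * (2 * real (Suc n) + 1) \<le> (central n)\<^sup>2 * (2 * real n + 1)"
    unfolding central_Suc rearrange s by simp
qed

lemma central_sq_increasing: "incseq (\<lambda>n. (central n)\<^sup>2 * real n)"
proof (rule incseq_SucI)
  fix n
  have "real n * (2 * real n + 2)\<^sup>2 \<le> (2 * real n + 1)\<^sup>2 * real (Suc n)"
    by (simp add: power2_eq_square algebra_simps)
  hence "real n \<le> (2 * real n + 1)\<^sup>2 * real (Suc n) / (2 * real n + 2)\<^sup>2"
    by (subst pos_le_divide_eq) auto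
  hence "(central n)\<^sup>2 * real n \<le> (central n)\<^sup>2 * ((2 * real n + 1)\<^sup>2 * real (Suc n) / (2 * real n + 2)\<^sup>2)"
    by (intro mult_left_mono) auto
  thus "(central n)\<^sup>2 * real n \<le> (central (Suc n))\<^sup>2 * real (Suc n)"
    unfolding central_Suc by (simp add: power_mult_distrib power_divide)
qed

lemma central_sq_wallis: "(central n)\<^sup>2 * (2 * real n + 1) * (\<Prod>k=1..n. (4 * real k ^ 2) / (4 * real k ^ 2 - 1)) = 1"
proof (induction n)
  case 0
  thus ?case by (simp add: central_def)
next
  case (Suc n)
  have e: "4 * real (Suc n) ^ 2 - 1 = (2 * real n + 1) * (2 * real n + 3)"
    by (simp add: power2_eq_square algebra_simps)
  have A: "(central (Suc n))\<^sup>2 * (2 * real (Suc n) + 1) * ((4 * real (Suc n) ^ 2) / (4 * real (Suc n) ^ 2 - 1))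
      = (central n)\<^sup>2 * (2 * real n + 1)"
  proof -
    have 1: "2 * real n + 1 \<noteq> 0" "2 * real n + 3 \<noteq> 0" "2 * real n + 2 \<noteq> 0" by linarith+
    have 2: "2 * real (Suc n) + 1 = 2 * real n + 3" "4 * real (Suc n) ^ 2 = (2 * real n + 2)\<^sup>2"
      by (simp_all add: power2_eq_square algebra_simps)
    have rearrange: "(c * (x / y))\<^sup>2 * z * (y\<^sup>2 / (x * z)) = c\<^sup>2 * x"
      if "x \<noteq> 0" "y \<noteq> 0" "z \<noteq> 0" for c x y z :: real
      using that by (simp add: power_mult_distrib power_divide) (simp add: power2_eq_square)
    show ?thesis unfolding e central_Suc unfolding 2 by (rule rearrange) (use 1 in auto)
  qed
  have B: "(\<Prod>k=1..Suc n. (4 * real k ^ 2) / (4 * real k ^ 2 - 1))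
      = ((4 * real (Suc n) ^ 2) / (4 * real (Suc n) ^ 2 - 1)) * (\<Prod>k=1..n. (4 * real k ^ 2) / (4 * real k ^ 2 - 1))"
    by (subst prod.nat_ivl_Suc') auto
  show ?case unfolding B mult.assoc[symmetric] A by (rule Suc)
qed

lemma central_sq_limit: "(\<lambda>n. (central n)\<^sup>2 * (2 * real n + 1)) \<longlonglongrightarrow> 2 / pi"
proof -
  define W where "W = (\<lambda>n. \<Prod>k=1..n. (4 * real k ^ 2) / (4 * real k ^ 2 - 1))"
  have "(\<lambda>n. inverse (W n)) \<longlonglongrightarrow> inverse (pi / 2)"
    unfolding W_def by (intro tendsto_inverse wallis) auto
  moreover have "inverse (W n) = (central n)\<^sup>2 * (2 * real n + 1)" for n
  proof (rule inverse_unique)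
    show "W n * ((central n)\<^sup>2 * (2 * real n + 1)) = 1"
      using central_sq_wallis[of n] unfolding W_def by (subst mult.commute)
  qed
  moreover have "inverse (pi / 2) = 2 / pi" by (simp add: inverse_eq_divide)
  ultimately show ?thesis by (simp only:)
qed

lemma central_sq_le: "(central n)\<^sup>2 * real n \<le> 1 / pi"
proof -
  have "(\<lambda>n. ((central n)\<^sup>2 * (2 * real n + 1)) * (real n / (2 * real n + 1))) \<longlonglongrightarrow> (2 / pi) * (1 / 2)"
  proof (rule tendsto_mult[OF central_sq_limit])
    show "(\<lambda>n. real n / (2 * real n + 1)) \<longlonglongrightarrow> 1 / 2" by real_asymp
  qed
  moreover have "((central n)\<^sup>2 * (2 * real n + 1)) * (real n / (2 * real n + 1)) = (central n)\<^sup>2 * real n" for n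
  proof -
    have "2 * real n + 1 \<noteq> 0" by linarith
    thus ?thesis by simp
  qed
  moreover have "(2 / pi) * (1 / 2) = 1 / pi" by simp
  ultimately have "(\<lambda>n. (central n)\<^sup>2 * real n) \<longlonglongrightarrow> 1 / pi" by (simp only:)
  thus ?thesis by (rule incseq_le[OF central_sq_increasing])
qed

lemma central_sq_ge: "2 / pi \<le> (central n)\<^sup>2 * (2 * real n + 1)"
  by (rule decseq_ge[OF central_sq_decreasing central_sq_limit])

lemma central_sq_le_1: "(central n)\<^sup>2 * (2 * real n + 1) \<le> 1"
  using decseqD[OF central_sq_decreasing, of 0 n] by (simp add: central_def)

text \<open>For an odd number of steps, the last step averages two values for the preceding even
  number.\<close>

lemma line_walk_sq_le: "(line_walk m z)\<^sup>2 * (real m + 1) \<le> 2"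
proof -
  have E: "line_walk m z \<le> central (m div 2)"
  proof (cases "even m")
    case True
    thus ?thesis using line_walk_le_central[of "m div 2" z] by simp
  next
    case False
    define n where "n = m div 2"
    have m: "m = Suc (2 * n)" using False by (simp add: n_def)
    have "line_walk m z \<le> (central n + central n) / 2"
      unfolding m line_walk.simps using line_walk_le_central by (intro divide_right_mono add_mono) auto
    thus ?thesis by (simp add: n_def)
  qed
  have "(line_walk m z)\<^sup>2 * (real m + 1) \<le> (central (m div 2))\<^sup>2 * (real m + 1)"
    using E line_walk_nonneg by (intro mult_right_mono power_mono) auto
  also have "\<dots> \<le> (central (m div 2))\<^sup>2 * (2 * (2 * real (m div 2) + 1))"
  proof (rule mult_left_mono)
    define k where "k = m div 2"
    have "m \<le> 2 * k + 1" unfolding k_def by presburger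
    thus "real m + 1 \<le> 2 * (2 * real (m div 2) + 1)" unfolding k_def[symmetric] by simp
  qed simp
  also have "\<dots> \<le> 2" using central_sq_le_1[of "m div 2"] by (simp add: algebra_simps)
  finally show ?thesis .
qed

definition binomial_mean :: "real \<Rightarrow> nat \<Rightarrow> (nat \<Rightarrow> real) \<Rightarrow> real" where
  "binomial_mean \<alpha> n f = (\<Sum>i\<le>n. real (n choose i) * (\<alpha> ^ i * (1 - \<alpha>) ^ (n - i) * f i))"

lemma binomial_mean_Suc:
  "binomial_mean \<alpha> (Suc n) f
     = \<alpha> * binomial_mean \<alpha> n (\<lambda>i. f (Suc i)) + (1 - \<alpha>) * binomial_mean \<alpha> n f"
proof -
  define g where "g = (\<lambda>i. \<alpha> ^ i * (1 - \<alpha>) ^ (Suc n - i) * f i)"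
  have 1: "binomial_mean \<alpha> (Suc n) f = g 0 + (\<Sum>i\<le>n. real (Suc n choose Suc i) * g (Suc i))"
    unfolding binomial_mean_def g_def by (subst sum.atMost_Suc_shift) simp
  have 2: "(\<Sum>i\<le>n. real (Suc n choose Suc i) * g (Suc i))
      = (\<Sum>i\<le>n. real (n choose i) * g (Suc i)) + (\<Sum>i\<le>n. real (n choose Suc i) * g (Suc i))"
    by (simp add: distrib_right flip: sum.distrib)
  have 3: "(\<Sum>i\<le>n. real (n choose i) * g i) = g 0 + (\<Sum>i\<le>n. real (n choose Suc i) * g (Suc i))"
    using sum.atMost_Suc_shift[of "\<lambda>i. real (n choose i) * g i" n] by (simp add: binomial_eq_0)
  have 4: "(\<Sum>i\<le>n. real (n choose i) * g i) = (1 - \<alpha>) * binomial_mean \<alpha> n f"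
    unfolding binomial_mean_def sum_distrib_left by (rule sum.cong) (auto simp: g_def Suc_diff_le)
  have 5: "(\<Sum>i\<le>n. real (n choose i) * g (Suc i)) = \<alpha> * binomial_mean \<alpha> n (\<lambda>i. f (Suc i))"
    unfolding binomial_mean_def sum_distrib_left by (rule sum.cong) (auto simp: g_def)
  show ?thesis using 1 2 3 4 5 by linarith
qed

lemma binomial_mean_const: "binomial_mean \<alpha> n (\<lambda>_. 1) = 1"
  by (induction n) (simp add: binomial_mean_def, simp add: binomial_mean_Suc)

lemma binomial_mean_mono:
  assumes "0 \<le> \<alpha>" "\<alpha> \<le> 1" "\<And>i. f i \<le> g i"
  shows "binomial_mean \<alpha> n f \<le> binomial_mean \<alpha> n g"
  unfolding binomial_mean_def using assms by (intro sum_mono mult_left_mono) auto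

lemma binomial_mean_linear:
  "binomial_mean \<alpha> n (\<lambda>i. b * f i + c * g i) = b * binomial_mean \<alpha> n f + c * binomial_mean \<alpha> n g"
  by (simp add: binomial_mean_def sum_distrib_left sum.distrib algebra_simps)

lemma binomial_mean_scale: "binomial_mean \<alpha> n (\<lambda>i. b * f i) = b * binomial_mean \<alpha> n f"
  using binomial_mean_linear[of \<alpha> n b f 0 f] by simp

text \<open>The absorption identity
  \<open>(n choose i) / (i + 1) = (n + 1 choose i + 1) / (n + 1)\<close>: it turns inverse moments of the
  binomial distribution into ordinary means.\<close>

lemma binomial_mean_divide_Suc:
  assumes "0 < \<alpha>" "\<alpha> \<le> 1" "\<And>i. 0 \<le> g i"
  shows "binomial_mean \<alpha> n (\<lambda>i. g (Suc i) / real (Suc i)) \<le> binomial_mean \<alpha> (Suc n) g / (\<alpha> * real (Suc n))"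
proof -
  define h where "h = (\<lambda>i. real (Suc n choose i) * (\<alpha> ^ i * (1 - \<alpha>) ^ (Suc n - i) * g i))"
  have "\<alpha> * real (Suc n) * binomial_mean \<alpha> n (\<lambda>i. g (Suc i) / real (Suc i)) = (\<Sum>i\<le>n. h (Suc i))"
    unfolding binomial_mean_def sum_distrib_left
  proof (rule sum.cong)
    fix i
    have "real (Suc n) * real (n choose i) = real (Suc i) * real (Suc n choose Suc i)"
      using Suc_times_binomial[of i n] by (metis of_nat_mult)
    hence "real (Suc n) * real (n choose i) / real (Suc i) = real (Suc n choose Suc i)"
      by simp
    hence *: "real (Suc n choose Suc i) = real (Suc n) * real (n choose i) / real (Suc i)" ..
    show "\<alpha> * real (Suc n) * (real (n choose i) * (\<alpha> ^ i * (1 - \<alpha>) ^ (n - i) * (g (Suc i) / real (Suc i)))) = h (Suc i)"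
      unfolding h_def * by (simp del: of_nat_Suc)
  qed simp
  also have "\<dots> \<le> h 0 + (\<Sum>i\<le>n. h (Suc i))" using assms by (simp add: h_def)
  also have "\<dots> = binomial_mean \<alpha> (Suc n) g"
    unfolding binomial_mean_def h_def by (subst sum.atMost_Suc_shift) simp
  finally show ?thesis using assms by (simp add: field_simps del: of_nat_Suc)
qed

lemma binomial_mean_inverse:
  assumes "0 < \<alpha>" "\<alpha> \<le> 1"
  shows "binomial_mean \<alpha> n (\<lambda>i. 1 / real (Suc i)) \<le> 1 / (\<alpha> * real (Suc n))"
  using binomial_mean_divide_Suc[OF assms, of "\<lambda>_. 1" n] by (simp add: binomial_mean_const)

lemma binomial_mean_inverse_sq:
  assumes "0 < \<alpha>" "\<alpha> \<le> 1"
  shows "binomial_mean \<alpha> n (\<lambda>i. 1 / (real (Suc i))\<^sup>2) \<le> 2 / (\<alpha> * real (Suc n))\<^sup>2"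
proof -
  have "binomial_mean \<alpha> n (\<lambda>i. 1 / (real (Suc i))\<^sup>2)
      \<le> binomial_mean \<alpha> n (\<lambda>i. 2 * (1 / real (Suc (Suc i)) / real (Suc i)))"
  proof (rule binomial_mean_mono)
    fix i
    define x where "x = real (Suc i)"
    have x: "1 \<le> x" by (simp add: x_def)
    have "1 / x\<^sup>2 = 2 / (2 * x * x)" by (simp add: power2_eq_square)
    also have "\<dots> \<le> 2 / ((x + 1) * x)" using x by (intro frac_le mult_right_mono mult_pos_pos) auto
    finally show "1 / (real (Suc i))\<^sup>2 \<le> 2 * (1 / real (Suc (Suc i)) / real (Suc i))"
      by (simp add: x_def add_ac)
  qed (use assms in auto)
  also have "\<dots> = 2 * binomial_mean \<alpha> n (\<lambda>i. 1 / real (Suc (Suc i)) / real (Suc i))"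
    by (rule binomial_mean_scale)
  also have "\<dots> \<le> 2 * (binomial_mean \<alpha> (Suc n) (\<lambda>i. 1 / real (Suc i)) / (\<alpha> * real (Suc n)))"
    using assms by (intro mult_left_mono binomial_mean_divide_Suc) auto
  also have "\<dots> \<le> 2 * ((1 / (\<alpha> * real (Suc (Suc n)))) / (\<alpha> * real (Suc n)))"
    using assms by (intro mult_left_mono divide_right_mono binomial_mean_inverse) auto
  also have "\<dots> \<le> 2 * ((1 / (\<alpha> * real (Suc n))) / (\<alpha> * real (Suc n)))"
    using assms by (intro mult_left_mono divide_right_mono frac_le) auto
  finally show ?thesis by (simp add: power2_eq_square)
qed

text \<open>The power \<open>3 / 2\<close> lies between the two inverse moments above: with
  \<open>x = 1 / sqrt (i + 1)\<close> one has \<open>x ^ 3 \<le> s * x\<^sup>2 + x ^ 4 / s\<close> for every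
  \<open>s > 0\<close>, and \<open>s = 1 / sqrt (n + 1)\<close> balances the two terms.\<close>

lemma binomial_mean_three_halves:
  assumes "0 < \<alpha>" "\<alpha> \<le> 1"
  shows "binomial_mean \<alpha> n (\<lambda>i. (1 / sqrt (real (Suc i))) ^ 3)
    \<le> (1 / \<alpha> + 2 / \<alpha>\<^sup>2) * (1 / sqrt (real (Suc n))) ^ 3"
proof -
  define s where "s = 1 / sqrt (real (Suc n))"
  have s: "0 < s" "s\<^sup>2 = 1 / real (Suc n)" by (auto simp: s_def power_divide)
  have "binomial_mean \<alpha> n (\<lambda>i. (1 / sqrt (real (Suc i))) ^ 3)
      \<le> binomial_mean \<alpha> n (\<lambda>i. s * (1 / real (Suc i)) + (1 / s) * (1 / (real (Suc i))\<^sup>2))"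
  proof (rule binomial_mean_mono)
    fix i
    define x where "x = 1 / sqrt (real (Suc i))"
    have x: "0 < x" "x\<^sup>2 = 1 / real (Suc i)" by (auto simp: x_def power_divide)
    have "0 \<le> x\<^sup>2 * (s - x)\<^sup>2 + x ^ 3 * s" using x s by simp
    hence "s * x ^ 3 \<le> s * (s * x\<^sup>2) + (x\<^sup>2)\<^sup>2"
      by (simp add: power2_eq_square power3_eq_cube algebra_simps)
    hence "x ^ 3 \<le> s * x\<^sup>2 + (1 / s) * (x\<^sup>2)\<^sup>2" using s by (simp add: field_simps)
    thus "x ^ 3 \<le> s * (1 / real (Suc i)) + (1 / s) * (1 / (real (Suc i))\<^sup>2)"
      unfolding x(2) by (simp add: power_divide)
  qed (use assms in auto)
  also have "\<dots> \<le> s * (1 / (\<alpha> * real (Suc n))) + (1 / s) * (2 / (\<alpha> * real (Suc n))\<^sup>2)"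
    unfolding binomial_mean_linear using s assms
    by (intro add_mono mult_left_mono binomial_mean_inverse binomial_mean_inverse_sq) auto
  also have "\<dots> = s * ((1 / \<alpha>) * s\<^sup>2) + (1 / s) * ((2 / \<alpha>\<^sup>2) * (s\<^sup>2)\<^sup>2)"
    unfolding s(2) by (simp add: power_mult_distrib power_divide)
  also have "\<dots> = (1 / \<alpha> + 2 / \<alpha>\<^sup>2) * s ^ 3"
    using s(1) by (simp add: field_simps power2_eq_square power3_eq_cube)
  finally show ?thesis unfolding s_def .
qed


section \<open>Renewal equation for simple random walk\<close>

context reinforced_steps
begin

definition srw_return :: "nat \<Rightarrow> real" where
  "srw_return k = chance D uniform k (\<lambda>ys. sum_list ys = 0) []"

lemma srw_avoid_bounds: "0 \<le> srw_avoid m" "srw_avoid m \<le> 1"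
  unfolding srw_avoid_def by (rule U.chance_bounds; simp)+

lemma srw_return_nonneg: "0 \<le> srw_return m"
  unfolding srw_return_def by (rule U.chance_bounds; simp)

lemma srw_return_0: "srw_return 0 = 1"
  by (simp add: srw_return_def)

lemma srw_avoid_decreasing: "decseq srw_avoid"
proof (rule decseq_SucI)
  fix m
  have "srw_avoid (Suc m) \<le> chance D uniform (1 + m) (avoids m) []"
    unfolding srw_avoid_def using U.expect_mono[of "[]" "Suc m"] by (auto intro!: U.expect_mono elim!: avoids_mono simp del: expect.simps)
  also have "\<dots> = expect D uniform 1 (\<lambda>xs. chance D uniform m (\<lambda>ys. avoids m (take m ys)) xs) []"
    unfolding expect_add_steps by (simp add: avoids_take)
  also have "\<dots> = srw_avoid m"
    unfolding chance_uniform_take[where A = "avoids m"] srw_avoid_def by (rule U.expect_const) simp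
  finally show "srw_avoid (Suc m) \<le> srw_avoid m" .
qed

lemma last_zero_decomposition:
  "Z 0 \<Longrightarrow> (\<Sum>k\<le>n. of_bool (Z k \<and> (\<forall>j\<in>{k<..n}. \<not> Z j))) = (1 :: real)" for Z :: "nat \<Rightarrow> bool"
proof (induction n)
  case (Suc n)
  have iff: "(\<forall>j\<in>{k<..Suc n}. \<not> Z j) \<longleftrightarrow> \<not> Z (Suc n) \<and> (\<forall>j\<in>{k<..n}. \<not> Z j)" if "k \<le> n" for k
    using that by (auto simp: le_Suc_eq)
  have "(\<Sum>k\<le>n. of_bool (Z k \<and> (\<forall>j\<in>{k<..Suc n}. \<not> Z j)))
      = of_bool (\<not> Z (Suc n)) * (\<Sum>k\<le>n. of_bool (Z k \<and> (\<forall>j\<in>{k<..n}. \<not> Z j)) :: real)"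
    unfolding sum_distrib_left by (rule sum.cong) (auto simp: iff)
  thus ?case unfolding sum.atMost_Suc using Suc by auto
qed auto

text \<open>Decomposition of all paths of length \<open>n\<close> according to the earliest time at which
  the walk is at its end point: the earlier steps form, read backwards, an avoiding path, and the later ones
  a closed path.\<close>

lemma renewal: "(\<Sum>k\<le>n. srw_return k * srw_avoid (n - k)) = 1"
proof -
  have "1 = expect D uniform n (\<lambda>ys. \<Sum>k\<le>n.
      of_bool (sum_list (take k ys) = 0 \<and> avoids (n - k) (drop k ys))) []"
  proof -
    have "(\<Sum>k\<le>n. of_bool (sum_list (take k ys) = 0 \<and> avoids (n - k) (drop k ys))) = (1::real)" for ys :: "'b list"
    proof -
      let ?Z = "\<lambda>k. sum_list (take k ys) = 0"
      have "?Z k \<and> avoids (n - k) (drop k ys) \<longleftrightarrow> ?Z k \<and> (\<forall>j\<in>{k<..n}. \<not> ?Z j)" for k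
      proof (rule conj_cong[OF refl])
        assume Z: "?Z k"
        have "sum_list (take j (drop k ys)) = sum_list (take (k + j) ys)" for j
          using Z by (simp add: take_add)
        hence "avoids (n - k) (drop k ys) \<longleftrightarrow> (\<forall>j\<in>{1..n - k}. \<not> ?Z (k + j))"
          by (simp add: avoids_def)
        also have "\<dots> \<longleftrightarrow> (\<forall>j\<in>{k<..n}. \<not> ?Z j)"
        proof (intro iffI ballI)
          fix j assume *: "\<forall>j\<in>{1..n - k}. \<not> ?Z (k + j)" and j: "j \<in> {k<..n}"
          have "j - k \<in> {1..n - k}" using j by auto
          from bspec[OF * this] show "\<not> ?Z j" using j by simp
        qed auto
        finally show "avoids (n - k) (drop k ys) \<longleftrightarrow> (\<forall>j\<in>{k<..n}. \<not> ?Z j)" .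
      qed
      thus ?thesis using last_zero_decomposition[of ?Z n] by simp
    qed
    thus ?thesis by (simp add: U.expect_const)
  qed
  also have "\<dots> = (\<Sum>k\<le>n. srw_return k * srw_avoid (n - k))"
    unfolding expect_sum
  proof (rule sum.cong)
    fix k assume "k \<in> {..n}"
    hence n: "n = (n - k) + k" by simp
    have "chance D uniform ((n - k) + k) (\<lambda>ys. sum_list (take k ys) = 0 \<and> avoids (n - k) (drop k ys)) []
        = expect D uniform (n - k) (\<lambda>xs. of_bool (avoids (n - k) xs) * chance D uniform k (\<lambda>ys. sum_list (take k ys) = 0) xs) []"
      unfolding expect_add_steps expect_cmult[symmetric] by (intro expect_cong) auto
    also have "\<dots> = expect D uniform (n - k) (\<lambda>xs. srw_return k * of_bool (avoids (n - k) xs)) []"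
      unfolding chance_uniform_take[of k "\<lambda>ys. sum_list ys = 0"] srw_return_def by (simp add: mult.commute)
    also have "\<dots> = srw_return k * srw_avoid (n - k)"
      unfolding expect_cmult srw_avoid_def ..
    finally show "chance D uniform n (\<lambda>ys. sum_list (take k ys) = 0 \<and> avoids (n - k) (drop k ys)) []
        = srw_return k * srw_avoid (n - k)" using n by simp
  qed simp
  finally show ?thesis by simp
qed

definition green_upto :: "nat \<Rightarrow> real" where
  "green_upto n = (\<Sum>k\<le>n. srw_return k)"

lemma green_upto_ge_1: "1 \<le> green_upto n"
proof -
  have "srw_return 0 \<le> green_upto n" unfolding green_upto_def
    by (rule member_le_sum) (auto intro: srw_return_nonneg)
  thus ?thesis by (simp add: srw_return_0)
qed

lemma green_upto_diff: "green_upto (n + m) - green_upto m = (\<Sum>k\<in>{m<..n + m}. srw_return k)"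
proof -
  have "green_upto (n + m) = green_upto m + (\<Sum>k\<in>{m<..n + m}. srw_return k)"
    unfolding green_upto_def by (subst sum.union_disjoint[symmetric]) (auto intro!: sum.cong)
  thus ?thesis by simp
qed

lemma srw_avoid_le: "srw_avoid n \<le> 1 / green_upto n"
proof -
  have "srw_avoid n * green_upto n = (\<Sum>k\<le>n. srw_return k * srw_avoid n)"
    by (simp add: green_upto_def sum_distrib_left mult.commute)
  also have "\<dots> \<le> (\<Sum>k\<le>n. srw_return k * srw_avoid (n - k))"
    by (intro sum_mono mult_left_mono srw_return_nonneg decseqD[OF srw_avoid_decreasing]) auto
  finally show ?thesis using green_upto_ge_1[of n] unfolding renewal by (simp add: field_simps)
qed

text \<open>In the renewal equation at time \<open>n + m\<close>, the terms with return time beyond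
  \<open>m\<close> are estimated by the return probability alone.\<close>

lemma srw_avoid_ge: "(1 - (green_upto (n + m) - green_upto m)) / green_upto m \<le> srw_avoid n"
proof -
  have "1 = (\<Sum>k\<le>m. srw_return k * srw_avoid (n + m - k)) + (\<Sum>k\<in>{m<..n + m}. srw_return k * srw_avoid (n + m - k))"
    unfolding renewal[of "n + m", symmetric]
    by (subst sum.union_disjoint[symmetric]) (auto intro!: sum.cong)
  also have "\<dots> \<le> (\<Sum>k\<le>m. srw_return k * srw_avoid n) + (\<Sum>k\<in>{m<..n + m}. srw_return k * 1)"
    by (intro add_mono sum_mono mult_left_mono srw_return_nonneg srw_avoid_bounds decseqD[OF srw_avoid_decreasing]) auto
  also have "(\<Sum>k\<in>{m<..n + m}. srw_return k * 1) = green_upto (n + m) - green_upto m"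
    by (simp add: green_upto_diff)
  also have "(\<Sum>k\<le>m. srw_return k * srw_avoid n) = srw_avoid n * green_upto m"
    by (simp add: green_upto_def sum_distrib_left mult.commute)
  finally show ?thesis using green_upto_ge_1[of m] by (simp add: field_simps)
qed

lemma srw_avoid_limit:
  assumes "summable srw_return"
  shows "srw_avoid \<longlonglongrightarrow> 1 / suminf srw_return"
proof -
  define G where "G = suminf srw_return"
  have lim: "green_upto \<longlonglongrightarrow> G"
    unfolding green_upto_def[abs_def] G_def by (rule summable_LIMSEQ'[OF assms])
  have G: "1 \<le> G" by (rule LIMSEQ_le_const[OF lim]) (use green_upto_ge_1 in auto)
  have lim2: "(\<lambda>n. green_upto (n + n)) \<longlonglongrightarrow> G"
    using LIMSEQ_subseq_LIMSEQ[OF lim, of "\<lambda>n. n + n"] by (auto simp: strict_mono_def o_def)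
  show ?thesis unfolding G_def[symmetric]
  proof (rule real_tendsto_sandwich)
    show "\<forall>\<^sub>F n in sequentially. (1 - (green_upto (n + n) - green_upto n)) / green_upto n \<le> srw_avoid n"
      using srw_avoid_ge by auto
    show "\<forall>\<^sub>F n in sequentially. srw_avoid n \<le> 1 / green_upto n"
      using srw_avoid_le by auto
    show "(\<lambda>n. (1 - (green_upto (n + n) - green_upto n)) / green_upto n) \<longlonglongrightarrow> 1 / G"
      using tendsto_divide[OF tendsto_diff[OF tendsto_const tendsto_diff[OF lim2 lim]] lim, of 1] G by simp
    show "(\<lambda>n. 1 / green_upto n) \<longlonglongrightarrow> 1 / G"
      by (intro tendsto_intros lim) (use G in auto)
  qed
qed

text \<open>The bound \<open>1 / k\<close> on the return probabilities lets the truncated Green function change by at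
  most \<open>1 / j\<close> between \<open>n * j\<close> and \<open>n * j + n\<close>, while \<open>ln (n * j)\<close> and \<open>ln n\<close> are equivalent. So the
  lower bound for the avoidance probability falls short of the upper one by a factor
  \<open>1 - 1 / j\<close>, for every \<open>j\<close>.\<close>

lemma srw_avoid_log_limit:
  assumes c: "0 < c" and lim: "(\<lambda>n. green_upto n / ln (real n)) \<longlonglongrightarrow> 1 / c"
    and ret: "\<And>k. 1 \<le> k \<Longrightarrow> srw_return k \<le> 1 / real k"
  shows "(\<lambda>n. srw_avoid n * ln (real n)) \<longlonglongrightarrow> c"
proof (rule tendstoI)
  fix e :: real assume e: "0 < e"
  have lim': "(\<lambda>n. ln (real n) / green_upto n) \<longlonglongrightarrow> c"
    using tendsto_inverse[OF lim] c by simp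
  \<comment> \<open>the factor \<open>1 - 1 / j\<close> costs \<open>c / j\<close>, half of the tolerance\<close>
  obtain j :: nat where j: "c / real j < e / 2" "1 \<le> j"
  proof -
    obtain j :: nat where "2 * c / e < real j" using reals_Archimedean2 by blast
    hence "2 * c < e * real j" using e by (simp add: field_simps)
    moreover have "0 < real j" using \<open>2 * c / e < real j\<close> c e by (meson divide_pos_pos less_trans mult_pos_pos zero_less_numeral)
    ultimately show ?thesis using that[of j] by (simp add: field_simps Suc_le_eq)
  qed
  have "(\<lambda>n. ln (real (n * j)) / green_upto (n * j)) \<longlonglongrightarrow> c"
    using LIMSEQ_subseq_LIMSEQ[OF lim', of "\<lambda>n. n * j"] j by (auto simp: strict_mono_def o_def)
  moreover have "(\<lambda>n. ln (real n) / ln (real (n * j))) \<longlonglongrightarrow> 1"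
    unfolding of_nat_mult using j by (auto) real_asymp
  ultimately have "(\<lambda>n. ln (real (n * j)) / green_upto (n * j) * (ln (real n) / ln (real (n * j)))) \<longlonglongrightarrow> c * 1"
    by (rule tendsto_mult)
  hence lim2: "(\<lambda>n. (1 - 1 / real j) * (ln (real (n * j)) / green_upto (n * j) * (ln (real n) / ln (real (n * j))))) \<longlonglongrightarrow> (1 - 1 / real j) * c"
    by (intro tendsto_intros) simp
  have "(1 - 1 / real j) * c > c - e / 2" using j by (simp add: field_simps)
  from order_tendstoD(1)[OF lim2 this] order_tendstoD(2)[OF lim', of "c + e"] e
  have "\<forall>\<^sub>F n in sequentially. c - e / 2 < (1 - 1 / real j) * (ln (real (n * j)) / green_upto (n * j) * (ln (real n) / ln (real (n * j)))) \<and>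
    ln (real n) / green_upto n < c + e \<and> 2 \<le> n"
    by (intro eventually_conj eventually_ge_at_top) auto
  thus "\<forall>\<^sub>F n in sequentially. dist (srw_avoid n * ln (real n)) c < e"
  proof eventually_elim
    case (elim n)
    have n: "2 \<le> n" and nj: "2 \<le> n * j" using elim j by (auto intro: order.trans[of 2 n])
    hence ln: "0 < ln (real n)" "0 < ln (real (n * j))" by (auto intro!: ln_gt_zero simp del: of_nat_mult)
    have "srw_avoid n * ln (real n) \<le> (1 / green_upto n) * ln (real n)"
      using ln by (intro mult_right_mono srw_avoid_le) auto
    hence upper: "srw_avoid n * ln (real n) < c + e" using elim by simp
    have "green_upto (n + n * j) - green_upto (n * j) = (\<Sum>k\<in>{n * j<..n + n * j}. srw_return k)"
      by (rule green_upto_diff)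
    also have "\<dots> \<le> (\<Sum>k\<in>{n * j<..n + n * j}. 1 / real (n * j))"
    proof (rule sum_mono)
      fix k assume k: "k \<in> {n * j<..n + n * j}"
      hence "srw_return k \<le> 1 / real k" using ret[of k] by auto
      also have "\<dots> \<le> 1 / real (n * j)"
      proof (rule divide_left_mono)
        show "real (n * j) \<le> real k" using k by (simp only: of_nat_le_iff) auto
        have "0 < n * j" using nj by linarith
        moreover have "0 < k" using k by auto
        ultimately have "0 < k" "0 < n * j" by blast+
        thus "0 < real k * real (n * j)" by (intro mult_pos_pos) (simp_all only: of_nat_0_less_iff)
      qed simp
      finally show "srw_return k \<le> 1 / real (n * j)" .
    qed
    also have "\<dots> = 1 / real j" using n by simp
    finally have "(1 - 1 / real j) / green_upto (n * j) \<le> (1 - (green_upto (n + n * j) - green_upto (n * j))) / green_upto (n * j)"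
      using green_upto_ge_1[of "n * j"] by (intro divide_right_mono) auto
    also have "\<dots> \<le> srw_avoid n" by (rule srw_avoid_ge)
    finally have "(1 - 1 / real j) / green_upto (n * j) * ln (real n) \<le> srw_avoid n * ln (real n)"
      using ln by (intro mult_right_mono) auto
    also have "(1 - 1 / real j) / green_upto (n * j) * ln (real n)
        = (1 - 1 / real j) * (ln (real (n * j)) / green_upto (n * j) * (ln (real n) / ln (real (n * j))))"
      using ln by simp
    finally show ?case using upper elim e by (simp add: dist_real_def abs_less_iff)
  qed
qed

end

section \<open>Heat kernel bound in at least three dimensions\<close>

lemma sum_directions:
  fixes f :: "int ^ 'd::finite \<Rightarrow> 'c::comm_monoid_add"
  shows "(\<Sum>e\<in>directions. f e) = (\<Sum>i\<in>UNIV. f (axis i 1) + f (- axis i 1))"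
proof -
  have inj: "inj (\<lambda>i. axis i 1 :: int ^ 'd)" "inj (\<lambda>i. - axis i 1 :: int ^ 'd)"
    by (auto simp: inj_on_def axis_eq_axis)
  have "axis i 1 \<noteq> - (axis j 1 :: int ^ 'd)" for i j
  proof
    assume "axis i 1 = - (axis j 1 :: int ^ 'd)"
    hence "(axis i 1 :: int ^ 'd) $ i = - (axis j 1 :: int ^ 'd) $ i" by simp
    thus False by (simp add: axis_def split: if_splits)
  qed
  hence "range (\<lambda>i. axis i 1 :: int ^ 'd) \<inter> range (\<lambda>i. - axis i 1) = {}" by blast
  hence "(\<Sum>e\<in>directions. f e) = (\<Sum>e\<in>range (\<lambda>i. axis i 1). f e) + (\<Sum>e\<in>range (\<lambda>i. - axis i 1). f e)"
    unfolding directions_def by (intro sum.union_disjoint) auto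
  thus ?thesis using inj by (simp add: sum.reindex sum.distrib)
qed

lemma finite_directions [simp]: "finite directions"
  by (simp add: directions_def)

lemma card_directions: "card (directions :: (int ^ 'd::finite) set) = 2 * CARD('d)"
  using sum_directions[where f = "\<lambda>_ :: int ^ 'd. 1 :: nat"] by simp

lemma directions_nonempty [simp]: "directions \<noteq> {}"
  by (auto simp: directions_def)

lemma axis_in_directions [simp]: "axis i 1 \<in> directions" "- axis i 1 \<in> directions"
  by (auto simp: directions_def)

text \<open>The mean of \<open>f\<close> at \<open>j\<close> plus a binomial number of successes in
  \<open>n\<close> trials, in the recursive form in which it arises step by step.\<close>

primrec smear :: "real \<Rightarrow> (nat \<Rightarrow> real) \<Rightarrow> nat \<Rightarrow> nat \<Rightarrow> real" where
  "smear \<alpha> f 0 j = f j"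
| "smear \<alpha> f (Suc n) j = \<alpha> * smear \<alpha> f n (Suc j) + (1 - \<alpha>) * smear \<alpha> f n j"

lemma smear_eq: "smear \<alpha> f n j = binomial_mean \<alpha> n (\<lambda>i. f (j + i))"
proof (induction n arbitrary: j)
  case (Suc n)
  show ?case by (simp add: Suc binomial_mean_Suc)
qed (simp add: binomial_mean_def)

text \<open>The probability that independent one-dimensional walks in the coordinates
  \<open>i \<in> S\<close>, with \<open>m i\<close> steps each, stand at the coordinates of
  \<open>y\<close>. For \<open>m = 0\<close> it dominates the indicator of the origin.\<close>

definition product_walk :: "'d set \<Rightarrow> ('d \<Rightarrow> nat) \<Rightarrow> int ^ 'd::finite \<Rightarrow> real" where
  "product_walk S m y = (\<Prod>i\<in>S. line_walk (m i) (y $ i))"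

lemma product_walk_step:
  assumes "j \<in> S"
  shows "product_walk S m (y + axis j 1) + product_walk S m (y - axis j 1)
    = 2 * product_walk S (m(j := Suc (m j))) y"
proof -
  let ?P = "\<Prod>i\<in>S - {j}. line_walk (m i) (y $ i)"
  have S: "finite S" by simp
  have 1: "product_walk S m (y + axis j 1) = line_walk (m j) (y $ j + 1) * ?P"
    unfolding product_walk_def prod.remove[OF S assms]
    by (intro arg_cong2[of _ _ _ _ "(*)"] prod.cong) (auto simp: axis_def)
  have 2: "product_walk S m (y - axis j 1) = line_walk (m j) (y $ j - 1) * ?P"
    unfolding product_walk_def prod.remove[OF S assms]
    by (intro arg_cong2[of _ _ _ _ "(*)"] prod.cong) (auto simp: axis_def)
  have 3: "product_walk S (m(j := Suc (m j))) y
      = (line_walk (m j) (y $ j - 1) + line_walk (m j) (y $ j + 1)) / 2 * ?P"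
    unfolding product_walk_def prod.remove[OF S assms]
    by (intro arg_cong2[of _ _ _ _ "(*)"] prod.cong) auto
  show ?thesis unfolding 1 2 3 by (simp add: algebra_simps)
qed

lemma am_gm_3:
  fixes x y z :: real
  assumes "0 \<le> x" "0 \<le> y" "0 \<le> z"
  shows "x * y * z \<le> (x ^ 3 + y ^ 3 + z ^ 3) / 3"
proof -
  have "0 \<le> (x + y + z) * ((x - y)\<^sup>2 + (y - z)\<^sup>2 + (z - x)\<^sup>2)"
    using assms by (intro mult_nonneg_nonneg) auto
  also have "\<dots> = 2 * (x ^ 3 + y ^ 3 + z ^ 3) - 6 * (x * y * z)"
    by (simp add: power2_eq_square power3_eq_cube algebra_simps)
  finally show ?thesis by simp
qed

text \<open>The product of three one-dimensional bounds \<open>sqrt (2 / (m + 1))\<close> is separated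
  into a sum of cubes, one for each coordinate, by the inequality between arithmetic and geometric mean.
  Each summand then only needs the law of the number of steps in one coordinate.\<close>

definition cube_bound :: "nat \<Rightarrow> real" where
  "cube_bound j = (sqrt (2 / real (Suc j))) ^ 3"

lemma line_walk_le_sqrt: "line_walk m z \<le> sqrt (2 / real (Suc m))"
  using line_walk_sq_le[of m z] by (intro real_le_rsqrt) (simp add: field_simps)

lemma product_walk_le:
  assumes "card S = 3"
  shows "product_walk S m y \<le> (\<Sum>i\<in>S. cube_bound (m i)) / 3"
proof -
  obtain i j k where S: "S = {i, j, k}" "i \<noteq> j" "j \<noteq> k" "i \<noteq> k" using assms by (auto simp: card_3_iff)
  define b where "b = (\<lambda>i. sqrt (2 / real (Suc (m i))))"
  have b: "line_walk (m i) (y $ i) \<le> b i" "0 \<le> b i" for i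
    unfolding b_def by (rule line_walk_le_sqrt) simp
  have "product_walk S m y = line_walk (m i) (y $ i) * line_walk (m j) (y $ j) * line_walk (m k) (y $ k)"
    using S by (simp add: product_walk_def)
  also have "\<dots> \<le> b i * b j * b k"
    using b line_walk_nonneg by (intro mult_mono mult_nonneg_nonneg) auto
  also have "\<dots> \<le> (b i ^ 3 + b j ^ 3 + b k ^ 3) / 3" using b by (intro am_gm_3)
  also have "\<dots> = (\<Sum>i\<in>S. cube_bound (m i)) / 3" using S by (simp add: cube_bound_def b_def)
  finally show ?thesis .
qed

text \<open>Every step law with weight at least \<open>\<alpha> / 2\<close> on all directions is a
  mixture: with probability \<open>\<alpha>\<close> each, the step is symmetric in one of the three
  coordinates of \<open>S\<close>, which adds a step to the corresponding one-dimensional walk; with the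
  remaining probability it is arbitrary, and then it only shifts \<open>y\<close>, over which the bound is
  uniform. Independence of the steps allows the newest one to be treated first.\<close>

lemma heat_kernel_smear:
  fixes q :: "nat \<Rightarrow> int ^ 'd::finite \<Rightarrow> real" and S :: "'d set"
  assumes S: "card S = 3" and \<alpha>: "0 \<le> \<alpha>"
    and ge: "\<And>t e. t \<ge> t0 \<Longrightarrow> e \<in> directions \<Longrightarrow> \<alpha> / 2 \<le> q t e"
    and total: "\<And>t. t \<ge> t0 \<Longrightarrow> (\<Sum>e\<in>directions. q t e) = 1"
    and zs: "length zs \<ge> t0"
  shows "expect directions (\<lambda>ys. q (length ys)) n (\<lambda>ys. product_walk S m (y + sum_list (take n ys))) zs
     \<le> (\<Sum>i\<in>S. smear \<alpha> cube_bound n (m i)) / 3"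
proof (induction n arbitrary: m y)
  case 0
  show ?case using product_walk_le[OF S] by simp
next
  case (Suc n)
  define t where "t = n + length zs"
  have t: "t \<ge> t0" using zs by (simp add: t_def)
  define F where "F = (\<lambda>m y. expect directions (\<lambda>ys. q (length ys)) n (\<lambda>ys. product_walk S m (y + sum_list (take n ys))) zs)"
  define h where "h = smear \<alpha> cube_bound n"
  define H where "H = (\<Sum>i\<in>S. h (m i))"
  \<comment> \<open>the symmetric part of the step law: weight \<open>\<alpha> / 2\<close> on the six directions along \<open>S\<close>\<close>
  define c where "c = (\<lambda>e :: int ^ 'd. \<alpha> / 2 * of_bool (\<exists>i\<in>S. e $ i \<noteq> 0))"
  have c_axis: "c (axis j 1) = \<alpha> / 2 * of_bool (j \<in> S)" "c (- axis j 1) = \<alpha> / 2 * of_bool (j \<in> S)" for j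
    by (auto simp: c_def axis_def)
  have c_le: "c e \<le> q t e" if "e \<in> directions" for e
    using ge[OF t that] \<alpha> unfolding c_def by (cases "\<exists>i\<in>S. e $ i \<noteq> 0") auto
  have IH: "F m' y' \<le> (\<Sum>i\<in>S. h (m' i)) / 3" for m' y'
    using Suc unfolding F_def h_def .
  have F_step: "F m (y + axis j 1) + F m (y - axis j 1) = 2 * F (m(j := Suc (m j))) y" if "j \<in> S" for j
    unfolding F_def expect_plus[symmetric] expect_cmult[symmetric]
  proof (rule expect_cong)
    fix xs :: "(int ^ 'd) list"
    let ?s = "sum_list (take n (xs @ zs))"
    have eqs: "y + axis j 1 + ?s = (y + ?s) + axis j 1" "y - axis j 1 + ?s = (y + ?s) - axis j 1"
      by simp_all
    show "product_walk S m (y + axis j 1 + ?s) + product_walk S m (y - axis j 1 + ?s)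
        = 2 * product_walk S (m(j := Suc (m j))) (y + ?s)"
      unfolding eqs by (rule product_walk_step[OF that])
  qed
  have sum_c: "(\<Sum>e\<in>directions. c e) = 3 * \<alpha>"
  proof -
    have "(\<Sum>e\<in>directions. c e) = (\<Sum>l\<in>UNIV. \<alpha> * of_bool (l \<in> S))"
      unfolding sum_directions c_axis by (rule sum.cong) simp_all
    also have "\<dots> = \<alpha> * real (card S)" unfolding sum_distrib_left[symmetric] by simp
    finally show ?thesis using S by simp
  qed
  have "expect directions (\<lambda>ys. q (length ys)) (Suc n) (\<lambda>ys. product_walk S m (y + sum_list (take (Suc n) ys))) zs
      = expect directions (\<lambda>ys. q (length ys)) n
          (\<lambda>ys. \<Sum>e\<in>directions. q t e * product_walk S m ((y + e) + sum_list (take n ys))) zs"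
    unfolding expect_Suc_last by (rule expect_cong) (simp add: t_def add_ac)
  also have "\<dots> = (\<Sum>e\<in>directions. q t e * F m (y + e))"
    unfolding expect_sum expect_cmult F_def ..
  also have "\<dots> = (\<Sum>e\<in>directions. (q t e - c e) * F m (y + e)) + (\<Sum>e\<in>directions. c e * F m (y + e))"
    by (simp add: algebra_simps flip: sum.distrib)
  also have "(\<Sum>e\<in>directions. (q t e - c e) * F m (y + e)) \<le> (\<Sum>e\<in>directions. (q t e - c e) * (H / 3))"
    using c_le IH[of m] unfolding H_def by (intro sum_mono mult_left_mono) auto
  also have "\<dots> = (1 - 3 * \<alpha>) * (H / 3)"
    unfolding sum_distrib_right[symmetric] sum_subtractf total[OF t] sum_c ..
  also have "(\<Sum>e\<in>directions. c e * F m (y + e)) = (\<Sum>j\<in>UNIV. of_bool (j \<in> S) * (\<alpha> / 2 * (F m (y + axis j 1) + F m (y - axis j 1))))"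
    unfolding sum_directions c_axis by (simp add: algebra_simps)
  also have "\<dots> = (\<Sum>j\<in>S. \<alpha> / 2 * (F m (y + axis j 1) + F m (y - axis j 1)))"
    by (rule sum.mono_neutral_cong_right) auto
  also have "\<dots> = (\<Sum>j\<in>S. \<alpha> * F (m(j := Suc (m j))) y)"
    by (rule sum.cong) (auto simp: F_step)
  also have "\<dots> \<le> (\<Sum>j\<in>S. \<alpha> * ((H + (h (Suc (m j)) - h (m j))) / 3))"
  proof (intro sum_mono mult_left_mono \<alpha>)
    fix j assume j: "j \<in> S"
    have "(\<Sum>i\<in>S. h ((m(j := Suc (m j))) i)) = h (Suc (m j)) + (\<Sum>i\<in>S - {j}. h (m i))"
      using j by (subst sum.remove[of _ j]) auto
    also have "(\<Sum>i\<in>S - {j}. h (m i)) = H - h (m j)"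
      unfolding H_def using j by (subst sum.remove[of _ j]) auto
    finally have "(\<Sum>i\<in>S. h ((m(j := Suc (m j))) i)) = H + (h (Suc (m j)) - h (m j))" by simp
    thus "F (m(j := Suc (m j))) y \<le> (H + (h (Suc (m j)) - h (m j))) / 3"
      using IH[of "m(j := Suc (m j))" y] by simp
  qed
  also have "(1 - 3 * \<alpha>) * (H / 3) + \<dots> = (H + (\<Sum>j\<in>S. \<alpha> * (h (Suc (m j)) - h (m j)))) / 3"
    using S by (simp add: sum.distrib distrib_left sum_divide_distrib[symmetric] sum_distrib_left[symmetric] add_divide_distrib) (simp add: algebra_simps)
  also have "\<dots> = (\<Sum>i\<in>S. smear \<alpha> cube_bound (Suc n) (m i)) / 3"
    unfolding H_def sum.distrib[symmetric] by (simp add: h_def algebra_simps)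
  finally show ?case by simp
qed

text \<open>By the preceding lemma the bound is a constant times the mean of \<open>(1 / sqrt (M + 1)) ^ 3\<close> for a
  binomial \<open>M\<close> with mean \<open>\<alpha> * n\<close>.\<close>

lemma heat_kernel_bound:
  fixes q :: "nat \<Rightarrow> int ^ 'd::finite \<Rightarrow> real"
  assumes d: "3 \<le> CARD('d)" and \<alpha>: "0 < \<alpha>" "\<alpha> \<le> 1"
    and ge: "\<And>t e. t \<ge> t0 \<Longrightarrow> e \<in> directions \<Longrightarrow> \<alpha> / 2 \<le> q t e"
    and tot: "\<And>t. t \<ge> t0 \<Longrightarrow> (\<Sum>e\<in>directions. q t e) = 1"
    and Q: "step_kernel directions (\<lambda>ys. q (length ys))"
    and zs: "length zs \<ge> t0" "zs \<in> lists directions"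
  shows "chance directions (\<lambda>ys. q (length ys)) n (\<lambda>ys. sum_list (take n ys) = 0) zs
     \<le> 3 * (1 / \<alpha> + 2 / \<alpha>\<^sup>2) * (1 / sqrt (real (Suc n))) ^ 3"
proof -
  interpret step_kernel directions "\<lambda>ys. q (length ys)" by (rule Q)
  obtain S :: "'d set" where S: "card S = 3" using d by (metis obtain_subset_with_card_n)
  have "chance directions (\<lambda>ys. q (length ys)) n (\<lambda>ys. sum_list (take n ys) = 0) zs
      \<le> expect directions (\<lambda>ys. q (length ys)) n (\<lambda>ys. product_walk S (\<lambda>_. 0) (0 + sum_list (take n ys))) zs"
    by (intro expect_mono zs) (auto simp: product_walk_def intro!: prod_nonneg)
  also have "\<dots> \<le> (\<Sum>i\<in>S. smear \<alpha> cube_bound n 0) / 3"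
    by (rule heat_kernel_smear) (use S \<alpha> ge tot zs in auto)
  also have "\<dots> = binomial_mean \<alpha> n cube_bound" using S by (simp add: smear_eq)
  also have "\<dots> \<le> binomial_mean \<alpha> n (\<lambda>i. 3 * (1 / sqrt (real (Suc i))) ^ 3)"
  proof (rule binomial_mean_mono)
    fix i
    have "sqrt 2 ^ 3 \<le> (3 :: real)"
    proof (rule power2_le_imp_le)
      have "(sqrt 2 ^ 3)\<^sup>2 = ((sqrt 2)\<^sup>2) ^ 3" by (simp only: power_mult[symmetric] mult.commute)
      thus "(sqrt 2 ^ 3)\<^sup>2 \<le> (3::real)\<^sup>2" by simp
    qed simp
    hence "sqrt 2 ^ 3 * (1 / sqrt (real (Suc i))) ^ 3 \<le> 3 * (1 / sqrt (real (Suc i))) ^ 3"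
      by (intro mult_right_mono) auto
    thus "cube_bound i \<le> 3 * (1 / sqrt (real (Suc i))) ^ 3"
      unfolding cube_bound_def real_sqrt_divide by (simp add: power_divide)
  qed (use \<alpha> in auto)
  also have "\<dots> = 3 * binomial_mean \<alpha> n (\<lambda>i. (1 / sqrt (real (Suc i))) ^ 3)"
    by (rule binomial_mean_scale)
  also have "\<dots> \<le> 3 * ((1 / \<alpha> + 2 / \<alpha>\<^sup>2) * (1 / sqrt (real (Suc n))) ^ 3)"
    using \<alpha> by (intro mult_left_mono binomial_mean_three_halves) auto
  finally show ?thesis by (simp only: mult.assoc)
qed

lemma summable_heat_kernel: "summable (\<lambda>n. C * (1 / sqrt (real (Suc n))) ^ 3)"
proof -
  have pw: "(1 / sqrt (real n)) ^ 3 = real n powr (- 3 / 2)" if "n > 0" for n :: nat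
  proof -
    have "1 / sqrt (real n) = real n powr (- 1 / 2)"
      using that by (simp add: powr_half_sqrt powr_minus_divide)
    hence "(1 / sqrt (real n)) ^ 3 = (real n powr (- 1 / 2)) powr 3"
      using that powr_realpow[of "real n powr (- 1 / 2)" 3] by simp
    also have "\<dots> = real n powr (- 3 / 2)" by (simp add: powr_powr)
    finally show ?thesis .
  qed
  have "(\<lambda>n. (1 / sqrt (real (Suc n))) ^ 3) = (\<lambda>n. real (Suc n) powr (- 3 / 2))"
    by (rule ext) (rule pw, simp)
  moreover have "summable (\<lambda>n. real (Suc n) powr (- 3 / 2))"
    using summable_Suc_iff[of "\<lambda>n. real n powr (- 3 / 2)"] summable_real_powr_iff[of "- 3 / 2"] by simp
  ultimately show ?thesis by (intro summable_mult) simp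
qed

section \<open>Return probabilities in the plane\<close>

text \<open>The coordinates \<open>y $ i + y $ j\<close> and \<open>y $ i - y $ j\<close> of the planar
  walk are independent simple random walks on the integers.\<close>

lemma planar_return:
  fixes y :: "int ^ 'd::finite" and i j :: 'd
  assumes ij: "UNIV = {i, j}" "i \<noteq> j"
  shows "chance directions (\<lambda>_ _. 1 / 4) n (\<lambda>ys. y + sum_list (take n ys) = 0) zs
    = line_walk n (y $ i + y $ j) * line_walk n (y $ i - y $ j)"
proof (induction n arbitrary: y)
  case 0
  have "y = 0 \<longleftrightarrow> (\<forall>l\<in>UNIV. y $ l = 0)" by (simp add: vec_eq_iff)
  also have "\<dots> \<longleftrightarrow> y $ i = 0 \<and> y $ j = 0" unfolding ij by simp
  finally show ?case by auto
next
  case (Suc n)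
  have sum_ij: "(\<Sum>l\<in>UNIV. g l) = g i + g j" for g :: "'d \<Rightarrow> real"
    unfolding ij(1) using ij(2) by simp
  have "chance directions (\<lambda>_ _. 1 / 4) (Suc n) (\<lambda>ys. y + sum_list (take (Suc n) ys) = 0) zs
      = expect directions (\<lambda>_ _. 1 / 4) n (\<lambda>ys. \<Sum>e\<in>directions. 1 / 4 * of_bool ((y + e) + sum_list (take n ys) = 0)) zs"
    unfolding expect_Suc_last take_Suc_Cons sum_list.Cons add.assoc ..
  also have "\<dots> = (\<Sum>e\<in>directions. 1 / 4 * (line_walk n ((y + e) $ i + (y + e) $ j) * line_walk n ((y + e) $ i - (y + e) $ j)))"
    unfolding expect_sum expect_cmult Suc ..
  also have "\<dots> = line_walk (Suc n) (y $ i + y $ j) * line_walk (Suc n) (y $ i - y $ j)"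
  proof -
    have ax: "axis i 1 $ i = (1::int)" "axis j 1 $ j = (1::int)" "axis i 1 $ j = (0::int)" "axis j 1 $ i = (0::int)"
      using ij(2) by (auto simp: axis_def)
    have arg: "y $ i + 1 + (y $ j + 0) = (y $ i + y $ j) + 1" "y $ i + 1 - (y $ j + 0) = (y $ i - y $ j) + 1"
      "y $ i + - 1 + (y $ j + - 0) = (y $ i + y $ j) - 1" "y $ i + - 1 - (y $ j + - 0) = (y $ i - y $ j) - 1"
      "y $ i + 0 + (y $ j + 1) = (y $ i + y $ j) + 1" "y $ i + 0 - (y $ j + 1) = (y $ i - y $ j) - 1"
      "y $ i + - 0 + (y $ j + - 1) = (y $ i + y $ j) - 1" "y $ i + - 0 - (y $ j + - 1) = (y $ i - y $ j) + 1"
      by simp_all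
    show ?thesis
      unfolding sum_directions sum_ij vector_add_component vector_uminus_component ax arg line_walk.simps
      by (simp add: algebra_simps)
  qed
  finally show ?case .
qed


section \<open>The law of the elephant random walk\<close>

primrec history :: "(nat \<Rightarrow> 'a \<Rightarrow> 'b) \<Rightarrow> nat \<Rightarrow> 'a \<Rightarrow> 'b list" where
  "history X 0 \<omega> = []"
| "history X (Suc n) \<omega> = X (Suc n) \<omega> # history X n \<omega>"

lemma length_history [simp]: "length (history X n \<omega>) = n"
  by (induction n) auto

lemma nth_history: "i < n \<Longrightarrow> history X n \<omega> ! i = X (n - i) \<omega>"
  by (induction n arbitrary: i) (auto simp: nth_Cons split: nat.split)

lemma history_eq_iff:
  "length xs = n \<Longrightarrow> history X n \<omega> = xs \<longleftrightarrow> (\<forall>j\<in>{1..<Suc n}. X j \<omega> = xs ! (n - j))"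
proof -
  assume len: "length xs = n"
  have "history X n \<omega> = xs \<longleftrightarrow> (\<forall>i<n. X (n - i) \<omega> = xs ! i)"
    using len by (auto simp: list_eq_iff_nth_eq nth_history)
  also have "\<dots> \<longleftrightarrow> (\<forall>j\<in>{1..<Suc n}. X j \<omega> = xs ! (n - j))"
  proof (intro iffI ballI allI impI)
    fix j assume *: "\<forall>i<n. X (n - i) \<omega> = xs ! i" and j: "j \<in> {1..<Suc n}"
    have "n - j < n" "n - (n - j) = j" using j by auto
    thus "X j \<omega> = xs ! (n - j)" using * by metis
  next
    fix i assume *: "\<forall>j\<in>{1..<Suc n}. X j \<omega> = xs ! (n - j)" and i: "i < n"
    have "n - i \<in> {1..<Suc n}" "n - (n - i) = i" using i by auto
    thus "X (n - i) \<omega> = xs ! i" using * by metis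
  qed
  finally show ?thesis .
qed

lemma sum_list_history: "sum_list (history X n \<omega>) = walk X n \<omega>"
  by (induction n) (simp_all add: walk_def add.commute)

lemma sites_history: "sites (history X n \<omega>) = walk_range X n \<omega>"
proof (induction n)
  case (Suc n)
  have "X (Suc n) \<omega> + sum_list (history X n \<omega>) = walk X (Suc n) \<omega>"
    using sum_list_history[of X "Suc n" \<omega>] by simp
  thus ?case using Suc by (simp add: walk_range_def atLeast0AtMost atMost_Suc)
qed (simp add: walk_range_def walk_def)

primrec path_weight :: "('b list \<Rightarrow> 'b \<Rightarrow> real) \<Rightarrow> 'b list \<Rightarrow> real" where
  "path_weight K [] = 1"
| "path_weight K (e # xs) = path_weight K xs * K xs e"

definition paths :: "'b set \<Rightarrow> nat \<Rightarrow> 'b list set" where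
  "paths D n = {xs. set xs \<subseteq> D \<and> length xs = n}"

lemma finite_paths: "finite D \<Longrightarrow> finite (paths D n)"
  unfolding paths_def by (rule finite_lists_length_eq)

lemma paths_Suc: "paths D (Suc n) = (\<lambda>(xs, e). e # xs) ` (paths D n \<times> D)"
proof (intro equalityI subsetI)
  fix ys assume "ys \<in> paths D (Suc n)"
  thus "ys \<in> (\<lambda>(xs, e). e # xs) ` (paths D n \<times> D)" by (cases ys) (auto simp: paths_def image_iff)
qed (auto simp: paths_def)

lemma expect_eq_sum:
  assumes "finite D"
  shows "expect D K n f [] = (\<Sum>xs\<in>paths D n. path_weight K xs * f xs)"
proof (induction n arbitrary: f)
  case 0
  have "paths D 0 = {[]}" by (auto simp: paths_def)
  thus ?case by simp
next
  case (Suc n)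
  have "expect D K (Suc n) f [] = (\<Sum>xs\<in>paths D n. \<Sum>e\<in>D. path_weight K xs * (K xs e * f (e # xs)))"
    unfolding expect_Suc_last Suc sum_distrib_left ..
  also have "\<dots> = (\<Sum>(xs, e)\<in>paths D n \<times> D. path_weight K (e # xs) * f (e # xs))"
    by (simp add: sum.cartesian_product mult.assoc)
  also have "\<dots> = (\<Sum>ys\<in>paths D (Suc n). path_weight K ys * f ys)"
    unfolding paths_Suc by (subst sum.reindex) (auto simp: inj_on_def intro!: sum.cong)
  finally show ?case .
qed

lemma path_weight_uniform: "path_weight (\<lambda>_ _. c) xs = c ^ length xs"
  by (induction xs) auto

context elephant_random_walk
begin

lemma pred_increment [measurable]: "1 \<le> n \<Longrightarrow> Measurable.pred M (\<lambda>\<omega>. X n \<omega> = e)"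
proof -
  assume "1 \<le> n"
  hence X: "X n \<in> measurable M (count_space directions)" by (rule increments)
  have "X n -` ({e} \<inter> directions) \<inter> space M \<in> sets M"
    by (rule measurable_sets[OF X]) auto
  also have "X n -` ({e} \<inter> directions) \<inter> space M = {\<omega>\<in>space M. X n \<omega> = e}"
    using measurable_space[OF X] by auto
  finally show ?thesis by (simp add: pred_def)
qed

lemma pred_memory [measurable]: "2 \<le> n \<Longrightarrow> Measurable.pred M (\<lambda>\<omega>. u n \<omega> = k)"
proof -
  assume "2 \<le> n"
  hence U: "u n \<in> measurable M (count_space {1..n - 1})" by (rule memory_times)
  have "u n -` ({k} \<inter> {1..n - 1}) \<inter> space M \<in> sets M"
    by (rule measurable_sets[OF U]) auto
  also have "u n -` ({k} \<inter> {1..n - 1}) \<inter> space M = {\<omega>\<in>space M. u n \<omega> = k}"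
    using measurable_space[OF U] by auto
  finally show ?thesis by (simp add: pred_def)
qed

lemma pred_past [measurable]: "Measurable.pred M (past X u n x v)"
  unfolding past_def[abs_def] by (intro pred_intros_logic pred_intros_finite) auto

lemma history_in_paths: "\<omega> \<in> space M \<Longrightarrow> history X n \<omega> \<in> paths directions n"
proof (induction n)
  case (Suc n)
  have "X (Suc n) \<omega> \<in> directions"
    using measurable_space[OF increments[of "Suc n"]] Suc by simp
  thus ?case using Suc by (simp add: paths_def)
qed (simp add: paths_def)

lemma pred_history [measurable]: "Measurable.pred M (\<lambda>\<omega>. history X n \<omega> = xs)"
proof (cases "length xs = n")
  case True
  show ?thesis unfolding history_eq_iff[OF True] by (intro pred_intros_finite) auto
next
  case False
  hence "(\<lambda>\<omega>. history X n \<omega> = xs) = (\<lambda>_. False)" using length_history by (metis (mono_tags))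
  thus ?thesis by simp
qed

definition step_chance :: "int ^ 'd \<Rightarrow> int ^ 'd \<Rightarrow> real" where
  "step_chance y e = (if e = y then p else (1 - p) / (2 * real CARD('d) - 1))"

text \<open>The hypotheses on the conditional probabilities only apply to pasts of positive probability;
  for the others both sides vanish.\<close>

lemma prob_past_step:
  assumes n: "1 \<le> n" and e: "e \<in> directions" and k: "k \<in> {1..n}"
  shows "\<P>(\<omega> in M. past X u (Suc n) x v \<omega> \<and> u (Suc n) \<omega> = k \<and> X (Suc n) \<omega> = e)
    = \<P>(\<omega> in M. past X u (Suc n) x v \<omega>) * (step_chance (x k) e / real n)"
proof (cases "\<P>(\<omega> in M. past X u (Suc n) x v \<omega>) = 0")
  case True
  have "\<P>(\<omega> in M. past X u (Suc n) x v \<omega> \<and> u (Suc n) \<omega> = k \<and> X (Suc n) \<omega> = e)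
      \<le> \<P>(\<omega> in M. past X u (Suc n) x v \<omega>)"
    by (rule finite_measure_mono) auto
  thus ?thesis using True by (simp add: measure_le_0_iff)
next
  case False
  let ?p = "\<P>(\<omega> in M. past X u (Suc n) x v \<omega>)"
  have pos: "?p > 0" using False by (simp add: zero_less_measure_iff)
  have "\<P>(\<omega> in M. u (Suc n) \<omega> = k \<bar> past X u (Suc n) x v \<omega>) = 1 / (real (Suc n) - 1)"
    by (rule memory_time) (use n k pos in auto)
  hence 1: "\<P>(\<omega> in M. past X u (Suc n) x v \<omega> \<and> u (Suc n) \<omega> = k) = ?p / real n"
    using False by (simp add: cond_prob_def conj_commute field_simps)
  hence pos2: "\<P>(\<omega> in M. past X u (Suc n) x v \<omega> \<and> u (Suc n) \<omega> = k) > 0" using pos n by simp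
  have "\<P>(\<omega> in M. X (Suc n) \<omega> = e \<bar> past X u (Suc n) x v \<omega> \<and> u (Suc n) \<omega> = k) = step_chance (x k) e"
    unfolding step_chance_def by (rule next_increment) (use n k e pos2 in auto)
  moreover have "{\<omega>\<in>space M. X (Suc n) \<omega> = e \<and> past X u (Suc n) x v \<omega> \<and> u (Suc n) \<omega> = k}
      = {\<omega>\<in>space M. past X u (Suc n) x v \<omega> \<and> u (Suc n) \<omega> = k \<and> X (Suc n) \<omega> = e}" by auto
  ultimately have "\<P>(\<omega> in M. past X u (Suc n) x v \<omega> \<and> u (Suc n) \<omega> = k \<and> X (Suc n) \<omega> = e)
      = step_chance (x k) e * \<P>(\<omega> in M. past X u (Suc n) x v \<omega> \<and> u (Suc n) \<omega> = k)"
    using pos2 by (simp add: cond_prob_def field_simps)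
  thus ?thesis unfolding 1 by simp
qed

text \<open>The step law given the increments only: the remembered time is uniform over the path.\<close>

definition mean_step_chance :: "(int ^ 'd) list \<Rightarrow> int ^ 'd \<Rightarrow> real" where
  "mean_step_chance xs e = (if xs = [] then 1 / (2 * real CARD('d))
     else (\<Sum>y\<leftarrow>xs. step_chance y e) / real (length xs))"

lemma prob_first: "e \<in> directions \<Longrightarrow> \<P>(\<omega> in M. X 1 \<omega> = e) = 1 / (2 * real CARD('d))"
proof -
  assume e: "e \<in> directions"
  have X: "X 1 \<in> measurable M (count_space directions)" by (rule increments) simp
  have "measure (distr M (count_space directions) (X 1)) {e} = \<P>(\<omega> in M. X 1 \<omega> = e)"
    using e by (subst measure_distr[OF X]) (auto simp: vimage_def Int_def conj_commute)
  moreover have "measure (uniform_count_measure (directions :: (int ^ 'd) set)) {e} = 1 / (2 * real CARD('d))"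
    using e measure_uniform_count_measure[of "directions :: (int ^ 'd) set" "{e}"] by (simp add: card_directions)
  ultimately show ?thesis by (simp only: first_increment)
qed

text \<open>The remembered times are summed out: the event of a given history is the disjoint union, over
  the finitely many possible sequences \<open>v\<close> of remembered times, of the events to which the
  hypotheses apply.\<close>

lemma prob_history_step:
  assumes n: "1 \<le> n" and xs: "xs \<in> paths directions n" and e: "e \<in> directions"
  shows "\<P>(\<omega> in M. history X n \<omega> = xs \<and> X (Suc n) \<omega> = e)
    = \<P>(\<omega> in M. history X n \<omega> = xs) * mean_step_chance xs e"
proof -
  define x where "x = (\<lambda>j. xs ! (n - j))"
  define V where "V = Pi\<^sub>E {2..<Suc n} (\<lambda>j. {1..j - 1})"
  define A where "A = (\<lambda>v. {\<omega>\<in>space M. past X u (Suc n) x v \<omega>})"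
  have len: "length xs = n" using xs by (simp add: paths_def)
  have V: "finite V" unfolding V_def by (intro finite_PiE) auto
  have past_iff: "past X u (Suc n) x v \<omega> \<longleftrightarrow> history X n \<omega> = xs \<and> (\<forall>j\<in>{2..<Suc n}. u j \<omega> = v j)" for v \<omega>
    unfolding past_def x_def history_eq_iff[OF len] ..
  have cover: "\<exists>v\<in>V. \<forall>j\<in>{2..<Suc n}. u j \<omega> = v j" if "\<omega> \<in> space M" for \<omega>
  proof -
    have "u j \<omega> \<in> {1..j - 1}" if "j \<in> {2..<Suc n}" for j
      using measurable_space[OF memory_times[of j] \<open>\<omega> \<in> space M\<close>] that by simp
    hence "restrict (\<lambda>j. u j \<omega>) {2..<Suc n} \<in> V" unfolding V_def by auto
    moreover have "\<forall>j\<in>{2..<Suc n}. u j \<omega> = restrict (\<lambda>j. u j \<omega>) {2..<Suc n} j" by simp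
    ultimately show ?thesis by blast
  qed
  have disj: "v = w" if "v \<in> V" "w \<in> V" "\<forall>j\<in>{2..<Suc n}. v j = w j" for v w
    using that unfolding V_def by (intro PiE_ext) auto
  have decompose: "\<P>(\<omega> in M. history X n \<omega> = xs \<and> B \<omega>) = (\<Sum>v\<in>V. \<P>(\<omega> in M. past X u (Suc n) x v \<omega> \<and> B \<omega>))"
    if [measurable]: "Measurable.pred M B" for B
  proof -
    have "{\<omega>\<in>space M. history X n \<omega> = xs \<and> B \<omega>} = (\<Union>v\<in>V. {\<omega>\<in>space M. past X u (Suc n) x v \<omega> \<and> B \<omega>})"
      using cover unfolding past_iff by blast
    moreover have "disjoint_family_on (\<lambda>v. {\<omega>\<in>space M. past X u (Suc n) x v \<omega> \<and> B \<omega>}) V"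
      unfolding disjoint_family_on_def
    proof (intro ballI impI equals0I)
      fix v w \<omega> assume vw: "v \<in> V" "w \<in> V" "v \<noteq> w"
        and "\<omega> \<in> {\<omega>\<in>space M. past X u (Suc n) x v \<omega> \<and> B \<omega>} \<inter> {\<omega>\<in>space M. past X u (Suc n) x w \<omega> \<and> B \<omega>}"
      hence "\<forall>j\<in>{2..<Suc n}. v j = w j" unfolding past_iff by auto
      thus False using disj vw by blast
    qed
    ultimately show ?thesis using V
      by (simp add: finite_measure_finite_Union image_subset_iff)
  qed
  have step: "\<P>(\<omega> in M. past X u (Suc n) x v \<omega> \<and> X (Suc n) \<omega> = e)
      = \<P>(\<omega> in M. past X u (Suc n) x v \<omega>) * mean_step_chance xs e" for v
  proof -
    have [measurable]: "Measurable.pred M (\<lambda>\<omega>. X (Suc n) \<omega> = e)" "Measurable.pred M (\<lambda>\<omega>. u (Suc n) \<omega> = k)" for k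
      using n by (auto intro!: pred_increment pred_memory)
    have "{\<omega>\<in>space M. past X u (Suc n) x v \<omega> \<and> X (Suc n) \<omega> = e}
        = (\<Union>k\<in>{1..n}. {\<omega>\<in>space M. past X u (Suc n) x v \<omega> \<and> u (Suc n) \<omega> = k \<and> X (Suc n) \<omega> = e})"
      using measurable_space[OF memory_times[of "Suc n"]] n by auto
    moreover have "disjoint_family_on (\<lambda>k. {\<omega>\<in>space M. past X u (Suc n) x v \<omega> \<and> u (Suc n) \<omega> = k \<and> X (Suc n) \<omega> = e}) {1..n}"
      by (auto simp: disjoint_family_on_def)
    ultimately have "\<P>(\<omega> in M. past X u (Suc n) x v \<omega> \<and> X (Suc n) \<omega> = e)
        = (\<Sum>k\<in>{1..n}. \<P>(\<omega> in M. past X u (Suc n) x v \<omega> \<and> u (Suc n) \<omega> = k \<and> X (Suc n) \<omega> = e))"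
      by (simp add: finite_measure_finite_Union image_subset_iff)
    also have "\<dots> = (\<Sum>k\<in>{1..n}. \<P>(\<omega> in M. past X u (Suc n) x v \<omega>) * (step_chance (x k) e / real n))"
      by (intro sum.cong prob_past_step n e) auto
    also have "\<dots> = \<P>(\<omega> in M. past X u (Suc n) x v \<omega>) * ((\<Sum>k\<in>{1..n}. step_chance (x k) e) / real n)"
      by (simp add: sum_distrib_left sum_divide_distrib)
    also have "(\<Sum>k\<in>{1..n}. step_chance (x k) e) = (\<Sum>i\<in>{..<n}. step_chance (xs ! i) e)"
      unfolding x_def by (rule sum.reindex_bij_witness[of _ "\<lambda>i. n - i" "\<lambda>k. n - k"]) auto
    also have "\<dots> = (\<Sum>y\<leftarrow>xs. step_chance y e)"
      by (simp add: sum_list_sum_nth len atLeast0LessThan)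
    finally show ?thesis using n len by (auto simp: mean_step_chance_def)
  qed
  have "\<P>(\<omega> in M. history X n \<omega> = xs \<and> X (Suc n) \<omega> = e)
      = (\<Sum>v\<in>V. \<P>(\<omega> in M. past X u (Suc n) x v \<omega> \<and> X (Suc n) \<omega> = e))"
    by (rule decompose) (rule pred_increment, simp)
  also have "\<dots> = (\<Sum>v\<in>V. \<P>(\<omega> in M. past X u (Suc n) x v \<omega>)) * mean_step_chance xs e"
    unfolding step sum_distrib_right ..
  also have "(\<Sum>v\<in>V. \<P>(\<omega> in M. past X u (Suc n) x v \<omega>)) = \<P>(\<omega> in M. history X n \<omega> = xs)"
    using decompose[of "\<lambda>_. True"] by simp
  finally show ?thesis .
qed

lemma prob_history:
  "xs \<in> paths directions n \<Longrightarrow> \<P>(\<omega> in M. history X n \<omega> = xs) = path_weight mean_step_chance xs"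
proof (induction n arbitrary: xs)
  case 0
  thus ?case by (simp add: paths_def prob_space)
next
  case (Suc n)
  then obtain e ys where xs: "xs = e # ys" "e \<in> directions" "ys \<in> paths directions n"
    unfolding paths_Suc by auto
  have "\<P>(\<omega> in M. history X (Suc n) \<omega> = xs) = \<P>(\<omega> in M. history X n \<omega> = ys \<and> X (Suc n) \<omega> = e)"
    unfolding xs by (simp add: conj_commute)
  also have "\<dots> = \<P>(\<omega> in M. history X n \<omega> = ys) * mean_step_chance ys e"
  proof (cases "n = 0")
    case True
    thus ?thesis using xs prob_first[of e] by (simp add: paths_def mean_step_chance_def prob_space)
  next
    case False
    thus ?thesis by (intro prob_history_step xs) auto
  qed
  finally show ?case using Suc.IH xs by simp
qed

lemma
  shows integrable_history: "integrable M (\<lambda>\<omega>. f (history X n \<omega>) :: real)"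
    and integral_history: "(\<integral>\<omega>. f (history X n \<omega>) \<partial>M) = expect directions mean_step_chance n f []"
proof -
  let ?P = "paths directions n :: (int ^ 'd) list set"
  let ?A = "\<lambda>xs. {\<omega>\<in>space M. history X n \<omega> = xs}"
  have P: "finite ?P" by (rule finite_paths) simp
  have eq: "f (history X n \<omega>) = (\<Sum>xs\<in>?P. f xs * indicator (?A xs) \<omega>)" if "\<omega> \<in> space M" for \<omega>
  proof -
    have "(\<Sum>xs\<in>?P. f xs * indicator (?A xs) \<omega>) = (\<Sum>xs\<in>?P. if xs = history X n \<omega> then f xs else 0)"
      using that by (intro sum.cong) (auto simp: indicator_def)
    thus ?thesis using P history_in_paths[OF that, of n] by simp
  qed
  have int: "integrable M (\<lambda>\<omega>. \<Sum>xs\<in>?P. f xs * indicator (?A xs) \<omega>)"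
    by (intro Bochner_Integration.integrable_sum integrable_mult_right integrable_real_indicator) (auto simp: emeasure_eq_measure)
  show "integrable M (\<lambda>\<omega>. f (history X n \<omega>) :: real)"
    using int by (subst Bochner_Integration.integrable_cong[OF refl eq])
  have "(\<integral>\<omega>. f (history X n \<omega>) \<partial>M) = (\<integral>\<omega>. (\<Sum>xs\<in>?P. f xs * indicator (?A xs) \<omega>) \<partial>M)"
    by (rule Bochner_Integration.integral_cong[OF refl eq])
  also have "\<dots> = (\<Sum>xs\<in>?P. f xs * measure M (?A xs))"
    by (subst Bochner_Integration.integral_sum) (auto simp: emeasure_eq_measure intro!: integrable_real_indicator)
  also have "\<dots> = expect directions mean_step_chance n f []"
    unfolding expect_eq_sum[OF finite_directions] using prob_history by (intro sum.cong) auto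
  finally show "(\<integral>\<omega>. f (history X n \<omega>) \<partial>M) = expect directions mean_step_chance n f []" .
qed

end

section \<open>The Green function\<close>

text \<open>The dimension enters only through a type; the parameter \<open>dim\<close> names this type, so
  that the locale can be interpreted for a given one.\<close>

locale lattice_walk = reinforced_steps "directions :: (int ^ 'd::finite) set" a
  for a :: real and dim :: "'d::finite itself"
begin

lemma u_eq: "u = 1 / (2 * real CARD('d))"
  by (simp add: u_def card_directions)

text \<open>Outside a null set all steps are directions. There the indicator of \<open>walk n = 0\<close>
  agrees with that of a finite union of cylinder sets, which makes the visits measurable and gives their
  probabilities.\<close>

lemma green_eq:
  "green (0 :: int ^ 'd) = (\<Sum>n. ennreal (srw_return n))"
proof -
  let ?D = "directions :: (int ^ 'd) set"
  let ?M = "srw_space :: (nat \<Rightarrow> int ^ 'd) measure"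
  interpret product_prob_space "\<lambda>_. measure_pmf (pmf_of_set ?D)" "UNIV :: nat set"
    by unfold_locales
  interpret M: prob_space ?M unfolding srw_space_def by (rule prob_space_PiM) unfold_locales
  let ?X = "\<lambda>j (\<omega> :: nat \<Rightarrow> int ^ 'd). \<omega> j"
  let ?A = "\<lambda>n xs. {\<omega>\<in>space ?M. history ?X n \<omega> = xs}"
  have A: "?A n xs \<in> sets ?M" "measure ?M (?A n xs) = u ^ n" if "xs \<in> paths ?D n" for n xs
  proof -
    have len: "length xs = n" using that by (simp add: paths_def)
    have eq: "?A n xs = {\<omega>\<in>space ?M. \<forall>j\<in>{1..<Suc n}. \<omega> j \<in> {xs ! (n - j)}}"
      unfolding history_eq_iff[OF len] by simp
    show "?A n xs \<in> sets ?M" unfolding eq unfolding srw_space_def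
      by (rule sets.sets_Collect_finite_All) (auto intro!: sets_Collect_single')
    have "emeasure ?M (?A n xs) = (\<Prod>j\<in>{1..<Suc n}. emeasure (measure_pmf (pmf_of_set ?D)) {xs ! (n - j)})"
      unfolding eq unfolding srw_space_def by (rule emeasure_PiM_Collect) auto
    also have "\<dots> = (\<Prod>j\<in>{1..<Suc n}. ennreal u)"
    proof (rule prod.cong)
      fix j assume "j \<in> {1..<Suc n}"
      hence "n - j < length xs" using len by auto
      hence "xs ! (n - j) \<in> ?D" using that nth_mem by (auto simp: paths_def)
      thus "emeasure (measure_pmf (pmf_of_set ?D)) {xs ! (n - j)} = ennreal u"
        by (simp add: emeasure_pmf_single u_def)
    qed simp
    also have "\<dots> = ennreal (u ^ n)" using u_pos by (simp add: ennreal_power)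
    finally show "measure ?M (?A n xs) = u ^ n"
      using u_pos by (simp add: M.emeasure_eq_measure)
  qed
  define B where "B = (\<lambda>n S. \<Union>xs\<in>paths ?D n \<inter> S. ?A n xs)"
  have fin: "finite (paths ?D n \<inter> S)" for n S using finite_paths[of ?D n] by simp
  have B_sets: "B n S \<in> sets ?M" for n S unfolding B_def using fin A by (intro sets.finite_UN) auto
  have B_measure: "measure ?M (B n {xs. Q xs}) = chance ?D uniform n Q []" for n Q
  proof -
    have "measure ?M (B n {xs. Q xs}) = (\<Sum>xs\<in>paths ?D n \<inter> {xs. Q xs}. measure ?M (?A n xs))"
      unfolding B_def using fin A by (intro M.finite_measure_finite_Union) (auto simp: disjoint_family_on_def)
    also have "\<dots> = (\<Sum>xs\<in>paths ?D n. path_weight uniform xs * of_bool (Q xs))"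
    proof (rule sum.mono_neutral_cong_left)
      fix xs assume "xs \<in> paths ?D n \<inter> {xs. Q xs}"
      moreover have "uniform = (\<lambda>_ _. u)" by (intro ext) (simp add: uniform_def)
      ultimately show "measure ?M (?A n xs) = path_weight uniform xs * of_bool (Q xs)"
        using A(2) by (simp add: path_weight_uniform) (auto simp: paths_def)
    qed (auto intro: finite_paths)
    finally show ?thesis by (simp add: expect_eq_sum)
  qed
  have "measure ?M (B n UNIV) = 1" for n
    using B_measure[of n "\<lambda>_. True"] by (simp add: U.expect_const)
  hence "AE \<omega> in ?M. \<omega> \<in> B n UNIV" for n using M.prob_eq_1[OF B_sets] by simp
  hence ae: "AE \<omega> in ?M. \<forall>n. \<omega> \<in> B n UNIV" by (simp add: AE_all_countable)
  let ?Z = "{xs :: (int ^ 'd) list. sum_list xs = 0}"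
  have "green (0 :: int ^ 'd) = (\<integral>\<^sup>+\<omega>. (\<Sum>n. indicator (B n ?Z) \<omega>) \<partial>?M)"
    unfolding green_def
  proof (rule nn_integral_cong_AE)
    show "AE \<omega> in ?M. (\<Sum>n. indicator {0} (walk ?X n \<omega>)) = (\<Sum>n. indicator (B n ?Z) \<omega> :: ennreal)"
      using ae
    proof eventually_elim
      case (elim \<omega>)
      have "indicator {0} (walk ?X n \<omega>) = (indicator (B n ?Z) \<omega> :: ennreal)" for n
      proof -
        have "history ?X n \<omega> \<in> paths ?D n" "\<omega> \<in> space ?M" using elim[rule_format, of n] by (auto simp: B_def)
        hence "\<omega> \<in> B n ?Z \<longleftrightarrow> sum_list (history ?X n \<omega>) = 0" by (auto simp: B_def)
        thus ?thesis by (simp add: sum_list_history indicator_def)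
      qed
      thus ?case by simp
    qed
  qed
  also have "\<dots> = (\<Sum>n. \<integral>\<^sup>+\<omega>. indicator (B n ?Z) \<omega> \<partial>?M)"
    by (rule nn_integral_suminf) (use B_sets in auto)
  also have "\<dots> = (\<Sum>n. ennreal (srw_return n))"
    using B_sets by (simp add: M.emeasure_eq_measure B_measure srw_return_def)
  finally show ?thesis .
qed

end


section \<open>Convergence in mean and reduction to independent steps\<close>

text \<open>\<open>\<bar>z - c\<bar> = (z - c) + 2 * max 0 (c - z)\<close>, and \<open>c - z\<close> is at
  most \<open>\<epsilon>\<close> outside the lower tail and at most \<open>c\<close> on it.\<close>

lemma (in step_kernel) L1_deviation_le:
  assumes c: "0 \<le> c" "0 < \<epsilon>"
    and Z: "\<And>ys. ys \<in> lists D \<Longrightarrow> length ys = n \<Longrightarrow> 0 \<le> Z ys"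
  shows "expect D K n (\<lambda>ys. \<bar>Z ys - c\<bar>) []
    \<le> (expect D K n Z [] - c) + 2 * \<epsilon> + 2 * c * chance D K n (\<lambda>ys. Z ys \<le> c - \<epsilon>) []"
proof -
  have "expect D K n (\<lambda>ys. \<bar>Z ys - c\<bar>) []
      \<le> expect D K n (\<lambda>ys. Z ys + ((- c + 2 * \<epsilon>) + (2 * c) * of_bool (Z ys \<le> c - \<epsilon>))) []"
  proof (rule expect_mono)
    fix zs assume "zs \<in> lists D" "length zs = n"
    hence "0 \<le> Z (zs @ [])" using Z by simp
    thus "\<bar>Z (zs @ []) - c\<bar> \<le> Z (zs @ []) + ((- c + 2 * \<epsilon>) + (2 * c) * of_bool (Z (zs @ []) \<le> c - \<epsilon>))"
      using c by (auto simp: abs_if)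
  qed simp
  also have "\<dots> = (expect D K n Z [] - c) + 2 * \<epsilon> + 2 * c * chance D K n (\<lambda>ys. Z ys \<le> c - \<epsilon>) []"
    unfolding expect_plus expect_cmult by (simp add: expect_const)
  finally show ?thesis .
qed

lemma L1_convergence_criterion:
  assumes K: "step_kernel D K" and c: "0 \<le> c"
    and Z: "\<And>n ys. 0 \<le> Z n ys"
    and upper: "\<And>\<epsilon>. 0 < \<epsilon> \<Longrightarrow> \<forall>\<^sub>F n in sequentially. expect D K n (Z n) [] \<le> c + \<epsilon>"
    and lower: "\<And>\<epsilon> \<tau>. 0 < \<epsilon> \<Longrightarrow> 0 < \<tau> \<Longrightarrow>
      \<forall>\<^sub>F n in sequentially. chance D K n (\<lambda>ys. Z n ys \<le> c - \<epsilon>) [] \<le> \<tau>"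
  shows "(\<lambda>n. expect D K n (\<lambda>ys. \<bar>Z n ys - c\<bar>) []) \<longlonglongrightarrow> 0"
proof (rule tendstoI)
  interpret step_kernel D K by (rule K)
  fix e :: real assume e: "0 < e"
  define \<tau> where "\<tau> = e / (8 * (c + 1))"
  have \<tau>: "0 < \<tau>" "2 * c * \<tau> \<le> e / 4" using e c by (auto simp: \<tau>_def field_simps)
  have "0 < e / 8" using e by simp
  from upper[OF this] lower[OF this \<tau>(1)]
  show "\<forall>\<^sub>F n in sequentially. dist (expect D K n (\<lambda>ys. \<bar>Z n ys - c\<bar>) []) 0 < e"
  proof eventually_elim
    case (elim n)
    have "expect D K n (\<lambda>ys. \<bar>Z n ys - c\<bar>) []
        \<le> (expect D K n (Z n) [] - c) + 2 * (e / 8) + 2 * c * chance D K n (\<lambda>ys. Z n ys \<le> c - e / 8) []"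
      by (rule L1_deviation_le) (use c e Z in auto)
    also have "\<dots> \<le> e / 8 + 2 * (e / 8) + 2 * c * \<tau>"
      using elim c by (intro add_mono mult_left_mono) auto
    also have "\<dots> < e" using \<tau>(2) e by simp
    finally have "expect D K n (\<lambda>ys. \<bar>Z n ys - c\<bar>) [] < e" .
    moreover have "0 \<le> expect D K n (\<lambda>ys. \<bar>Z n ys - c\<bar>) []"
      by (rule expect_lower) auto
    ultimately show ?case by simp
  qed
qed

context reinforced_steps
begin

lemma chance_uniform_avoids: "chance D uniform m (avoids m) xs = srw_avoid m"
proof -
  have "chance D uniform m (avoids m) xs = chance D uniform m (\<lambda>ys. avoids m (take m ys)) xs"
    by (simp add: avoids_take)
  thus ?thesis unfolding chance_uniform_take[of m "avoids m"] srw_avoid_def .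
qed

lemma near_uniform_divergence:
  assumes Q: "step_kernel D Q" and xs: "xs \<in> lists D"
    and near: "\<And>ys e. ys \<in> lists D \<Longrightarrow> e \<in> D \<Longrightarrow> \<bar>Q ys e - u\<bar> \<le> \<eta>"
  shows "divergence_cost D Q uniform m xs \<le> real m * ((real (card D))\<^sup>2 * \<eta>\<^sup>2)"
proof -
  interpret Q: step_kernel D Q by (rule Q)
  have "expect D Q i (\<lambda>ys. chi_square D (Q ys) (uniform ys)) xs \<le> (real (card D))\<^sup>2 * \<eta>\<^sup>2" for i
  proof (rule Q.expect_upper[OF xs])
    fix zs assume zs: "zs \<in> lists D"
    have "chi_square D (Q (zs @ xs)) (uniform (zs @ xs)) \<le> (\<Sum>e\<in>D. \<eta>\<^sup>2 / u)"
      unfolding chi_square_def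
    proof (rule sum_mono)
      fix e assume "e \<in> D"
      hence "\<bar>Q (zs @ xs) e - u\<bar> \<le> \<eta>" using near[of "zs @ xs" e] zs xs by auto
      hence "\<bar>Q (zs @ xs) e - u\<bar>\<^sup>2 \<le> \<eta>\<^sup>2" by (intro power_mono) auto
      thus "(Q (zs @ xs) e - uniform (zs @ xs) e)\<^sup>2 / uniform (zs @ xs) e \<le> \<eta>\<^sup>2 / u"
        using u_pos by (simp add: uniform_def divide_right_mono)
    qed
    thus "chi_square D (Q (zs @ xs)) (uniform (zs @ xs)) \<le> (real (card D))\<^sup>2 * \<eta>\<^sup>2"
      by (simp add: u_def power2_eq_square mult_ac)
  qed
  hence "divergence_cost D Q uniform m xs \<le> (\<Sum>i<m. (real (card D))\<^sup>2 * \<eta>\<^sup>2)"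
    unfolding divergence_cost_def by (intro sum_mono)
  thus ?thesis by simp
qed

text \<open>The cost over \<open>m\<close> steps is at most \<open>m * (card D)\<^sup>2 * \<eta>\<^sup>2\<close>; so for fixed \<open>m\<close> and \<open>t\<close>, a small
  \<open>\<eta>\<close> makes the error \<open>\<delta>\<close> small.\<close>

lemma near_uniform_avoid:
  assumes Q: "step_kernel D Q" and xs: "xs \<in> lists D" and t: "0 < t" "t \<le> 1"
    and near: "\<And>ys e. ys \<in> lists D \<Longrightarrow> e \<in> D \<Longrightarrow> \<bar>Q ys e - u\<bar> \<le> \<eta>"
    and bound: "real m * ((real (card D))\<^sup>2 * \<eta>\<^sup>2) / t \<le> \<delta>"
  shows "chance D Q m (avoids m) xs \<le> srw_avoid m + t + \<delta>"
    and "srw_avoid m - t - \<delta> \<le> chance D Q m (avoids m) xs"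
proof -
  have "divergence_cost D Q uniform m xs / t \<le> real m * ((real (card D))\<^sup>2 * \<eta>\<^sup>2) / t"
    using t by (intro divide_right_mono near_uniform_divergence[OF Q xs near]) auto
  hence cost: "divergence_cost D Q uniform m xs / t \<le> \<delta>" using bound by simp
  have "t * srw_avoid m \<le> t * 1" using t srw_avoid_bounds by (intro mult_left_mono) auto
  thus "chance D Q m (avoids m) xs \<le> srw_avoid m + t + \<delta>"
    using chance_compare(1)[OF Q uniform_kernel uniform_pos xs t, of m "avoids m"] cost
    unfolding chance_uniform_avoids by (simp add: algebra_simps)
  show "srw_avoid m - t - \<delta> \<le> chance D Q m (avoids m) xs"
    using chance_compare(2)[OF Q uniform_kernel uniform_pos xs t, of m "avoids m"] cost
    unfolding chance_uniform_avoids by simp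
qed

lemma range_tail_split:
  "chance D elephant (k + T) (\<lambda>ys. real (card (sites ys)) \<le> c) []
     \<le> expect D elephant k (chance D elephant T (\<lambda>ys. real (card (sites (take T ys))) \<le> c)) []"
  unfolding expect_add_steps
proof (intro E.expect_mono)
  fix xs ys :: "'b list" assume len: "length xs = k" "length ys = T"
  have "card (sites (take T (ys @ xs @ []))) \<le> card (sites (ys @ xs @ []))"
    using card_sites_append[of ys "xs @ []"] len by simp
  thus "of_bool (real (card (sites (ys @ xs @ []))) \<le> c)
      \<le> (of_bool (real (card (sites (take T (ys @ xs @ [])))) \<le> c) :: real)"
    by auto
qed auto

text \<open>The comparison is made after the path \<open>xs\<close>, so that the predicted steps become a
  step law that depends on time only and starts from the empty path.\<close>

lemma predicted_comparison:
  assumes xs: "xs \<in> lists D" "xs \<noteq> []" and \<eta>: "\<eta> \<le> u / 2"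
    and near: "\<And>e. e \<in> D \<Longrightarrow> \<bar>excess xs e\<bar> \<le> \<eta> * real (length xs)"
    and T: "real T \<le> \<beta> * real (length xs)" and t: "0 < t"
  shows "step_kernel D (\<lambda>ys. predicted xs (ys @ xs))"
    and "chance D elephant T (\<lambda>ys. B (take T ys)) xs
      \<le> (exp t - 1) / t * chance D (\<lambda>ys. predicted xs (ys @ xs)) T B []
        + 2 * (real (card D))\<^sup>2 * \<beta>\<^sup>2 * exp (2 * \<beta>) / t"
proof -
  have pos: "0 < predicted xs (ys @ xs) e" if "e \<in> D" for ys e
    using predicted_ge[OF xs \<eta> near, of "ys @ xs" e] that u_pos by simp
  show Q: "step_kernel D (\<lambda>ys. predicted xs (ys @ xs))"
    by unfold_locales
      (use finite_D pos sum_predicted[OF xs \<eta> near] in \<open>auto intro: less_imp_le\<close>)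
  have cost: "divergence_cost D (\<lambda>ys. elephant (ys @ xs)) (\<lambda>ys. predicted xs (ys @ xs)) T []
      = divergence_cost D elephant (predicted xs) T xs"
    unfolding divergence_cost_def
    using expect_append[of D elephant _ "\<lambda>ys. chi_square D (elephant ys) (predicted xs ys)" "[]" xs] by simp
  have "chance D elephant T (\<lambda>ys. B (take T ys)) xs
      = expect D (\<lambda>zs. elephant (zs @ xs)) T (\<lambda>zs. of_bool (B (take T (zs @ xs)))) []"
    using expect_append[of D elephant T "\<lambda>ys. of_bool (B (take T ys))" "[]" xs] by simp
  also have "\<dots> = chance D (\<lambda>zs. elephant (zs @ xs)) T B []"
    by (rule expect_cong) simp
  also have "\<dots> \<le> (exp t - 1) / t * chance D (\<lambda>ys. predicted xs (ys @ xs)) T B []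
      + divergence_cost D (\<lambda>ys. elephant (ys @ xs)) (\<lambda>ys. predicted xs (ys @ xs)) T [] / t"
    by (rule chance_change_of_measure[OF E.shifted[OF xs(1)] Q]) (use pos t in auto)
  also have "\<dots> \<le> (exp t - 1) / t * chance D (\<lambda>ys. predicted xs (ys @ xs)) T B []
        + 2 * (real (card D))\<^sup>2 * \<beta>\<^sup>2 * exp (2 * \<beta>) / t"
    unfolding cost using t
    by (intro add_left_mono divide_right_mono divergence_prediction_le[OF xs \<eta> near T]) auto
  finally show "chance D elephant T (\<lambda>ys. B (take T ys)) xs
      \<le> (exp t - 1) / t * chance D (\<lambda>ys. predicted xs (ys @ xs)) T B []
        + 2 * (real (card D))\<^sup>2 * \<beta>\<^sup>2 * exp (2 * \<beta>) / t" .
qed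

text \<open>Chebyshev's inequality: the second moment of the excess is
  \<open>O(k powr (1 + \<theta>))\<close> with \<open>\<theta> < 1\<close>.\<close>

lemma excess_law_of_large_numbers:
  assumes "0 < \<eta>" "0 < \<tau>"
  shows "\<forall>\<^sub>F k in sequentially.
    chance D elephant k (\<lambda>xs. \<not> (\<forall>e\<in>D. \<bar>excess xs e\<bar> \<le> \<eta> * real k)) [] \<le> \<tau>"
proof -
  define \<theta> where "\<theta> = max 0 a"
  have \<theta>: "0 \<le> \<theta>" "2 * a < 1 + \<theta>" "\<theta> < 1" using a_less by (auto simp: \<theta>_def)
  define C where "C = 1 + 1 / (1 + \<theta> - 2 * a)"
  have le: "chance D elephant k (\<lambda>xs. \<not> (\<forall>e\<in>D. \<bar>excess xs e\<bar> \<le> \<eta> * real k)) []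
      \<le> real (card D) * C / \<eta>\<^sup>2 * real k powr (\<theta> - 1)" if k: "1 \<le> k" for k
  proof -
    have "chance D elephant k (\<lambda>xs. \<not> (\<forall>e\<in>D. \<bar>excess xs e\<bar> \<le> \<eta> * real k)) []
        \<le> expect D elephant k (\<lambda>xs. \<Sum>e\<in>D. (excess xs e)\<^sup>2) [] / (\<eta> * real k)\<^sup>2"
    proof (rule E.markov_inequality)
      fix zs assume "\<not> (\<forall>e\<in>D. \<bar>excess (zs @ []) e\<bar> \<le> \<eta> * real k)"
      then obtain e where e: "e \<in> D" "\<eta> * real k \<le> \<bar>excess zs e\<bar>" by auto
      hence "(\<eta> * real k)\<^sup>2 \<le> \<bar>excess zs e\<bar>\<^sup>2" using assms by (intro power_mono) auto
      also have "\<dots> \<le> (\<Sum>e\<in>D. (excess zs e)\<^sup>2)"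
        unfolding power2_abs using e finite_D by (intro member_le_sum) auto
      finally show "(\<eta> * real k)\<^sup>2 \<le> (\<Sum>e\<in>D. (excess (zs @ []) e)\<^sup>2)" by simp
    qed (use assms k in \<open>auto intro!: sum_nonneg\<close>)
    also have "\<dots> \<le> (\<Sum>e\<in>D. C * real k powr (1 + \<theta>)) / (\<eta> * real k)\<^sup>2"
      unfolding expect_sum C_def
      by (intro divide_right_mono sum_mono excess_second_moment \<theta>) auto
    also have "\<dots> = real (card D) * C / \<eta>\<^sup>2 * (real k powr (1 + \<theta>) / real k powr 2)"
      using k by (simp add: power_mult_distrib powr_numeral)
    also have "real k powr (1 + \<theta>) / real k powr 2 = real k powr (\<theta> - 1)"
      unfolding powr_diff[symmetric] by (rule arg_cong[of _ _ "(powr) _"]) simp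
    finally show ?thesis .
  qed
  have "(\<lambda>k. real k powr (\<theta> - 1)) \<longlonglongrightarrow> 0"
    using \<theta> by (intro tendsto_neg_powr filterlim_real_sequentially) auto
  hence "(\<lambda>k. real (card D) * C / \<eta>\<^sup>2 * real k powr (\<theta> - 1)) \<longlonglongrightarrow> 0"
    by (rule tendsto_mult_right_zero)
  from order_tendstoD(2)[OF this assms(2)] eventually_ge_at_top[of 1]
  show ?thesis by eventually_elim (use le in force)
qed

end

section \<open>The range in at least three dimensions\<close>

context lattice_walk
begin

definition escape :: real where "escape = 1 / suminf srw_return"

definition heat_bound :: "nat \<Rightarrow> real" where
  "heat_bound i = 3 * (1 / u + 2 / u\<^sup>2) * (1 / sqrt (real (Suc i))) ^ 3"

lemma heat_bound_nonneg: "0 \<le> heat_bound i"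
  using u_pos by (simp add: heat_bound_def)

lemma summable_heat_bound: "summable heat_bound"
  unfolding heat_bound_def[abs_def] by (rule summable_heat_kernel)

lemma return_chance_le:
  fixes q :: "nat \<Rightarrow> int ^ 'd \<Rightarrow> real"
  assumes "3 \<le> CARD('d)" "step_kernel directions (\<lambda>ys. q (length ys))"
    and "\<And>t e. e \<in> directions \<Longrightarrow> u / 2 \<le> q t e"
    and "zs \<in> lists directions"
  shows "chance directions (\<lambda>ys. q (length ys)) n (\<lambda>ys. sum_list (take n ys) = 0) zs \<le> heat_bound n"
  unfolding heat_bound_def
proof (rule heat_kernel_bound[where ?t0.0 = 0])
  fix t
  have "replicate t (axis undefined 1 :: int ^ 'd) \<in> lists directions" by auto
  from step_kernel.total[OF assms(2) this] show "(\<Sum>e\<in>directions. q t e) = 1" by simp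
qed (use assms u_pos u_le_1 in auto)

lemma summable_srw_return: 
  assumes "3 \<le> CARD('d)"
  shows "summable srw_return"
proof (rule summable_comparison_test'[OF summable_heat_bound])
  fix n :: nat
  have "srw_return n = chance (directions :: (int ^ 'd) set) (\<lambda>ys. (\<lambda>_ _. u) (length ys)) n (\<lambda>ys. sum_list (take n ys) = 0) []"
    unfolding srw_return_def uniform_def[abs_def] by (rule expect_cong) simp
  also have "\<dots> \<le> heat_bound n"
    by (rule return_chance_le) (use assms uniform_kernel u_pos in \<open>auto simp: uniform_def[abs_def]\<close>)
  finally show "norm (srw_return n) \<le> heat_bound n" using srw_return_nonneg by simp
qed

lemma
  assumes "3 \<le> CARD('d)"
  shows escape_limit: "srw_avoid \<longlonglongrightarrow> escape"
    and escape_pos: "0 < escape"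
    and escape_le: "escape \<le> srw_avoid m"
proof -
  show *: "srw_avoid \<longlonglongrightarrow> escape"
    unfolding escape_def by (rule srw_avoid_limit[OF summable_srw_return[OF assms]])
  have "srw_return 0 \<le> suminf srw_return"
    using sum_le_suminf[OF summable_srw_return[OF assms], of "{0}"] srw_return_nonneg by simp
  thus "0 < escape" by (simp add: escape_def srw_return_0)
  show "escape \<le> srw_avoid m" by (rule decseq_ge[OF srw_avoid_decreasing *])
qed

lemma escape_rate_eq:
  assumes "3 \<le> CARD('d)"
  shows "escape_rate TYPE('d) = escape"
proof -
  have "green (0 :: int ^ 'd) = ennreal (suminf srw_return)"
    unfolding green_eq using srw_return_nonneg summable_srw_return[OF assms]
    by (intro suminf_ennreal2) auto
  moreover have "0 < suminf srw_return" using escape_pos[OF assms] by (simp add: escape_def)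
  ultimately show ?thesis
    by (simp add: escape_rate_def escape_def divide_ennreal flip: ennreal_1)
qed

text \<open>For independent nearly uniform steps, the avoidance probabilities over all times
  \<open>m \<ge> A\<close> lie close to the escape probability: over \<open>A\<close> steps by comparison
  with simple random walk, and returns after more than \<open>A\<close> steps are unlikely by the heat
  kernel bound, uniformly in the step laws. The second moment bound applies.\<close>

lemma near_uniform_range:
  assumes d: "3 \<le> CARD('d)" and s: "0 < s" "s \<le> 1" and \<tau>: "0 < \<tau>"
  obtains \<eta> T0 where "0 < \<eta>" "\<eta> \<le> u / 2"
    "\<And>(q :: nat \<Rightarrow> int ^ 'd \<Rightarrow> real) T. T0 \<le> T \<Longrightarrow> step_kernel directions (\<lambda>ys. q (length ys)) \<Longrightarrow>
       (\<And>t e. e \<in> directions \<Longrightarrow> \<bar>q t e - u\<bar> \<le> \<eta>) \<Longrightarrow>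
       chance directions (\<lambda>ys. q (length ys)) T
         (\<lambda>ys. real (card (sites ys)) \<le> (1 - s) * escape * real T) [] \<le> \<tau>"
proof -
  \<comment> \<open>\<open>\<kappa>\<close> is the accuracy of the avoidance probabilities; each of its four quarters absorbs one error below\<close>
  define \<kappa> where "\<kappa> = escape * \<tau> * s\<^sup>2 / 8"
  have esc: "0 < escape" by (rule escape_pos[OF d])
  have \<kappa>: "0 < \<kappa>" using esc \<tau> s by (simp add: \<kappa>_def)
  define t where "t = min 1 (\<kappa> / 4)"
  have t: "0 < t" "t \<le> 1" "t \<le> \<kappa> / 4" using \<kappa> by (auto simp: t_def)
  obtain N where N: "\<And>n. N \<le> n \<Longrightarrow> norm (\<Sum>i. heat_bound (i + n)) < \<kappa> / 4"
    using suminf_exist_split[OF _ summable_heat_bound, of "\<kappa> / 4"] \<kappa> by auto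
  have "\<forall>\<^sub>F A in sequentially. srw_avoid A < escape + \<kappa> / 4"
    using \<kappa> by (intro order_tendstoD(2)[OF escape_limit[OF d]]) simp
  then obtain N' where N': "\<And>n. N' \<le> n \<Longrightarrow> srw_avoid n < escape + \<kappa> / 4"
    by (auto simp: eventually_sequentially)
  define A where "A = N + N' + 1"
  have A: "1 \<le> A" "srw_avoid A < escape + \<kappa> / 4" using N'[of A] by (auto simp: A_def)
  have tail: "(\<Sum>i\<in>{A<..k}. heat_bound i) \<le> \<kappa> / 4" for k
  proof -
    have sm: "summable (\<lambda>i. heat_bound (i + A))"
      using summable_heat_bound by (simp add: summable_iff_shift)
    have "(\<Sum>i\<in>{A<..k}. heat_bound i) \<le> (\<Sum>i\<in>(\<lambda>i. i + A) ` {..k}. heat_bound i)"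
    proof (rule sum_mono2)
      show "{A<..k} \<subseteq> (\<lambda>i. i + A) ` {..k}"
      proof
        fix i assume "i \<in> {A<..k}"
        hence "i = (i - A) + A" "i - A \<in> {..k}" by auto
        thus "i \<in> (\<lambda>i. i + A) ` {..k}" by blast
      qed
    qed (auto simp: heat_bound_nonneg)
    also have "\<dots> = (\<Sum>i\<le>k. heat_bound (i + A))" by (subst sum.reindex) (auto simp: inj_on_def)
    also have "\<dots> \<le> (\<Sum>i. heat_bound (i + A))"
      by (rule sum_le_suminf[OF sm]) (auto simp: heat_bound_nonneg)
    also have "\<dots> \<le> \<kappa> / 4" using N[of A] by (auto simp: A_def)
    finally show ?thesis .
  qed
  define c where "c = (real (card (directions :: (int ^ 'd) set)))\<^sup>2"
  have c: "0 < c" by (simp add: c_def card_directions)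
  define \<eta> where "\<eta> = min (u / 2) (sqrt (\<kappa> * t / (4 * real A * c)))"
  have \<eta>: "0 < \<eta>" "\<eta> \<le> u / 2" using u_pos \<kappa> t A c by (auto simp: \<eta>_def)
  have cost: "real m * (c * \<eta>\<^sup>2) / t \<le> \<kappa> / 4" if "m \<le> A" for m
  proof -
    have "\<eta>\<^sup>2 \<le> (sqrt (\<kappa> * t / (4 * real A * c)))\<^sup>2" using \<eta> by (intro power_mono) (auto simp: \<eta>_def)
    also have "\<dots> = \<kappa> * t / (4 * real A * c)" using \<kappa> t c by simp
    finally have "real m * (c * \<eta>\<^sup>2) \<le> real A * (c * (\<kappa> * t / (4 * real A * c)))"
      using that c by (intro mult_mono mult_left_mono) auto
    also have "\<dots> = \<kappa> / 4 * t" using A c by simp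
    finally show ?thesis using t by (simp add: divide_le_eq)
  qed
  \<comment> \<open>from here on the term with \<open>A\<close> in \<open>range_lower_tail\<close> is at most \<open>\<tau> / 2\<close>\<close>
  define T0 where "T0 = nat \<lceil>10 * real A / (escape\<^sup>2 * s\<^sup>2 * \<tau>)\<rceil> + 1"
  show thesis
  proof (rule that[OF \<eta>])
    fix q :: "nat \<Rightarrow> int ^ 'd \<Rightarrow> real" and T :: nat
    assume T: "T0 \<le> T" and Q: "step_kernel directions (\<lambda>ys. q (length ys))"
      and near: "\<And>t e. e \<in> directions \<Longrightarrow> \<bar>q t e - u\<bar> \<le> \<eta>"
    let ?Q = "\<lambda>ys. q (length ys)"
    interpret Q: step_kernel directions ?Q by (rule Q)
    have ge: "u / 2 \<le> q t e" if "e \<in> directions" for t e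
      using near[OF that, of t] \<eta> by (simp add: abs_le_iff)
    have T1: "1 \<le> T" using T by (simp add: T0_def)
    note av = near_uniform_avoid[OF Q _ t(1,2), of _ \<eta> _ "\<kappa> / 4", folded c_def]
    define \<rho> where "\<rho> = escape + \<kappa>"
    have tail_bound: "chance directions ?Q T (\<lambda>ys. real (card (sites ys)) \<le> (1 - s) * \<rho> * real T) []
        \<le> (2 * (1 - (escape - \<kappa>) / \<rho>) + 5 * real A / (\<rho>\<^sup>2 * real T)) / s\<^sup>2"
    proof (rule range_lower_tail[OF Q])
      fix xs m assume xs: "xs \<in> lists (directions :: (int ^ 'd) set)" and m: "A \<le> m"
      have "chance directions ?Q m (avoids m) xs \<le> chance directions ?Q (m - A + A) (avoids A) xs"
        using m by (auto intro!: Q.expect_mono xs elim!: avoids_mono)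
      also have "\<dots> \<le> \<rho>"
        unfolding expect_add_steps
      proof (rule Q.expect_upper[OF xs])
        fix zs assume "zs \<in> lists (directions :: (int ^ 'd) set)"
        hence "zs @ xs \<in> lists directions" using xs by simp
        from av(1)[OF this _ cost, of A] near
        have "chance directions ?Q A (avoids A) (zs @ xs) \<le> srw_avoid A + t + \<kappa> / 4" by simp
        thus "chance directions ?Q A (avoids A) (zs @ xs) \<le> \<rho>"
          using A t \<kappa> by (simp add: \<rho>_def)
      qed
      finally show "chance directions ?Q m (avoids m) xs \<le> \<rho>" .
    next
      fix k assume k: "1 \<le> k" "k \<le> T"
      define m where "m = min A k"
      have m: "m \<le> A" "m \<le> k" by (auto simp: m_def)
      have "srw_avoid A - t - \<kappa> / 4 \<le> srw_avoid m - t - \<kappa> / 4"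
        using decseqD[OF srw_avoid_decreasing m(1)] by simp
      also have "\<dots> \<le> chance directions ?Q (k - m + m) (avoids m) []"
        unfolding expect_add_steps
      proof (rule Q.expect_lower)
        fix zs assume "zs \<in> lists (directions :: (int ^ 'd) set)"
        hence "zs @ [] \<in> lists directions" by simp
        from av(2)[OF this _ cost[OF m(1)]] near
        show "srw_avoid m - t - \<kappa> / 4 \<le> chance directions ?Q m (avoids m) (zs @ [])" by simp
      qed simp
      also have "k - m + m = k" using m by simp
      also have "chance directions ?Q k (avoids m) []
          \<le> expect directions ?Q k (\<lambda>ys. of_bool (avoids k ys) + (\<Sum>i\<in>{A<..k}. of_bool (sum_list (take i ys) = 0))) []"
      proof (rule Q.expect_mono)
        fix zs :: "(int ^ 'd) list"
        have nn: "0 \<le> (\<Sum>i\<in>{A<..k}. of_bool (sum_list (take i (zs @ [])) = 0) :: real)"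
          by (intro sum_nonneg) auto
        show "of_bool (avoids m (zs @ []))
            \<le> of_bool (avoids k (zs @ [])) + (\<Sum>i\<in>{A<..k}. of_bool (sum_list (take i (zs @ [])) = 0) :: real)"
        proof (cases "avoids m (zs @ []) \<and> \<not> avoids k (zs @ [])")
          case True
          then obtain i where i: "1 \<le> i" "i \<le> k" "sum_list (take i (zs @ [])) = 0" "\<not> i \<le> m"
            by (auto simp: avoids_def)
          hence "i \<in> {A<..k}" by (auto simp: m_def)
          hence "of_bool (sum_list (take i (zs @ [])) = 0)
              \<le> (\<Sum>i\<in>{A<..k}. of_bool (sum_list (take i (zs @ [])) = 0) :: real)"
            by (intro member_le_sum) auto
          thus ?thesis using i True by simp
        qed (use nn in auto)
      qed simp
      also have "\<dots> = chance directions ?Q k (avoids k) []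
          + (\<Sum>i\<in>{A<..k}. chance directions ?Q k (\<lambda>ys. sum_list (take i ys) = 0) [])"
        unfolding expect_plus expect_sum ..
      also have "(\<Sum>i\<in>{A<..k}. chance directions ?Q k (\<lambda>ys. sum_list (take i ys) = 0) [])
          \<le> (\<Sum>i\<in>{A<..k}. heat_bound i)"
      proof (rule sum_mono)
        fix i assume "i \<in> {A<..k}"
        hence ki: "k - i + i = k" by simp
        have "chance directions ?Q (k - i + i) (\<lambda>ys. sum_list (take i ys) = 0) [] \<le> heat_bound i"
          unfolding expect_add_steps
          by (rule Q.expect_upper) (use return_chance_le[OF d Q ge] in auto)
        thus "chance directions ?Q k (\<lambda>ys. sum_list (take i ys) = 0) [] \<le> heat_bound i"
          unfolding ki .
      qed
      also have "\<dots> \<le> \<kappa> / 4" by (rule tail)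
      finally show "escape - \<kappa> \<le> chance directions ?Q k (avoids k) []"
        using escape_le[OF d, of A] t by simp
    qed (use esc \<kappa> s A T1 in \<open>auto simp: \<rho>_def\<close>)
    have \<rho>: "escape \<le> \<rho>" using \<kappa> by (simp add: \<rho>_def)
    have "1 - (escape - \<kappa>) / \<rho> = 2 * \<kappa> / \<rho>" using esc \<kappa> by (simp add: \<rho>_def field_simps)
    also have "\<dots> \<le> 2 * \<kappa> / escape" using esc \<kappa> \<rho> by (intro divide_left_mono) auto
    also have "\<dots> = \<tau> * s\<^sup>2 / 4" using esc by (simp add: \<kappa>_def)
    finally have "2 * (1 - (escape - \<kappa>) / \<rho>) \<le> 2 * (\<tau> * s\<^sup>2 / 4)"
      by (rule mult_left_mono) simp
    also have "\<dots> = \<tau> * s\<^sup>2 / 2" by simp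
    finally have b1: "2 * (1 - (escape - \<kappa>) / \<rho>) \<le> \<tau> * s\<^sup>2 / 2" .
    have "5 * real A / (\<rho>\<^sup>2 * real T) \<le> 5 * real A / (escape\<^sup>2 * real T)"
      using esc \<rho> T1 by (intro divide_left_mono mult_right_mono power_mono mult_pos_pos) auto
    also have "\<dots> \<le> \<tau> * s\<^sup>2 / 2"
    proof -
      have "10 * real A / (escape\<^sup>2 * s\<^sup>2 * \<tau>) \<le> real T"
        using T unfolding T0_def by linarith
      hence "10 * real A \<le> real T * (escape\<^sup>2 * s\<^sup>2 * \<tau>)"
        using esc s \<tau> by (simp add: divide_le_eq)
      thus ?thesis using esc T1 by (simp add: divide_le_eq algebra_simps)
    qed
    finally have b2: "5 * real A / (\<rho>\<^sup>2 * real T) \<le> \<tau> * s\<^sup>2 / 2" .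
    have "(1 - s) * escape * real T \<le> (1 - s) * \<rho> * real T"
      using \<rho> s by (intro mult_right_mono mult_left_mono) auto
    hence "chance directions ?Q T (\<lambda>ys. real (card (sites ys)) \<le> (1 - s) * escape * real T) []
        \<le> chance directions ?Q T (\<lambda>ys. real (card (sites ys)) \<le> (1 - s) * \<rho> * real T) []"
      by (intro Q.expect_mono) auto
    also have "\<dots> \<le> (\<tau> * s\<^sup>2 / 2 + \<tau> * s\<^sup>2 / 2) / s\<^sup>2"
      by (rule order.trans[OF tail_bound]) (intro divide_right_mono add_mono b1 b2 zero_le_power2)
    also have "\<dots> = \<tau>" using s by simp
    finally show "chance directions ?Q T (\<lambda>ys. real (card (sites ys)) \<le> (1 - s) * escape * real T) [] \<le> \<tau>" .
  qed
qed

end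


text \<open>The cost of the comparison is governed by the ratio of the number of remaining steps to the length
  of the prefix, and the loss in the range by the discarded fraction of the steps.\<close>

lemma prefix_split:
  assumes N: "2 \<le> N" and n: "N \<le> n"
  defines "k \<equiv> n div N"
  shows "1 \<le> k" "k \<le> n" "k + (n - k) = n" "real n * (1 - 1 / real N) \<le> real (n - k)"
    "real (n - k) \<le> 2 * real N * real k" "2 * k \<le> n"
proof -
  show k1: "1 \<le> k" using N n by (simp add: k_def Suc_le_eq div_greater_zero_iff)
  show kn: "k \<le> n" by (simp add: k_def)
  thus "k + (n - k) = n" by simp
  have kN: "k * N \<le> n" by (simp add: k_def)
  have "k * 2 \<le> k * N" using N by (intro mult_left_mono) auto
  also note kN
  finally show "2 * k \<le> n" by (simp only: mult.commute)
  from kN have "real k * real N \<le> real n" by (metis of_nat_le_iff of_nat_mult)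
  hence "real k \<le> real n / real N" using N by (simp add: field_simps)
  thus "real n * (1 - 1 / real N) \<le> real (n - k)" using kn by (simp add: of_nat_diff algebra_simps)
  have "n < N * Suc k" unfolding k_def using N by (intro dividend_less_times_div[of N n, THEN less_le_trans]) auto
  also have "\<dots> \<le> N * (2 * k)" using k1 by (intro mult_left_mono) auto
  finally have "n - k \<le> 2 * N * k" by simp
  thus "real (n - k) \<le> 2 * real N * real k" by (metis of_nat_le_iff of_nat_mult of_nat_numeral)
qed

text \<open>Room below the constant \<open>c\<close> for two losses: a factor \<open>1 - s\<close> in the
  second moment bound, and the fraction \<open>1 / N\<close> of the steps that is discarded.\<close>

lemma prefix_loss:
  fixes c \<epsilon> :: real
  assumes c: "0 < c" and \<epsilon>: "0 < \<epsilon>"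
  obtains s N where "0 < s" "s \<le> 1" "2 \<le> N" "c - \<epsilon> \<le> (1 - s) * c * (1 - 1 / real N)"
proof -
  define s where "s = min 1 (\<epsilon> / (2 * c))"
  define N where "N = nat \<lceil>2 * c / \<epsilon>\<rceil> + 2"
  have s: "0 < s" "s \<le> 1" using c \<epsilon> by (auto simp: s_def)
  have "c * s \<le> c * (\<epsilon> / (2 * c))" using c by (intro mult_left_mono) (auto simp: s_def)
  hence cs: "c * s \<le> \<epsilon> / 2" using c by simp
  have "2 * c / \<epsilon> \<le> real N" unfolding N_def by linarith
  hence "2 * c \<le> real N * \<epsilon>" using \<epsilon> by (simp add: divide_le_eq)
  moreover have N: "0 < real N" by (simp add: N_def)
  ultimately have cN: "c * (1 / real N) \<le> \<epsilon> / 2" by (simp add: field_simps)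
  have "0 \<le> s * (c * (1 / real N))" using s c by simp
  moreover have "(1 - s) * c * (1 - 1 / real N) = c - c * s - c * (1 / real N) + s * (c * (1 / real N))"
    by (simp only: algebra_simps mult_1_right)
  ultimately have "c - \<epsilon> \<le> (1 - s) * c * (1 - 1 / real N)" using cs cN by linarith
  moreover have "2 \<le> N" by (simp add: N_def)
  ultimately show thesis using that s by blast
qed

context lattice_walk
begin

text \<open>After a prefix on which the frequencies have come close to uniform, the elephant random walk
  is compared with the independent predicted steps at bounded cost \<open>C\<close>. The parameter
  \<open>t\<close> is chosen first, to make \<open>C / t\<close> small; then the tolerance
  \<open>\<eta>\<close>, to make \<open>(exp t - 1) / t\<close> times the lower tail of the comparison walk
  small; and \<open>n\<close> last.\<close>

lemma transient_lower_tail: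
  assumes d: "3 \<le> CARD('d)" and \<epsilon>: "0 < \<epsilon>" and \<tau>: "0 < \<tau>"
  shows "\<forall>\<^sub>F n in sequentially.
    chance directions elephant n (\<lambda>ys. real (card (sites ys)) \<le> (escape - \<epsilon>) * real n) [] \<le> \<tau>"
proof -
  have esc: "0 < escape" by (rule escape_pos[OF d])
  obtain s N where s: "0 < s" "s \<le> 1" and N: "2 \<le> N"
    and ratio: "escape - \<epsilon> \<le> (1 - s) * escape * (1 - 1 / real N)"
    by (rule prefix_loss[OF esc \<epsilon>])
  define \<beta> where "\<beta> = 2 * real N"
  define C where "C = 2 * (real (card (directions :: (int ^ 'd) set)))\<^sup>2 * \<beta>\<^sup>2 * exp (2 * \<beta>)"
  have C: "0 < C" using N by (simp add: C_def card_directions \<beta>_def)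
  define t where "t = 3 * C / \<tau>"
  have t: "0 < t" "C / t = \<tau> / 3" using C \<tau> by (auto simp: t_def)
  define m where "m = (exp t - 1) / t"
  have m: "0 < m" using t by (simp add: m_def)
  have "0 < \<tau> / (3 * m)" using \<tau> m by simp
  then obtain \<eta> T0 where \<eta>: "0 < \<eta>" "\<eta> \<le> u / 2" and near_range:
    "\<And>(q :: nat \<Rightarrow> int ^ 'd \<Rightarrow> real) T. T0 \<le> T \<Longrightarrow> step_kernel directions (\<lambda>ys. q (length ys)) \<Longrightarrow>
       (\<And>t e. e \<in> directions \<Longrightarrow> \<bar>q t e - u\<bar> \<le> \<eta>) \<Longrightarrow>
       chance directions (\<lambda>ys. q (length ys)) T
         (\<lambda>ys. real (card (sites ys)) \<le> (1 - s) * escape * real T) [] \<le> \<tau> / (3 * m)"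
    by (rule near_uniform_range[OF d s]) blast
  obtain K0 where K0: "\<And>k. K0 \<le> k \<Longrightarrow>
      chance directions elephant k (\<lambda>xs. \<not> (\<forall>e\<in>directions. \<bar>excess xs e\<bar> \<le> \<eta> * real k)) [] \<le> \<tau> / 3"
    using excess_law_of_large_numbers[OF \<eta>(1), of "\<tau> / 3"] \<tau> by (auto simp: eventually_sequentially)
  show ?thesis
  proof (rule eventually_sequentiallyI[of "max (N * (K0 + 1)) (2 * T0)"])
    fix n assume n: "max (N * (K0 + 1)) (2 * T0) \<le> n"
    define k where "k = n div N"
    define T where "T = n - k"
    have "N * 1 \<le> N * (K0 + 1)" by (intro mult_left_mono) auto
    hence "N \<le> n" using n by simp
    note split = prefix_split[OF N this, folded k_def, folded T_def]
    have kK: "K0 \<le> k"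
    proof -
      have "N * (K0 + 1) div N \<le> n div N" using n by (intro div_le_mono) simp
      thus ?thesis using N by (simp add: k_def)
    qed
    have T: "T0 \<le> T"
    proof -
      have "2 * T0 \<le> n" using n by simp
      thus ?thesis unfolding T_def using split(6) by linarith
    qed
    define c where "c = (1 - s) * escape * real T"
    have "(escape - \<epsilon>) * real n \<le> (1 - s) * escape * (1 - 1 / real N) * real n"
      using ratio by (intro mult_right_mono) auto
    also have "\<dots> = (1 - s) * escape * (real n * (1 - 1 / real N))" by simp
    also have "\<dots> \<le> c" unfolding c_def using split(4) s esc by (intro mult_left_mono) auto
    finally have le_c: "(escape - \<epsilon>) * real n \<le> c" .
    define B where "B = (\<lambda>ys :: (int ^ 'd) list. real (card (sites ys)) \<le> c)"
    let ?bad = "\<lambda>xs :: (int ^ 'd) list. \<not> (\<forall>e\<in>directions. \<bar>excess xs e\<bar> \<le> \<eta> * real k)"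
    have "chance directions elephant n (\<lambda>ys. real (card (sites ys)) \<le> (escape - \<epsilon>) * real n) []
        \<le> chance directions elephant (k + T) B []"
      unfolding split(3) B_def using le_c by (intro E.expect_mono) auto
    also have "\<dots> \<le> expect directions elephant k (chance directions elephant T (\<lambda>ys. B (take T ys))) []"
      unfolding B_def by (rule range_tail_split)
    also have "\<dots> \<le> expect directions elephant k (\<lambda>xs. of_bool (?bad xs) + 2 * \<tau> / 3) []"
    proof (rule E.expect_mono)
      fix zs assume zs: "zs \<in> lists (directions :: (int ^ 'd) set)" "length zs = k"
      have "chance directions elephant T (\<lambda>ys. B (take T ys)) zs \<le> of_bool (?bad zs) + 2 * \<tau> / 3"
      proof (cases "?bad zs")
        case True
        thus ?thesis using E.chance_bounds(2)[OF zs(1), of T "\<lambda>ys. B (take T ys)"] \<tau> by simp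
      next
        case False
        hence near: "\<And>e. e \<in> directions \<Longrightarrow> \<bar>excess zs e\<bar> \<le> \<eta> * real (length zs)" using zs by auto
        have ne: "zs \<noteq> []" using zs split(1) by auto
        have T_le: "real T \<le> \<beta> * real (length zs)" using split(5) zs by (simp add: \<beta>_def)
        define q where "q = (\<lambda>i e. u + a * (excess zs e * growth k (i + k)) / real (i + k))"
        have q: "(\<lambda>ys. predicted zs (ys @ zs)) = (\<lambda>ys. q (length ys))"
          by (intro ext) (simp add: predicted_def q_def zs)
        note kernel_q = predicted_comparison(1)[OF zs(1) ne \<eta>(2) near T_le t(1), unfolded q]
        note comparison = predicted_comparison(2)[OF zs(1) ne \<eta>(2) near T_le t(1), of B, unfolded q, folded C_def m_def]
        have "\<bar>q i e - u\<bar> \<le> \<eta>" if e: "e \<in> directions" for i e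
        proof -
          have "q i e = predicted zs (replicate i 0 @ zs) e" by (simp add: predicted_def q_def zs)
          thus ?thesis using predicted_near[OF zs(1) ne \<eta>(2) near _ e, of "replicate i 0 @ zs"] by simp
        qed
        from near_range[OF T kernel_q this]
        have "m * chance directions (\<lambda>ys. q (length ys)) T B [] \<le> m * (\<tau> / (3 * m))"
          unfolding B_def c_def using m by (intro mult_left_mono) auto
        also have "\<dots> = \<tau> / 3" using m by simp
        finally have "chance directions elephant T (\<lambda>ys. B (take T ys)) zs \<le> \<tau> / 3 + \<tau> / 3"
          using comparison t(2) by linarith
        thus ?thesis using False by simp
      qed
      thus "chance directions elephant T (\<lambda>ys. B (take T ys)) (zs @ []) \<le> of_bool (?bad (zs @ [])) + 2 * \<tau> / 3"
        by simp
    qed simp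
    also have "\<dots> = chance directions elephant k ?bad [] + 2 * \<tau> / 3"
      unfolding expect_plus by (simp add: E.expect_const)
    also have "\<dots> \<le> \<tau>" using K0[OF kK] by simp
    finally show "chance directions elephant n (\<lambda>ys. real (card (sites ys)) \<le> (escape - \<epsilon>) * real n) [] \<le> \<tau>" .
  qed
qed

text \<open>A fixed \<open>L\<close> in \<open>expected_range_le\<close>, and \<open>m\<close> of order
  \<open>sqrt n\<close>, which is negligible against \<open>n\<close> but makes the cost over
  \<open>L\<close> steps vanish.\<close>

lemma transient_upper:
  assumes d: "3 \<le> CARD('d)" and \<epsilon>: "0 < \<epsilon>"
  shows "\<forall>\<^sub>F n in sequentially.
    expect directions elephant n (\<lambda>ys. real (card (sites ys)) / real n) [] \<le> escape + \<epsilon>"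
proof -
  define \<theta> where "\<theta> = max 0 a"
  have \<theta>: "0 \<le> \<theta>" "\<theta> \<le> 1" "2 * a < 1 + \<theta>" "\<theta> < 1" using a_less by (auto simp: \<theta>_def)
  define t where "t = min 1 (\<epsilon> / 4)"
  have t: "0 < t" "t \<le> 1" "t \<le> \<epsilon> / 4" using \<epsilon> by (auto simp: t_def)
  have "\<forall>\<^sub>F L in sequentially. srw_avoid L < escape + \<epsilon> / 4"
    using \<epsilon> by (intro order_tendstoD(2)[OF escape_limit[OF d]]) simp
  then obtain L where L: "srw_avoid L < escape + \<epsilon> / 4"
    by (auto simp: eventually_sequentially)
  define m where "m = (\<lambda>n :: nat. nat \<lceil>sqrt (real n)\<rceil>)"
  define R where "R = (\<lambda>n. (1 + real (m n)) / real n
    + ((1 + t) * srw_avoid L + cost_const \<theta> * real L * real (m n - L) powr (\<theta> - 1) / t))"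
  have m_top: "filterlim m at_top at_top" unfolding m_def by real_asymp
  have "filterlim (\<lambda>n. real (m n - L)) at_top at_top"
    by (intro filterlim_compose[OF filterlim_real_sequentially]
        filterlim_compose[OF filterlim_minus_const_nat_at_top m_top])
  hence "(\<lambda>n. real (m n - L) powr (\<theta> - 1)) \<longlonglongrightarrow> 0"
    using \<theta> by (intro tendsto_neg_powr) auto
  moreover have "(\<lambda>n. (1 + real (m n)) / real n) \<longlonglongrightarrow> 0" unfolding m_def by real_asymp
  ultimately have "R \<longlonglongrightarrow> 0 + ((1 + t) * srw_avoid L + cost_const \<theta> * real L * 0 / t)"
    unfolding R_def by (intro tendsto_intros) (use t in auto)
  moreover have "0 + ((1 + t) * srw_avoid L + cost_const \<theta> * real L * 0 / t) < escape + \<epsilon>"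
  proof -
    have "t * srw_avoid L \<le> t * 1" using t srw_avoid_bounds by (intro mult_left_mono) auto
    moreover have "0 + ((1 + t) * srw_avoid L + cost_const \<theta> * real L * 0 / t) = srw_avoid L + t * srw_avoid L"
      by (simp add: algebra_simps)
    ultimately show ?thesis using L t \<epsilon> by linarith
  qed
  ultimately have "\<forall>\<^sub>F n in sequentially. R n < escape + \<epsilon>" by (rule order_tendstoD)
  moreover have "\<forall>\<^sub>F n in sequentially. Suc L \<le> m n"
    using m_top by (auto simp: filterlim_at_top)
  ultimately show ?thesis using eventually_gt_at_top[of 0]
  proof eventually_elim
    case (elim n)
    have "expect directions elephant n (\<lambda>ys. real (card (sites ys)) / real n) []
        = 1 / real n * expect directions elephant n (\<lambda>ys. real (card (sites ys))) []"
      unfolding expect_cmult[symmetric] by simp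
    also have "\<dots> \<le> 1 / real n * (1 + real (m n)
        + real n * ((1 + t) * srw_avoid L + cost_const \<theta> * real L * real (m n - L) powr (\<theta> - 1) / t))"
      using elim t \<theta> by (intro mult_left_mono expected_range_le) auto
    also have "\<dots> = R n" unfolding R_def using elim by (simp add: distrib_left add_divide_distrib)
    finally show ?case using elim by simp
  qed
qed

section \<open>The range in the plane\<close>

lemma srw_return_planar:
  assumes "CARD('d) = 2"
  shows "srw_return n = (line_walk n 0)\<^sup>2"
proof -
  obtain i j :: 'd where ij: "UNIV = {i, j}" "i \<noteq> j" using assms by (auto simp: card_2_iff)
  have "uniform = (\<lambda>_ _. 1 / 4)" by (intro ext) (simp add: uniform_def u_eq assms)
  hence "srw_return n = chance directions (\<lambda>_ _. 1 / 4) n (\<lambda>ys. (0 :: int ^ 'd) + sum_list (take n ys) = 0) []"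
    unfolding srw_return_def by (auto intro: expect_cong)
  thus ?thesis unfolding planar_return[OF ij] by (simp add: power2_eq_square)
qed

lemma green_upto_planar:
  assumes "CARD('d) = 2"
  shows "green_upto n = (\<Sum>j\<le>n div 2. (central j)\<^sup>2)"
proof (induction n)
  case 0
  show ?case by (simp add: green_upto_def srw_return_0 central_def)
next
  case (Suc n)
  have "green_upto (Suc n) = green_upto n + (line_walk (Suc n) 0)\<^sup>2"
    by (simp add: green_upto_def srw_return_planar[OF assms] del: line_walk.simps)
  also have "\<dots> = (\<Sum>j\<le>Suc n div 2. (central j)\<^sup>2)"
  proof (cases "even n")
    case True
    hence "line_walk (Suc n) 0 = 0" by (intro line_walk_odd) auto
    thus ?thesis using Suc True by (simp del: line_walk.simps)
  next
    case False
    define j where "j = n div 2"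
    have n: "n = 2 * j + 1" using False by (simp add: j_def)
    have "Suc n = 2 * Suc j" by (simp add: n)
    hence "line_walk (Suc n) 0 = central (Suc j)" by (simp only: line_walk_central)
    thus ?thesis using Suc by (simp add: n del: line_walk.simps)
  qed
  finally show ?case .
qed

lemma green_upto_planar_bounds:
  assumes "CARD('d) = 2" "2 \<le> n"
  shows "ln (real n / 2) / pi \<le> green_upto n" "green_upto n \<le> 2 + ln (real n) / pi"
proof -
  define m where "m = n div 2"
  have m: "1 \<le> m" "m \<le> n" "n \<le> 2 * (m + 1)" using assms(2) by (auto simp: m_def)
  have G: "green_upto n = (\<Sum>j\<le>m. (central j)\<^sup>2)" unfolding green_upto_planar[OF assms(1)] m_def ..
  have "ln (real n / 2) \<le> ln (real (Suc m) + 1)"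
  proof -
    have "real n \<le> real (2 * (m + 1))" using m(3) by (simp only: of_nat_le_iff)
    thus ?thesis using assms(2) by (intro ln_mono) auto
  qed
  also have "\<dots> \<le> harm (Suc m)" by (rule ln_le_harm)
  also have "\<dots> = (\<Sum>j\<le>m. 1 / real (Suc j))"
    unfolding harm_def by (rule sum.reindex_bij_witness[of _ Suc "\<lambda>k. k - 1"]) (auto simp: inverse_eq_divide)
  finally have "ln (real n / 2) / pi \<le> (\<Sum>j\<le>m. 1 / real (Suc j)) / pi"
    by (rule divide_right_mono) simp
  also have "\<dots> \<le> green_upto n"
    unfolding G sum_divide_distrib
  proof (rule sum_mono)
    fix j
    have "1 / real (Suc j) / pi = (2 / pi) / (2 * real (Suc j))" by (simp del: of_nat_Suc)
    also have "\<dots> \<le> (2 / pi) / (2 * real j + 1)" by (intro divide_left_mono) auto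
    also have "\<dots> \<le> (central j)\<^sup>2" using central_sq_ge[of j] by (simp add: divide_le_eq mult_ac)
    finally show "1 / real (Suc j) / pi \<le> (central j)\<^sup>2" .
  qed
  finally show "ln (real n / 2) / pi \<le> green_upto n" .
  have "green_upto n = 1 + (\<Sum>j=1..m. (central j)\<^sup>2)"
    unfolding G atMost_atLeast0 by (subst sum.atLeast_Suc_atMost) (auto simp: central_def)
  also have "(\<Sum>j=1..m. (central j)\<^sup>2) \<le> (\<Sum>j=1..m. inverse (real j) / pi)"
  proof (rule sum_mono)
    fix j assume "j \<in> {1..m}"
    hence "(central j)\<^sup>2 \<le> 1 / pi / real j" using central_sq_le[of j] by (simp add: field_simps)
    thus "(central j)\<^sup>2 \<le> inverse (real j) / pi" by (simp add: field_simps)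
  qed
  also have "\<dots> = harm m / pi" by (simp add: harm_def sum_divide_distrib)
  also have "\<dots> \<le> (1 + ln (real n)) / pi"
  proof (rule divide_right_mono)
    have "harm m - ln (real m) \<le> (harm 1 - ln (real 1) :: real)"
      using euler_mascheroni_sequence_decreasing[of 1 m] m by simp
    moreover have "ln (real m) \<le> ln (real n)" using m by (intro ln_mono) auto
    ultimately show "harm m \<le> 1 + ln (real n)" by (simp add: harm_def)
  qed simp
  also have "(1 + ln (real n)) / pi \<le> 1 + ln (real n) / pi"
    using pi_ge_two by (simp add: add_divide_distrib)
  finally show "green_upto n \<le> 2 + ln (real n) / pi" by simp
qed

lemma srw_avoid_planar:
  assumes d: "CARD('d) = 2"
  shows "(\<lambda>n. srw_avoid n * ln (real n)) \<longlonglongrightarrow> pi"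
proof (rule srw_avoid_log_limit)
  show "(\<lambda>n. green_upto n / ln (real n)) \<longlonglongrightarrow> 1 / pi"
  proof (rule real_tendsto_sandwich)
    have ev: "\<forall>\<^sub>F n in sequentially. (2::nat) \<le> n" by (rule eventually_ge_at_top)
    show "\<forall>\<^sub>F n in sequentially. (ln (real n / 2) / pi) / ln (real n) \<le> green_upto n / ln (real n)"
      using ev by eventually_elim (intro divide_right_mono green_upto_planar_bounds d, auto)
    show "\<forall>\<^sub>F n in sequentially. green_upto n / ln (real n) \<le> (2 + ln (real n) / pi) / ln (real n)"
      using ev by eventually_elim (intro divide_right_mono green_upto_planar_bounds d, auto)
    have "(\<lambda>n. (ln (real n / 2) / pi) / ln (real n)) \<longlonglongrightarrow> inverse pi" by real_asymp
    thus "(\<lambda>n. (ln (real n / 2) / pi) / ln (real n)) \<longlonglongrightarrow> 1 / pi"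
      by (simp only: inverse_eq_divide)
    have "(\<lambda>n. (2 + ln (real n) / pi) / ln (real n)) \<longlonglongrightarrow> inverse pi" by real_asymp
    thus "(\<lambda>n. (2 + ln (real n) / pi) / ln (real n)) \<longlonglongrightarrow> 1 / pi"
      by (simp only: inverse_eq_divide)
  qed
next
  fix k :: nat assume k: "1 \<le> k"
  show "srw_return k \<le> 1 / real k"
  proof (cases "even k")
    case True
    then obtain j where j: "k = 2 * j" by (auto elim: evenE)
    have "(central j)\<^sup>2 * real k \<le> (central j)\<^sup>2 * (2 * real j + 1)"
      by (intro mult_left_mono) (auto simp: j)
    also have "\<dots> \<le> 1" by (rule central_sq_le_1)
    finally show ?thesis using k unfolding srw_return_planar[OF d] j line_walk_central by (simp add: field_simps)
  next
    case False
    thus ?thesis using line_walk_odd[of 0 k] by (simp add: srw_return_planar[OF d])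
  qed
qed simp

text \<open>The avoidance probability is nearly constant in the logarithmic scale: from
  \<open>A = T / ln T ^ 3\<close> to \<open>T\<close> it is \<open>(1 + o(1)) * pi / ln T\<close>, while
  \<open>A\<close> is \<open>o(\<rho>\<^sup>2 * T)\<close>, as the second moment bound requires.\<close>

lemma planar_uniform_range:
  assumes d: "CARD('d) = 2" and s: "0 < s" "s \<le> 1" and \<tau>: "0 < \<tau>"
  shows "\<forall>\<^sub>F T in sequentially. chance directions uniform T
    (\<lambda>ys. real (card (sites ys)) \<le> (1 - s) * pi * (real T / ln (real T))) [] \<le> \<tau>"
proof -
  \<comment> \<open>with avoidance probabilities between \<open>(1 - \<kappa>) * pi / ln T\<close> and \<open>(1 + \<kappa>) * pi / ln T\<close>, the first term in \<open>range_lower_tail\<close> is at most \<open>\<tau> / 2\<close>\<close>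
  define \<kappa> where "\<kappa> = \<tau> * s\<^sup>2 / 8"
  have \<kappa>: "0 < \<kappa>" using \<tau> s by (simp add: \<kappa>_def)
  define A where "A = (\<lambda>T :: nat. nat \<lceil>real T / ln (real T) ^ 3\<rceil>)"
  have A_top: "filterlim A at_top at_top" unfolding A_def by real_asymp
  have "(\<lambda>T. srw_avoid (A T) * ln (real (A T))) \<longlonglongrightarrow> pi"
    by (rule filterlim_compose[OF srw_avoid_planar[OF d] A_top])
  moreover have "(\<lambda>T. ln (real T) / ln (real (A T))) \<longlonglongrightarrow> 1" unfolding A_def by real_asymp
  ultimately have "(\<lambda>T. srw_avoid (A T) * ln (real (A T)) * (ln (real T) / ln (real (A T)))) \<longlonglongrightarrow> pi * 1"
    by (rule tendsto_mult)
  hence "\<forall>\<^sub>F T in sequentially. srw_avoid (A T) * ln (real (A T)) * (ln (real T) / ln (real (A T))) < (1 + \<kappa>) * pi"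
    by (rule order_tendstoD(2)) (use \<kappa> in simp)
  moreover have "\<forall>\<^sub>F T in sequentially. (1 - \<kappa>) * pi < srw_avoid T * ln (real T)"
    by (rule order_tendstoD(1)[OF srw_avoid_planar[OF d]]) (use \<kappa> in \<open>simp add: algebra_simps\<close>)
  moreover have "(\<lambda>T. real (A T) * ln (real T) ^ 2 / real T) \<longlonglongrightarrow> 0" unfolding A_def by real_asymp
  hence "\<forall>\<^sub>F T in sequentially. real (A T) * ln (real T) ^ 2 / real T < \<tau> * s\<^sup>2 / 10"
    by (rule order_tendstoD(2)) (use \<tau> s in simp)
  moreover have "\<forall>\<^sub>F T in sequentially. 2 \<le> A T" using A_top by (auto simp: filterlim_at_top)
  ultimately show ?thesis using eventually_ge_at_top[of 3]
  proof eventually_elim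
    case (elim T)
    define l where "l = ln (real T)"
    have l: "0 < l" using elim by (simp add: l_def)
    have lA: "0 < ln (real (A T))" using elim by simp
    define \<rho> where "\<rho> = (1 + \<kappa>) * pi / l"
    have \<rho>: "0 < \<rho>" using l \<kappa> by (simp add: \<rho>_def)
    have "srw_avoid (A T) * l < (1 + \<kappa>) * pi" using elim lA by (simp add: l_def)
    hence rA: "srw_avoid (A T) \<le> \<rho>" using l by (simp add: \<rho>_def pos_le_divide_eq)
    have rT: "(1 - \<kappa>) * pi / l \<le> srw_avoid T" using elim l by (simp add: l_def pos_divide_le_eq)
    have "chance directions uniform T (\<lambda>ys. real (card (sites ys)) \<le> (1 - s) * \<rho> * real T) []
        \<le> (2 * (1 - (1 - \<kappa>) * pi / l / \<rho>) + 5 * real (A T) / (\<rho>\<^sup>2 * real T)) / s\<^sup>2"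
    proof (rule range_lower_tail[OF uniform_kernel \<rho> s(1)])
      fix xs :: "(int ^ 'd) list" and m assume "A T \<le> m"
      thus "chance directions uniform m (avoids m) xs \<le> \<rho>"
        unfolding chance_uniform_avoids using rA decseqD[OF srw_avoid_decreasing, of "A T" m] by simp
    next
      fix k assume "1 \<le> k" "k \<le> T"
      thus "(1 - \<kappa>) * pi / l \<le> chance directions uniform k (avoids k) []"
        unfolding chance_uniform_avoids using rT decseqD[OF srw_avoid_decreasing, of k T] by simp
    qed (use elim in auto)
    also have "\<dots> \<le> (\<tau> * s\<^sup>2 / 2 + \<tau> * s\<^sup>2 / 2) / s\<^sup>2"
    proof (intro divide_right_mono add_mono)
      have "(1 - \<kappa>) * pi / l / \<rho> = (1 - \<kappa>) / (1 + \<kappa>)" unfolding \<rho>_def using l by simp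
      hence "1 - (1 - \<kappa>) * pi / l / \<rho> = 2 * \<kappa> / (1 + \<kappa>)" using \<kappa> by (simp add: field_simps)
      also have "\<dots> \<le> 2 * \<kappa> / 1" using \<kappa> by (intro divide_left_mono) auto
      finally have "2 * (1 - (1 - \<kappa>) * pi / l / \<rho>) \<le> 2 * (2 * \<kappa> / 1)" by (rule mult_left_mono) simp
      thus "2 * (1 - (1 - \<kappa>) * pi / l / \<rho>) \<le> \<tau> * s\<^sup>2 / 2" by (simp add: \<kappa>_def)
      have "1 / l \<le> \<rho>"
      proof -
        have "1 * 1 \<le> (1 + \<kappa>) * pi" using \<kappa> pi_ge_two by (intro mult_mono) auto
        thus ?thesis unfolding \<rho>_def using l by (simp add: divide_right_mono)
      qed
      hence "(1 / l)\<^sup>2 \<le> \<rho>\<^sup>2" using l by (intro power_mono) auto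
      hence "5 * real (A T) / (\<rho>\<^sup>2 * real T) \<le> 5 * real (A T) / ((1 / l)\<^sup>2 * real T)"
        using l \<rho> elim by (intro divide_left_mono mult_right_mono mult_pos_pos) auto
      also have "\<dots> = 5 * (real (A T) * l ^ 2 / real T)" by (simp add: power_divide)
      also have "\<dots> \<le> 5 * (\<tau> * s\<^sup>2 / 10)"
        by (intro mult_left_mono less_imp_le elim(3)[folded l_def]) simp
      also have "\<dots> = \<tau> * s\<^sup>2 / 2" by simp
      finally show "5 * real (A T) / (\<rho>\<^sup>2 * real T) \<le> \<tau> * s\<^sup>2 / 2" .
    qed simp
    also have "\<dots> = \<tau>" using s by simp
    finally have "chance directions uniform T (\<lambda>ys. real (card (sites ys)) \<le> (1 - s) * \<rho> * real T) [] \<le> \<tau>" .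
    moreover have le: "(1 - s) * pi * (real T / ln (real T)) \<le> (1 - s) * \<rho> * real T"
    proof -
      have "(1 - s) * (pi * (real T / l)) \<le> (1 - s) * ((1 + \<kappa>) * (pi * (real T / l)))"
      proof (rule mult_left_mono)
        have "1 * (pi * (real T / l)) \<le> (1 + \<kappa>) * (pi * (real T / l))"
          using \<kappa> l by (intro mult_right_mono) auto
        thus "pi * (real T / l) \<le> (1 + \<kappa>) * (pi * (real T / l))" by simp
      qed (use s in simp)
      thus ?thesis by (simp add: \<rho>_def l_def mult.assoc)
    qed
    have "chance directions uniform T (\<lambda>ys. real (card (sites ys)) \<le> (1 - s) * pi * (real T / ln (real T))) []
        \<le> chance directions uniform T (\<lambda>ys. real (card (sites ys)) \<le> (1 - s) * \<rho> * real T) []"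
      using le by (intro U.expect_mono) (auto intro: order.trans)
    ultimately show ?case by linarith
  qed
qed

text \<open>In the diffusive case the mean cost of step \<open>k\<close> with respect to simple random
  walk is \<open>O(1 / k)\<close>, so that the cost of the last \<open>n - n div N\<close> steps stays
  bounded.\<close>

lemma planar_lower_tail:
  assumes d: "CARD('d) = 2" and a: "2 * a < 1" and \<epsilon>: "0 < \<epsilon>" and \<tau>: "0 < \<tau>"
  shows "\<forall>\<^sub>F n in sequentially. chance directions elephant n
    (\<lambda>ys. real (card (sites ys)) \<le> (pi - \<epsilon>) * (real n / ln (real n))) [] \<le> \<tau>"
proof -
  obtain s N where s: "0 < s" "s \<le> 1" and N: "2 \<le> N"
    and ratio: "pi - \<epsilon> \<le> (1 - s) * pi * (1 - 1 / real N)"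
    by (rule prefix_loss[OF pi_gt_zero \<epsilon>])
  define C where "C = cost_const 0 * (2 * real N)"
  have "0 < 1 + 1 / (1 + 0 - 2 * a)" using a by (intro add_pos_pos) auto
  hence cc: "0 < cost_const 0" unfolding cost_const_def card_directions by (intro mult_pos_pos) auto
  hence C: "0 < C" using N by (simp add: C_def)
  define t where "t = 2 * C / \<tau>"
  have t: "0 < t" "C / t = \<tau> / 2" using C \<tau> by (auto simp: t_def)
  define m where "m = (exp t - 1) / t"
  have m: "0 < m" using t by (simp add: m_def)
  have "0 < \<tau> / (2 * m)" using \<tau> m by simp
  from planar_uniform_range[OF d s this]
  obtain T0 where T0: "\<And>T. T0 \<le> T \<Longrightarrow> chance directions uniform T
    (\<lambda>ys. real (card (sites ys)) \<le> (1 - s) * pi * (real T / ln (real T))) [] \<le> \<tau> / (2 * m)"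
    by (auto simp: eventually_sequentially)
  show ?thesis
  proof (rule eventually_sequentiallyI[of "max (2 * N) (2 * T0 + 4)"])
    fix n assume n: "max (2 * N) (2 * T0 + 4) \<le> n"
    define k where "k = n div N"
    define T where "T = n - k"
    have "N \<le> n" using n by simp
    note split = prefix_split[OF N this, folded k_def, folded T_def]
    have "2 * T0 + 4 \<le> n" using n by simp
    hence T: "T0 \<le> T" "2 \<le> T" unfolding T_def using split(6) by linarith+
    have lnT: "0 < ln (real T)" "ln (real T) \<le> ln (real n)" using T by (auto simp: T_def intro!: ln_mono)
    define c where "c = (1 - s) * pi * (real T / ln (real T))"
    have "(pi - \<epsilon>) * (real n / ln (real n)) \<le> (1 - s) * pi * (1 - 1 / real N) * (real n / ln (real n))"
      using ratio lnT by (intro mult_right_mono) auto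
    also have "\<dots> = (1 - s) * pi * (real n * (1 - 1 / real N) / ln (real n))" by simp
    also have "\<dots> \<le> c" unfolding c_def using split(4) s lnT
      by (intro mult_left_mono frac_le) auto
    finally have le_c: "(pi - \<epsilon>) * (real n / ln (real n)) \<le> c" .
    define B where "B = (\<lambda>ys :: (int ^ 'd) list. real (card (sites ys)) \<le> c)"
    have "chance directions elephant n (\<lambda>ys. real (card (sites ys)) \<le> (pi - \<epsilon>) * (real n / ln (real n))) []
        \<le> chance directions elephant (k + T) B []"
      unfolding split(3) B_def using le_c by (intro E.expect_mono) auto
    also have "\<dots> \<le> expect directions elephant k (chance directions elephant T (\<lambda>ys. B (take T ys))) []"
      unfolding B_def by (rule range_tail_split)
    also have "\<dots> \<le> expect directions elephant k
        (\<lambda>xs. \<tau> / 2 + (1 / t) * divergence_cost directions elephant uniform T xs) []"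
    proof (rule E.expect_mono)
      fix zs assume zs: "zs \<in> lists (directions :: (int ^ 'd) set)"
      have "chance directions elephant T (\<lambda>ys. B (take T ys)) zs
          \<le> m * chance directions uniform T (\<lambda>ys. B (take T ys)) zs + divergence_cost directions elephant uniform T zs / t"
        unfolding m_def
        by (rule chance_change_of_measure[OF elephant_kernel uniform_kernel uniform_pos zs t(1)])
      also have "chance directions uniform T (\<lambda>ys. B (take T ys)) zs \<le> \<tau> / (2 * m)"
        unfolding chance_uniform_take[of T B] unfolding B_def c_def by (rule T0[OF T(1)])
      hence "m * chance directions uniform T (\<lambda>ys. B (take T ys)) zs \<le> m * (\<tau> / (2 * m))"
        using m by (intro mult_left_mono) auto
      hence "m * chance directions uniform T (\<lambda>ys. B (take T ys)) zs \<le> \<tau> / 2" using m by simp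
      finally show "chance directions elephant T (\<lambda>ys. B (take T ys)) (zs @ [])
          \<le> \<tau> / 2 + (1 / t) * divergence_cost directions elephant uniform T (zs @ [])" by simp
    qed simp
    also have "\<dots> = \<tau> / 2 + (1 / t) * expect directions elephant k (divergence_cost directions elephant uniform T) []"
      unfolding expect_plus expect_cmult by (simp add: E.expect_const)
    also have "\<dots> \<le> \<tau> / 2 + (1 / t) * C"
    proof (intro add_left_mono mult_left_mono)
      have "expect directions elephant k (divergence_cost directions elephant uniform T) []
          \<le> cost_const 0 * real T * real k powr (0 - 1)"
        by (rule expected_divergence_uniform) (use a split(1) in auto)
      also have "\<dots> = cost_const 0 * (real T / real k)"
        using split(1) by (simp add: powr_minus_divide)
      also have "\<dots> \<le> C" unfolding C_def using split(1,5) cc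
        by (intro mult_left_mono) (auto simp: divide_le_eq)
      finally show "expect directions elephant k (divergence_cost directions elephant uniform T) [] \<le> C" .
    qed (use t in auto)
    also have "\<dots> = \<tau> / 2 + C / t" by simp
    also have "\<dots> = \<tau>" unfolding t(2) by simp
    finally show "chance directions elephant n
      (\<lambda>ys. real (card (sites ys)) \<le> (pi - \<epsilon>) * (real n / ln (real n))) [] \<le> \<tau>" .
  qed
qed

text \<open>Here \<open>m = n / ln n ^ 2\<close> is negligible against \<open>n / ln n\<close>, and
  \<open>L = n / ln n ^ 4\<close> satisfies both \<open>ln L \<sim> ln n\<close> and
  \<open>L / m = o(1 / ln n)\<close>, which makes the cost negligible against the avoidance
  probability.\<close>

lemma planar_upper:
  assumes d: "CARD('d) = 2" and a: "2 * a < 1" and \<epsilon>: "0 < \<epsilon>"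
  shows "\<forall>\<^sub>F n in sequentially.
    expect directions elephant n (\<lambda>ys. ln (real n) / real n * real (card (sites ys))) [] \<le> pi + \<epsilon>"
proof -
  define t where "t = min 1 (\<epsilon> / (2 * pi))"
  have t: "0 < t" "t \<le> 1" "pi * t \<le> \<epsilon> / 2"
  proof -
    show "0 < t" "t \<le> 1" using \<epsilon> by (auto simp: t_def)
    have "pi * t \<le> pi * (\<epsilon> / (2 * pi))" by (intro mult_left_mono) (auto simp: t_def)
    thus "pi * t \<le> \<epsilon> / 2" by simp
  qed
  define m where "m = (\<lambda>n :: nat. nat \<lceil>real n / ln (real n) ^ 2\<rceil>)"
  define L where "L = (\<lambda>n :: nat. nat \<lceil>real n / ln (real n) ^ 4\<rceil>)"
  define R where "R = (\<lambda>n. (1 + real (m n)) * ln (real n) / real n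
    + ((1 + t) * (srw_avoid (L n) * ln (real (L n)) * (ln (real n) / ln (real (L n))))
       + cost_const 0 / t * (real (L n) * ln (real n) / (real (m n) - real (L n)))))"
  have "filterlim L at_top at_top" unfolding L_def by real_asymp
  hence "(\<lambda>n. srw_avoid (L n) * ln (real (L n))) \<longlonglongrightarrow> pi"
    by (rule filterlim_compose[OF srw_avoid_planar[OF d]])
  moreover have "(\<lambda>n. (1 + real (m n)) * ln (real n) / real n) \<longlonglongrightarrow> 0" unfolding m_def by real_asymp
  moreover have "(\<lambda>n. ln (real n) / ln (real (L n))) \<longlonglongrightarrow> 1" unfolding L_def by real_asymp
  moreover have "(\<lambda>n. real (L n) * ln (real n) / (real (m n) - real (L n))) \<longlonglongrightarrow> 0"
    unfolding L_def m_def by real_asymp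
  ultimately have "R \<longlonglongrightarrow> 0 + ((1 + t) * (pi * 1) + cost_const 0 / t * 0)"
    unfolding R_def by (intro tendsto_intros)
  moreover have "0 + ((1 + t) * (pi * 1) + cost_const 0 / t * 0) < pi + \<epsilon>"
    using t \<epsilon> by (simp add: algebra_simps)
  ultimately have "\<forall>\<^sub>F n in sequentially. R n < pi + \<epsilon>" by (rule order_tendstoD)
  moreover have "\<forall>\<^sub>F n in sequentially. real (L n) < real (m n)" unfolding L_def m_def by real_asymp
  moreover have "\<forall>\<^sub>F n in sequentially. real (L n) > 1" unfolding L_def by real_asymp
  ultimately show ?thesis using eventually_ge_at_top[of 2]
  proof eventually_elim
    case (elim n)
    have Lm: "L n < m n" using elim by simp
    have l: "0 < ln (real n)" "0 < ln (real (L n))" using elim by auto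
    have "expect directions elephant n (\<lambda>ys. ln (real n) / real n * real (card (sites ys))) []
        \<le> ln (real n) / real n * (1 + real (m n) + real n * ((1 + t) * srw_avoid (L n)
          + cost_const 0 * real (L n) * real (m n - L n) powr (0 - 1) / t))"
      unfolding expect_cmult using l t a Lm by (intro mult_left_mono expected_range_le) auto
    also have "real (m n - L n) powr (0 - 1) = 1 / (real (m n) - real (L n))"
      using Lm by (simp add: powr_minus_divide of_nat_diff)
    also have "ln (real n) / real n * (1 + real (m n) + real n * ((1 + t) * srw_avoid (L n)
          + cost_const 0 * real (L n) * (1 / (real (m n) - real (L n))) / t)) = R n"
    proof -
      have "x / y * (1 + z + y * (v * r + c * w * (1 / q) / t)) = (1 + z) * x / y + (v * (r * b * (x / b)) + c / t * (w * x / q))"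
        if "y \<noteq> 0" "b \<noteq> 0" for x y z v r c w q t b :: real
      proof -
        have "x / y * (1 + z + y * W) = (1 + z) * x / y + x * W" for W
          using that by (simp add: field_simps)
        moreover have "x * (v * r + c * w * (1 / q) / t) = v * (r * b * (x / b)) + c / t * (w * x / q)"
          using that by (simp add: distrib_left mult_ac)
        ultimately show ?thesis by simp
      qed
      from this[of "real n" "ln (real (L n))"] show ?thesis unfolding R_def using elim l by simp
    qed
    finally show ?case using elim by simp
  qed
qed

lemma elephant_Nil: "elephant [] e = 1 / (2 * real CARD('d))"
  by (simp add: elephant_def u_eq)

lemma elephant_nonempty:
  assumes c: "1 - a = 2 * real CARD('d) * c" and "xs \<noteq> []"
  shows "elephant xs e = (c * real (length xs) + a * real (count_list xs e)) / real (length xs)"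
proof -
  have "(1 - a) * u = c" unfolding c by (simp add: u_eq)
  hence c': "c = (1 - a) * u" ..
  show ?thesis unfolding elephant_def excess_def c' using assms(2) by (simp add: field_simps)
qed

end

section \<open>The limit theorem\<close>

lemma sum_list_if_eq_count:
  "(\<Sum>y\<leftarrow>xs. if e = y then b else (c :: real)) = c * real (length xs) + (b - c) * real (count_list xs e)"
  by (induction xs) (auto simp: algebra_simps)

theorem theorem1p4:
  fixes M :: "'a measure" and p :: real
    and X :: "nat \<Rightarrow> 'a \<Rightarrow> int ^ 'd::finite" and u :: "nat \<Rightarrow> 'a \<Rightarrow> nat"
  assumes "0 \<le> p" and "p < 1"
    and "elephant_random_walk M p X u"
  shows "(CARD('d) = 2 \<longrightarrow> p < 5 / 8 \<longrightarrow>
            tendsto_L1 M (\<lambda>n \<omega>. ln (real n) / real n * real (card (walk_range X n \<omega>))) (\<lambda>\<omega>. pi)) \<and>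
         (CARD('d) \<ge> 3 \<longrightarrow>
            tendsto_L1 M (\<lambda>n \<omega>. real (card (walk_range X n \<omega>)) / real n)
              (\<lambda>\<omega>. escape_rate TYPE('d)))"
proof -
  interpret W: elephant_random_walk M p X u by (rule assms(3))
  define d where "d = real CARD('d)"
  define c where "c = (1 - p) / (2 * d - 1)"
  define a where "a = p - c"
  have walk: "reinforced_steps (directions :: (int ^ 'd) set) a" if "2 \<le> CARD('d)"
  proof
    have d: "2 \<le> d" using that by (simp add: d_def)
    have c: "0 < c" "c \<le> 1 / 2" using assms d by (auto simp: c_def field_simps)
    show "a < 1" "- 1 / 2 \<le> a" using assms c by (auto simp: a_def)
    have "1 - a = 2 * d * c" using d by (simp add: a_def c_def field_simps)
    thus "0 \<le> (1 - a) / real (card (directions :: (int ^ 'd) set)) + a"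
      using d assms by (simp add: card_directions a_def flip: d_def)
  qed auto
  have kernel: "W.mean_step_chance = reinforced_steps.elephant (directions :: (int ^ 'd) set) a" if d2: "2 \<le> CARD('d)"
  proof (intro ext)
    interpret lattice_walk a "TYPE('d)" unfolding lattice_walk_def by (rule walk[OF d2])
    have d: "2 \<le> d" using d2 by (simp add: d_def)
    have c: "1 - a = 2 * real CARD('d) * c" using d by (simp add: a_def c_def field_simps flip: d_def)
    fix xs :: "(int ^ 'd) list" and e
    show "W.mean_step_chance xs e = elephant xs e"
    proof (cases "xs = []")
      case True
      thus ?thesis by (simp add: W.mean_step_chance_def elephant_Nil)
    next
      case False
      have "W.mean_step_chance xs e = (c * real (length xs) + a * real (count_list xs e)) / real (length xs)"
        using False by (simp add: W.mean_step_chance_def W.step_chance_def sum_list_if_eq_count a_def c_def d_def)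
      also have "\<dots> = elephant xs e"
        by (rule elephant_nonempty[OF c False, symmetric])
      finally show ?thesis .
    qed
  qed
  have reduce: "tendsto_L1 M (\<lambda>n \<omega>. w n * real (card (walk_range X n \<omega>))) (\<lambda>\<omega>. l)"
    if "(\<lambda>n. expect directions W.mean_step_chance n (\<lambda>ys. \<bar>w n * real (card (sites ys)) - l\<bar>) []) \<longlonglongrightarrow> 0" for w l
    unfolding tendsto_L1_def
  proof (intro conjI allI)
    fix n
    show "integrable M (\<lambda>\<omega>. w n * real (card (walk_range X n \<omega>)))"
      using W.integrable_history[of "\<lambda>ys. w n * real (card (sites ys))" n] unfolding sites_history .
    show "integrable M (\<lambda>\<omega>. l)" by simp
    have "(\<integral>\<omega>. \<bar>w n * real (card (walk_range X n \<omega>)) - l\<bar> \<partial>M)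
        = expect directions W.mean_step_chance n (\<lambda>ys. \<bar>w n * real (card (sites ys)) - l\<bar>) []" for n
      using W.integral_history[of "\<lambda>ys. \<bar>w n * real (card (sites ys)) - l\<bar>" n] unfolding sites_history .
    thus "(\<lambda>n. \<integral>\<omega>. \<bar>w n * real (card (walk_range X n \<omega>)) - l\<bar> \<partial>M) \<longlonglongrightarrow> 0"
      using that by (simp only:)
  qed
  show ?thesis
  proof (intro conjI impI)
    assume d2: "CARD('d) = 2" and p: "p < 5 / 8"
    interpret lattice_walk a "TYPE('d)" unfolding lattice_walk_def by (rule walk) (simp add: d2)
    \<comment> \<open>for \<open>d = 2\<close> one has \<open>a = (4 * p - 1) / 3\<close>\<close>
    have a: "2 * a < 1" using p by (simp add: a_def c_def d_def d2 field_simps)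
    have "(\<lambda>n. expect directions elephant n (\<lambda>ys. \<bar>ln (real n) / real n * real (card (sites ys)) - pi\<bar>) []) \<longlonglongrightarrow> 0"
    proof (rule L1_convergence_criterion[OF elephant_kernel])
      fix n :: nat and ys :: "(int ^ 'd) list"
      show "0 \<le> ln (real n) / real n * real (card (sites ys))" by (cases "n = 0") auto
    next
      fix \<epsilon> \<tau> :: real assume *: "0 < \<epsilon>" "0 < \<tau>"
      show "\<forall>\<^sub>F n in sequentially. chance directions elephant n
          (\<lambda>ys. ln (real n) / real n * real (card (sites ys)) \<le> pi - \<epsilon>) [] \<le> \<tau>"
        using planar_lower_tail[OF d2 a *] eventually_ge_at_top[of 2]
      proof eventually_elim
        case (elim n)
        have rearrange: "l / y * x \<le> b \<longleftrightarrow> x \<le> b * (y / l)" if "0 < l" "0 < y" for l y x b :: real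
          using that by (simp add: field_simps)
        have pos: "0 < ln (real n)" "0 < real n" using elim(2) by auto
        show ?case unfolding rearrange[OF pos] by (rule elim(1))
      qed
    next
      fix \<epsilon> :: real assume "0 < \<epsilon>"
      thus "\<forall>\<^sub>F n in sequentially. expect directions elephant n
          (\<lambda>ys. ln (real n) / real n * real (card (sites ys))) [] \<le> pi + \<epsilon>"
        by (rule planar_upper[OF d2 a])
    qed simp
    hence "(\<lambda>n. expect directions W.mean_step_chance n (\<lambda>ys. \<bar>ln (real n) / real n * real (card (sites ys)) - pi\<bar>) []) \<longlonglongrightarrow> 0"
      by (simp only: kernel[OF eq_refl[OF d2[symmetric]]])
    thus "tendsto_L1 M (\<lambda>n \<omega>. ln (real n) / real n * real (card (walk_range X n \<omega>))) (\<lambda>\<omega>. pi)"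
      by (rule reduce)
  next
    assume d3: "3 \<le> CARD('d)"
    interpret lattice_walk a "TYPE('d)" unfolding lattice_walk_def by (rule walk) (use d3 in simp)
    have lim: "(\<lambda>n. expect directions elephant n (\<lambda>ys. \<bar>real (card (sites ys)) / real n - escape\<bar>) []) \<longlonglongrightarrow> 0"
    proof (rule L1_convergence_criterion[OF elephant_kernel])
      fix \<epsilon> \<tau> :: real assume *: "0 < \<epsilon>" "0 < \<tau>"
      show "\<forall>\<^sub>F n in sequentially. chance directions elephant n
          (\<lambda>ys. real (card (sites ys)) / real n \<le> escape - \<epsilon>) [] \<le> \<tau>"
        using transient_lower_tail[OF d3 *] eventually_gt_at_top[of 0]
        by eventually_elim (simp add: pos_divide_le_eq)
    next
      fix \<epsilon> :: real assume "0 < \<epsilon>"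
      thus "\<forall>\<^sub>F n in sequentially. expect directions elephant n
          (\<lambda>ys. real (card (sites ys)) / real n) [] \<le> escape + \<epsilon>"
        by (rule transient_upper[OF d3])
    qed (use escape_pos[OF d3] in simp_all)
    have "2 \<le> CARD('d)" using d3 by simp
    note kernel = kernel[OF this]
    have "(\<lambda>n. expect directions W.mean_step_chance n (\<lambda>ys. \<bar>1 / real n * real (card (sites ys)) - escape\<bar>) []) \<longlonglongrightarrow> 0"
      using lim by (simp only: kernel times_divide_eq_left mult_1_left)
    hence "tendsto_L1 M (\<lambda>n \<omega>. 1 / real n * real (card (walk_range X n \<omega>))) (\<lambda>\<omega>. escape)"
      by (rule reduce)
    thus "tendsto_L1 M (\<lambda>n \<omega>. real (card (walk_range X n \<omega>)) / real n) (\<lambda>\<omega>. escape_rate TYPE('d))"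
      by (simp only: escape_rate_eq[OF d3] times_divide_eq_left mult_1_left)
  qed
qed

end
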